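(* Let $d\ge1$, $\rho>0$ and $0<R_0<R_1<\dots<R_d$. (i) There is a constant $C_4=C_4(d,R_0,\dots,R_d,\rho)$ (depending only on $d,R_0,\dots,R_d,\rho$) such that for every nonempty compact set $K\subseteq B(0,\rho)\subseteq\mathbb{R}^d$ of positive reach with $\mathrm{Reach}(K)>R_d$ and every nonempty compact set $K_0\subseteq B(0,\rho)$, $$\big|\hat\Phi_k^{0,0}(K_0)-\Phi_k^{0,0}(K)\big|\le C_4\,d_H(K_0,K)\qquad\text{for all }k\in\{0,\dots,d\}.$$ (ii) For $r,s\in\mathbb{N}_0$ there is a constant $C_5=C_5(d,R_0,\dots,R_d,\rho,r,s)$ (depending only on the listed quantities) such that for all $K,K_0$ as in (i), $$\big|\hat\Phi_k^{r,s}(K_0)-\Phi_k^{r,s}(K)\big|\le C_5\,d_H(K_0,K)^{1/2}\qquad\text{for all }k\in\{0,\dots,d-1\}.$$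
   Context: Basic notation. $B(0,\rho)$ is the closed Euclidean ball in $\mathbb{R}^d$. $\mathcal{H}^d$ is $d$-dimensional Hausdorff (Lebesgue) measure. $\kappa_j$ is the volume of the unit ball in $\mathbb{R}^j$ ($\kappa_0=1$) and $\omega_j=j\kappa_j$ is the surface area of the unit sphere in $\mathbb{R}^j$. $\Sigma=\mathbb{R}^d\times S^{d-1}$. For a nonempty compact $K\subseteq\mathbb{R}^d$, $d_K(x)$ is the distance from $x$ to $K$, $K^R=\{x: d_K(x)\le R\}$, and $p_K(x)$ is the closest point of $K$ to $x$ when it is unique (this holds for almost every $x$). $\mathrm{Reach}(K)$ is the supremum of all $R\ge0$ such that every $x$ with $d_K(x)<R$ has a unique closest point in $K$. The Hausdorff distance is $d_H(K,M)=\inf\{\varepsilon>0: K\subseteq M^\varepsilon, M\subseteq K^\varepsilon\}$. Tensors. $\mathbb{T}^p$ is the space of symmetric rank-$p$ tensors over $\mathbb{R}^d$, viewed as symmetric $p$-linear maps $(\mathbb{R}^d)^p\to\mathbb{R}$, with norm $|T|=\sup\{|T(v_1,\dots,v_p)|:|v_1|=\dots=|v_p|=1\}$. For $x,y\in\mathbb{R}^d$, $x^ry^s\in\mathbb{T}^{r+s}$ is the symmetrization of $x^{\otimes r}\otimes y^{\otimes s}$ (average over all permutations of factors). Minkowski tensors. For compact $K$ of positive reach, the generalized curvature (support) measures $\Lambda_k(K;\cdot)$, $k=0,\dots,d-1$, are the signed Borel measures on $\Sigma$ determined by the local Steiner formula $$\mathcal{H}^d\Big(\Big\{x\in K^R\setminus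 K: \Big(p_K(x),\tfrac{x-p_K(x)}{|x-p_K(x)|}\Big)\in B\Big\}\Big)=\sum_{k=0}^{d-1}R^{d-k}\kappa_{d-k}\Lambda_k(K;B)$$ for all $0<R<\mathrm{Reach}(K)$ and all Borel $B\subseteq\Sigma$. For $k\in\{0,\dots,d-1\}$, $r,s\in\mathbb{N}_0$, $$\Phi_k^{r,s}(K)=\frac{1}{r!s!}\frac{\omega_{d-k}}{\omega_{d-k+s}}\int_\Sigma x^ru^s\,\Lambda_k(K;d(x,u))\in\mathbb{T}^{r+s},$$ and $\Phi_d^{r,0}(K)=\frac1{r!}\int_Kx^r\,dx$, $\Phi_d^{r,s}(K)=0$ for $s\ge1$. Estimators. For any nonempty compact $K_0\subseteq\mathbb{R}^d$ and $R>0$ put $\mathcal{V}_R^{r,s}(K_0)=\int_{K_0^R}p_{K_0}(x)^r(x-p_{K_0}(x))^s\,dx\in\mathbb{T}^{r+s}$. With the invertible $(d+1)\times(d+1)$ matrix $$A_{R_0,\dots,R_d}^{r,s}=r!s!\,\big(\kappa_{s+j}R_i^{s+j}\big)_{i,j=0,\dots,d}$$ the estimators are defined by $$\big(\hat\Phi_d^{r,s}(K_0),\hat\Phi_{d-1}^{r,s}(K_0),\dots,\hat\Phi_0^{r,s}(K_0)\big)^\top=\big(A_{R_0,\dots,R_d}^{r,s}\big)^{-1}\big(\mathcal{V}_{R_0}^{r,s}(K_0),\dots,\mathcal{V}_{R_d}^{r,s}(K_0)\big)^\top .$$ *)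

theory Defs
  imports
    "HOL-Analysis.Analysis"
    "HOL-Combinatorics.Permutations"
    "Jordan_Normal_Form.Gauss_Jordan_Elimination"
begin

text \<open>Euclidean space of dimension \<open>d\<close> is a type \<open>'a\<close> of class \<open>euclidean_space\<close>, with
  \<open>d = DIM('a)\<close>. The library's \<open>unit_ball_vol (real j)\<close> is the volume of the unit ball in
  dimension \<open>j\<close>, and \<open>closest_point K x\<close> is a point of \<open>K\<close> nearest to \<open>x\<close> (an arbitrary choice
  where it is not unique, which for compact \<open>K\<close> concerns a Lebesgue null set only).
  Integrals in space use \<open>lebesgue\<close> rather than \<open>lborel\<close>, since that choice need not be Borel
  measurable on the null set.\<close>

definition sphere_area :: "nat \<Rightarrow> real" where
  "sphere_area j = real j * unit_ball_vol (real j)"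


subsection \<open>Compact sets\<close>

definition parallel_set :: "'a::metric_space set \<Rightarrow> real \<Rightarrow> 'a set" where
  "parallel_set K R = {x. infdist x K \<le> R}"

definition hausdorff_distance :: "'a::metric_space set \<Rightarrow> 'a set \<Rightarrow> real" where
  "hausdorff_distance K M =
     Inf {\<epsilon>. \<epsilon> > 0 \<and> K \<subseteq> parallel_set M \<epsilon> \<and> M \<subseteq> parallel_set K \<epsilon>}"

text \<open>Extended real, as the reach may be infinite (convex sets).\<close>

definition reach :: "'a::metric_space set \<Rightarrow> ereal" where
  "reach K = Sup (ereal ` {R. R \<ge> 0 \<and>
     (\<forall>x. infdist x K < R \<longrightarrow> (\<exists>!y. y \<in> K \<and> (\<forall>z\<in>K. dist x y \<le> dist x z)))})"


subsection \<open>Tensors\<close>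

text \<open>A tensor of rank \<open>p\<close> is a symmetric \<open>p\<close>-linear form. Since \<open>p\<close> varies, the argument tuple
  is a sequence \<open>v :: nat \<Rightarrow> 'a\<close> of which only \<open>v 0, \<dots>, v (p - 1)\<close> matter. Tensor-valued
  integrals and matrix-vector products with tensor entries are evaluated argumentwise.\<close>

type_synonym 'a tensor = "(nat \<Rightarrow> 'a) \<Rightarrow> real"

definition tensor_norm :: "nat \<Rightarrow> 'a::real_normed_vector tensor \<Rightarrow> real" where
  "tensor_norm p T = Sup {\<bar>T v\<bar> |v. \<forall>i<p. norm (v i) = 1}"

text \<open>The tensor \<open>x\<^sup>r y\<^sup>s\<close>: the average over all permutations of the \<open>r + s\<close> factors,
  a vector being identified with the linear form given by the inner product.\<close>

definition sym_tensor :: "nat \<Rightarrow> nat \<Rightarrow> 'a::real_inner \<Rightarrow> 'a \<Rightarrow> 'a tensor" where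
  "sym_tensor r s x y = (\<lambda>v. (\<Sum>\<pi> | \<pi> permutes {..<r + s}.
     \<Prod>i<r + s. inner (if i < r then x else y) (v (\<pi> i))) / fact (r + s))"


subsection \<open>Finite signed measures\<close>

definition signed_measure :: "'b measure \<Rightarrow> ('b set \<Rightarrow> real) \<Rightarrow> bool" where
  "signed_measure M \<mu> \<longleftrightarrow> \<mu> {} = 0 \<and>
     (\<forall>A :: nat \<Rightarrow> 'b set. range A \<subseteq> sets M \<longrightarrow> disjoint_family A \<longrightarrow>
        (\<lambda>i. \<mu> (A i)) sums \<mu> (\<Union>i. A i))"

text \<open>The positive part of the Jordan decomposition of a signed measure; the truncation of
  negative values by \<open>ennreal\<close> does not affect the supremum, as \<open>\<mu> {} = 0\<close>.
  The negative part is the positive part of \<open>- \<mu>\<close>.\<close>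

definition positive_part :: "'b measure \<Rightarrow> ('b set \<Rightarrow> real) \<Rightarrow> 'b measure" where
  "positive_part M \<mu> = measure_of (space M) (sets M)
     (\<lambda>A. SUP B\<in>{B \<in> sets M. B \<subseteq> A}. ennreal (\<mu> B))"

definition signed_integral :: "'b measure \<Rightarrow> ('b set \<Rightarrow> real) \<Rightarrow> ('b \<Rightarrow> real) \<Rightarrow> real" where
  "signed_integral M \<mu> f =
     integral\<^sup>L (positive_part M \<mu>) f - integral\<^sup>L (positive_part M (\<lambda>A. - \<mu> A)) f"


subsection \<open>Support measures and Minkowski tensors\<close>

definition normal_bundle_space :: "('a::euclidean_space \<times> 'a) measure" where
  "normal_bundle_space = restrict_space borel (UNIV \<times> sphere 0 1)"

definition is_support_measures ::
    "'a::euclidean_space set \<Rightarrow> (nat \<Rightarrow> ('a \<times> 'a) set \<Rightarrow> real) \<Rightarrow> bool" where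
  "is_support_measures K \<Lambda> \<longleftrightarrow>
     (\<forall>k<DIM('a). signed_measure normal_bundle_space (\<Lambda> k)) \<and>
     (\<forall>R B. 0 < R \<longrightarrow> ereal R < reach K \<longrightarrow> B \<in> sets normal_bundle_space \<longrightarrow>
        measure lebesgue {x \<in> parallel_set K R - K.
          (closest_point K x, (x - closest_point K x) /\<^sub>R norm (x - closest_point K x)) \<in> B} =
        (\<Sum>k<DIM('a). R ^ (DIM('a) - k) * unit_ball_vol (real (DIM('a) - k)) * \<Lambda> k B))"

text \<open>For compact sets of positive reach such a family exists by Federer's local Steiner formula.
  Comparing coefficients of polynomials in \<open>R\<close>, its values at \<open>k < d\<close> and on Borel sets are
  unique; the choice is thus irrelevant for the Minkowski tensors.\<close>

definition support_measure ::
    "'a::euclidean_space set \<Rightarrow> nat \<Rightarrow> ('a \<times> 'a) set \<Rightarrow> real" where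
  "support_measure K = (SOME \<Lambda>. is_support_measures K \<Lambda>)"

definition minkowski_tensor ::
    "nat \<Rightarrow> nat \<Rightarrow> nat \<Rightarrow> 'a::euclidean_space set \<Rightarrow> 'a tensor" where
  "minkowski_tensor k r s K = (\<lambda>v.
     if k < DIM('a) then
       1 / (fact r * fact s) * (sphere_area (DIM('a) - k) / sphere_area (DIM('a) - k + s)) *
       signed_integral normal_bundle_space (support_measure K k) (\<lambda>(x, u). sym_tensor r s x u v)
     else if k = DIM('a) \<and> s = 0 then
       1 / fact r * set_lebesgue_integral lebesgue K (\<lambda>x. sym_tensor r 0 x 0 v)
     else 0)"


subsection \<open>Estimators\<close>

definition voronoi_tensor ::
    "nat \<Rightarrow> nat \<Rightarrow> real \<Rightarrow> 'a::euclidean_space set \<Rightarrow> 'a tensor" where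
  "voronoi_tensor r s R K = (\<lambda>v. set_lebesgue_integral lebesgue (parallel_set K R)
     (\<lambda>x. sym_tensor r s (closest_point K x) (x - closest_point K x) v))"

definition steiner_matrix :: "nat \<Rightarrow> nat \<Rightarrow> nat \<Rightarrow> (nat \<Rightarrow> real) \<Rightarrow> real mat" where
  "steiner_matrix d r s R = Matrix.mat (d + 1) (d + 1)
     (\<lambda>(i, j). fact r * fact s * (unit_ball_vol (real (s + j)) * R i ^ (s + j)))"

text \<open>The solution vector lists the estimators in the order \<open>d, d - 1, \<dots>, 0\<close>, so the one with
  index \<open>k\<close> is at position \<open>d - k\<close>. The matrix is invertible for \<open>0 < R 0 < \<dots> < R d\<close>, in which
  case \<open>mat_inverse\<close> returns \<open>Some\<close> of the inverse.\<close>

definition minkowski_estimator ::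
    "(nat \<Rightarrow> real) \<Rightarrow> nat \<Rightarrow> nat \<Rightarrow> nat \<Rightarrow> 'a::euclidean_space set \<Rightarrow> 'a tensor" where
  "minkowski_estimator R k r s K = (\<lambda>v.
     vec_index
       (mult_mat_vec (the (mat_inverse (steiner_matrix DIM('a) r s R)))
         (Matrix.vec (DIM('a) + 1) (\<lambda>i. voronoi_tensor r s (R i) K v)))
       (DIM('a) - k))"

end

theory Submission
  imports Defs "HOL-Computational_Algebra.Polynomial" "Jordan_Normal_Form.Determinant"
begin

text \<open>
  Writing \<open>p\<close> for the nearest-point map of a set \<open>K\<close> with \<open>reach K > r\<close>, Brouwer's fixed point
  theorem prolongs normal segments, which shows that \<open>p\<close> is monotone on the parallel set of radius
  \<open>r\<close>. The maps \<open>l id + (1 - l) p\<close> with \<open>0 < l \<le> 1\<close> shrink local tubes by the factor \<open>l\<close>. Replacing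
  \<open>p\<close> by smooth monotone approximations, the change of variables formula expresses volumes of images
  as integrals of Jacobians, which are polynomials of degree at most \<open>d\<close> in \<open>l\<close>; polynomials of
  bounded degree are closed under pointwise limits, so the volume of a local tube is a polynomial in
  its radius. This is the local Steiner formula, whence the support measures exist, are differences of
  finite measures, and the Voronoi tensors of \<open>K\<close> are \<open>A\<close> times the Minkowski tensors.

  It remains to compare the Voronoi tensors of \<open>K\<close> and \<open>K\<^sub>0\<close>. The domains of integration differ by
  shells of volume \<open>O(\<epsilon>)\<close>, \<open>\<epsilon>\<close> being the Hausdorff distance, and at distance \<open>t < b\<close> from \<open>K\<close>, with
  \<open>b = R DIM('a)\<close>, the nearest points differ by \<open>O(sqrt (\<epsilon> / (1 - t / b)))\<close>, whose singularity at
  \<open>t = b\<close> is integrable, uniformly in \<open>K\<close>, because the shells have volume proportional to their width.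
\<close>

text \<open>The obstacle in the Steiner formula is that the nearest-point map, though monotone, need
  not be differentiable, so \<open>rescale l\<close> has no Jacobian of its own. The Jacobians of
  its smooth approximations need not converge. What passes to the limit is the Lagrange identity
  that expresses the transported integral for every \<open>l\<close> through those at d + 1 fixed
  values of \<open>l\<close>.

  The obstacle in the stability estimate is uniformity: the constants may depend on the largest
  radius b, but not on the margin by which the reach of K exceeds b. Hence the monotonicity constant
  1 - t / b has to be used up to t = b, where it degenerates. The exponent 1/2 arises because an
  error \<open>\<epsilon>\<close> in the distance controls only the square of the displacement of
  nearest points.

  The Lipschitz constant of the tensors carries a factor r + s. It is kept explicit throughout: it
  is 0 for r = s = 0, so that a single estimate yields both the linear bound and the root
  bound.\<close>

no_notation Matrix.scalar_prod (infix "\<bullet>" 70)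

section \<open>Polynomial interpolation\<close>

text \<open>\<open>W k i\<close> is the coefficient of degree \<open>k\<close> in the
  \<open>i\<close>-th Lagrange basis polynomial, so \<open>W\<close> inverts the Vandermonde matrix
  of the nodes. That coefficients are fixed linear combinations of values later makes the support
  measures combinations of tube measures and the estimator matrix invertible.\<close>

lemma vandermonde_weights:
  fixes x :: "nat \<Rightarrow> real"
  assumes inj: "inj_on x {..n}"
  obtains W :: "nat \<Rightarrow> nat \<Rightarrow> real"
  where "\<And>c k. k \<le> n \<Longrightarrow> (\<Sum>i\<le>n. W k i * (\<Sum>j\<le>n. c j * x i ^ j)) = c k"
proof -
  define l where "l i = (\<Prod>j\<in>{..n}-{i}. Polynomial.smult (1 / (x i - x j)) [:- x j, 1:])" for i
  have deg_l: "degree (l i) \<le> n" if "i \<le> n" for i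
  proof -
    have "degree (l i) \<le> (\<Sum>j\<in>{..n}-{i}. degree (Polynomial.smult (1 / (x i - x j)) [:- x j, 1:]))"
      unfolding l_def using degree_prod_sum_le[of "{..n}-{i}" "\<lambda>j. Polynomial.smult (1 / (x i - x j)) [:- x j, 1:]"] by (simp add: o_def)
    also have "\<dots> \<le> (\<Sum>j\<in>{..n}-{i}. 1)"
      by (rule sum_mono) (auto intro: order.trans[OF degree_smult_le])
    also have "\<dots> = n" using that by simp
    finally show ?thesis .
  qed
  have l_node: "poly (l i) (x m) = (if i = m then 1 else 0)" if "i \<le> n" "m \<le> n" for i m
  proof (cases "i = m")
    case True
    have "x m \<noteq> x j" if "j \<in> {..n} - {m}" for j
      using inj that \<open>m \<le> n\<close> by (auto simp: inj_on_def)
    then have "poly (Polynomial.smult (1 / (x i - x j)) [:- x j, 1:]) (x m) = 1" if "j \<in> {..n} - {i}" for j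
      using that True by (simp add: divide_simps)
    then show ?thesis using True by (simp add: l_def poly_prod)
  next
    case False
    then have "poly (l i) (x m) = 0"
      unfolding l_def poly_prod using that by (intro prod_zero) (auto intro!: bexI[of _ m])
    then show ?thesis using False by simp
  qed
  show ?thesis
  proof
    fix c :: "nat \<Rightarrow> real" and k assume k: "k \<le> n"
    define q where "q = (\<Sum>j\<le>n. monom (c j) j)"
    define q' where "q' = (\<Sum>i\<le>n. Polynomial.smult (\<Sum>j\<le>n. c j * x i ^ j) (l i))"
    have "degree q \<le> n" unfolding q_def
      by (rule degree_sum_le) (auto intro: order.trans[OF degree_monom_le])
    moreover have "degree q' \<le> n" unfolding q'_def
      by (rule degree_sum_le) (auto intro: order.trans[OF degree_smult_le] deg_l)
    moreover have "poly q (x m) = poly q' (x m)" if "m \<le> n" for m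
      using that by (simp add: q_def q'_def poly_sum poly_monom l_node if_distrib cong: if_cong)
    ultimately have "q = q'"
      using inj by (intro poly_eqI_degree[of "x ` {..n}"]) (auto simp: card_image)
    then have "coeff q k = coeff q' k" by simp
    then show "(\<Sum>i\<le>n. coeff (l i) k * (\<Sum>j\<le>n. c j * x i ^ j)) = c k"
      using k by (simp add: q_def q'_def coeff_sum mult.commute)
  qed
qed

text \<open>The weights at \<open>t\<close> do not depend on \<open>p\<close>, so the identity
  survives pointwise limits of polynomials of degree at most \<open>n\<close>; this is the form in
  which such limits are taken below.\<close>

lemma lagrange_weights:
  fixes x :: "nat \<Rightarrow> real"
  assumes inj: "inj_on x {..n}"
  obtains L :: "nat \<Rightarrow> real poly"
  where "\<And>i. i \<le> n \<Longrightarrow> degree (L i) \<le> n"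
    "\<And>p t. degree p \<le> n \<Longrightarrow> poly p t = (\<Sum>i\<le>n. poly (L i) t * poly p (x i))"
proof -
  obtain W where W: "\<And>c k. k \<le> n \<Longrightarrow> (\<Sum>i\<le>n. W k i * (\<Sum>j\<le>n. c j * x i ^ j)) = c k"
    using vandermonde_weights[OF inj] by blast
  define L where "L i = (\<Sum>k\<le>n. monom (W k i) k)" for i
  show ?thesis
  proof
    show "degree (L i) \<le> n" for i unfolding L_def
      by (rule degree_sum_le) (auto intro: order.trans[OF degree_monom_le])
    fix p :: "real poly" and t assume p: "degree p \<le> n"
    have ev: "poly p s = (\<Sum>k\<le>n. coeff p k * s ^ k)" for s
      by (subst poly_as_sum_of_monoms'[OF p, symmetric]) (simp add: poly_sum poly_monom)
    have "poly p t = (\<Sum>k\<le>n. (\<Sum>i\<le>n. W k i * (\<Sum>j\<le>n. coeff p j * x i ^ j)) * t ^ k)"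
      by (simp add: ev W)
    also have "\<dots> = (\<Sum>k\<le>n. \<Sum>i\<le>n. W k i * t ^ k * poly p (x i))"
      by (simp add: ev sum_distrib_right sum_distrib_left mult_ac)
    also have "\<dots> = (\<Sum>i\<le>n. \<Sum>k\<le>n. W k i * t ^ k * poly p (x i))"
      by (rule sum.swap)
    also have "\<dots> = (\<Sum>i\<le>n. poly (L i) t * poly p (x i))"
      by (simp add: L_def poly_sum poly_monom sum_distrib_right)
    finally show "poly p t = (\<Sum>i\<le>n. poly (L i) t * poly p (x i))" .
  qed
qed


section \<open>Change of variables in a Euclidean space\<close>

text \<open>The library's change of variables lives on \<open>real ^ 'n\<close> with a well-ordered index type;
  the index type below serves to transfer it to an arbitrary Euclidean space.\<close>

typedef (overloaded) ('a::euclidean_space) basis_index = "Basis :: 'a set"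
  using nonempty_Basis by blast

lemma basis_index_range: "range (Rep_basis_index :: 'a::euclidean_space basis_index \<Rightarrow> 'a) = Basis"
  by (simp add: type_definition.Rep_range[OF type_definition_basis_index])

lemma inj_Rep_basis_index: "inj Rep_basis_index"
  by (simp add: inj_on_def Rep_basis_index_inject)

instance basis_index :: (euclidean_space) finite
proof
  have "finite (range (Rep_basis_index :: 'a basis_index \<Rightarrow> 'a))"
    by (simp add: basis_index_range)
  then show "finite (UNIV :: 'a basis_index set)"
    using finite_imageD inj_Rep_basis_index by blast
qed

text \<open>Any injection into the naturals would do: the induced well-order only makes
  \<open>basis_index\<close> an admissible index type and has no geometric meaning.\<close>

definition basis_number :: "'a::euclidean_space basis_index \<Rightarrow> nat" where
  "basis_number i = to_nat_on Basis (Rep_basis_index i)"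

lemma inj_basis_number: "inj basis_number"
  unfolding inj_on_def basis_number_def
  by (metis Rep_basis_index Rep_basis_index_inject countable_finite finite_Basis to_nat_on_inj)

instantiation basis_index :: (euclidean_space) wellorder
begin
definition "i \<le> j \<longleftrightarrow> basis_number i \<le> basis_number j" for i j :: "'a basis_index"
definition "i < j \<longleftrightarrow> basis_number i < basis_number j" for i j :: "'a basis_index"
instance
proof
  fix P :: "'a basis_index \<Rightarrow> bool" and a
  assume *: "\<And>x. (\<And>y. y < x \<Longrightarrow> P y) \<Longrightarrow> P x"
  show "P a"
    by (induction "basis_number a" arbitrary: a rule: less_induct)
       (use * less_basis_index_def in blast)
qed (use inj_basis_number in \<open>auto simp: less_eq_basis_index_def less_basis_index_def inj_on_def\<close>)
end

lemma CARD_basis_index: "CARD('a basis_index) = DIM('a::euclidean_space)"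
  by (simp add: type_definition.card[OF type_definition_basis_index])

definition to_coords :: "'a::euclidean_space \<Rightarrow> real ^ 'a basis_index" where
  "to_coords x = (\<chi> i. x \<bullet> Rep_basis_index i)"

definition of_coords :: "real ^ 'a basis_index \<Rightarrow> 'a::euclidean_space" where
  "of_coords y = (\<Sum>i\<in>UNIV. vec_nth y i *\<^sub>R Rep_basis_index i)"

lemma inner_Rep_basis_index:
  "(Rep_basis_index i :: 'a::euclidean_space) \<bullet> Rep_basis_index j = (if i = j then 1 else 0)"
  using Rep_basis_index[of i] Rep_basis_index[of j]
  by (simp add: inner_Basis Rep_basis_index_inject)

lemma sum_Basis_index: "(\<Sum>b\<in>Basis. f b) = (\<Sum>i\<in>UNIV. f (Rep_basis_index (i :: 'a::euclidean_space basis_index)))"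
  by (subst basis_index_range[symmetric], subst sum.reindex[OF inj_Rep_basis_index]) simp

lemma prod_Basis_index: "(\<Prod>b\<in>Basis. f b) = (\<Prod>i\<in>UNIV. f (Rep_basis_index (i :: 'a::euclidean_space basis_index)))"
  by (subst basis_index_range[symmetric], subst prod.reindex[OF inj_Rep_basis_index]) simp

lemma of_to_coords [simp]: "of_coords (to_coords x) = x"
  by (simp add: of_coords_def to_coords_def sum_Basis_index[symmetric, of "\<lambda>b. (x \<bullet> b) *\<^sub>R b"] euclidean_representation)

lemma to_of_coords [simp]: "to_coords (of_coords y) = y"
  by (simp add: of_coords_def to_coords_def Finite_Cartesian_Product.vec_eq_iff inner_sum_left inner_Rep_basis_index if_distrib
      cong: if_cong)

lemma linear_to_coords [simp]: "linear to_coords"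
  by (rule linearI) (auto simp: to_coords_def Finite_Cartesian_Product.vec_eq_iff inner_add_left)

lemma linear_of_coords [simp]: "linear of_coords"
  by (rule linearI) (auto simp: of_coords_def sum.distrib scaleR_add_left scaleR_sum_right)

lemma bounded_linear_to_coords [simp]: "bounded_linear to_coords"
  by (simp add: linear_conv_bounded_linear[symmetric])

lemma bounded_linear_of_coords [simp]: "bounded_linear of_coords"
  by (simp add: linear_conv_bounded_linear[symmetric])

lemma continuous_on_to_coords: "continuous_on S to_coords"
  and continuous_on_of_coords: "continuous_on S' of_coords"
  by (simp_all add: linear_continuous_on)

lemma measurable_to_coords [measurable]: "to_coords \<in> borel \<rightarrow>\<^sub>M borel"
  by (rule borel_measurable_continuous_onI) (rule continuous_on_to_coords)

lemma inj_to_coords: "inj to_coords" by (metis injI of_to_coords)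

lemma inj_of_coords: "inj of_coords" by (metis injI to_of_coords)

text \<open>\<open>to_coords\<close> matches coordinate boxes with coordinate boxes of the same side
  lengths, and Lebesgue measure is determined by its values on boxes.\<close>

lemma distr_to_coords: "distr lborel borel (to_coords :: 'a::euclidean_space \<Rightarrow> _) = lborel"
proof (rule lborel_eqI[symmetric])
  fix l u :: "real ^ 'a basis_index"
  assume le: "\<And>b. b \<in> Basis \<Longrightarrow> l \<bullet> b \<le> u \<bullet> b"
  have lu: "vec_nth l i \<le> vec_nth u i" for i
    using le[of "axis i 1"] by (simp add: inner_axis axis_in_Basis_iff)
  have "to_coords -` box l u = (box (of_coords l) (of_coords u) :: 'a set)"
  proof (rule Set.set_eqI)
    fix x :: 'a
    have *: "of_coords y \<bullet> (Rep_basis_index i :: 'a) = vec_nth y i" for y :: "real ^ 'a basis_index" and i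
      by (metis to_of_coords to_coords_def vec_lambda_beta)
    have "x \<in> box (of_coords l) (of_coords u) \<longleftrightarrow>
        (\<forall>b\<in>range (Rep_basis_index :: _ \<Rightarrow> 'a). of_coords l \<bullet> b < x \<bullet> b \<and> x \<bullet> b < of_coords u \<bullet> b)"
      by (simp only: basis_index_range mem_box)
    then show "x \<in> to_coords -` box l u \<longleftrightarrow> x \<in> box (of_coords l) (of_coords u)"
      by (simp only: vimage_eq mem_box_cart * to_coords_def ball_simps UNIV_I vec_lambda_beta)
  qed
  moreover have "emeasure lborel (box (of_coords l) (of_coords u) :: 'a set) = (\<Prod>b\<in>Basis. (u - l) \<bullet> b)"
  proof -
    have *: "of_coords y \<bullet> (Rep_basis_index i :: 'a) = vec_nth y i" for y :: "real ^ 'a basis_index" and i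
      by (metis to_of_coords to_coords_def vec_lambda_beta)
    have le': "of_coords l \<bullet> b \<le> of_coords u \<bullet> b" if "b \<in> Basis" for b :: 'a
    proof -
      obtain i where i: "b = Rep_basis_index i" using \<open>b \<in> Basis\<close> unfolding basis_index_range[symmetric] by blast
      show ?thesis unfolding i * by (rule lu)
    qed
    have "emeasure lborel (box (of_coords l) (of_coords u) :: 'a set) = (\<Prod>b\<in>Basis. (of_coords u - of_coords l :: 'a) \<bullet> b)"
      by (rule emeasure_lborel_box[OF le'])
    also have "(\<Prod>b\<in>Basis. (of_coords u - of_coords l :: 'a) \<bullet> b) = (\<Prod>i\<in>UNIV. vec_nth (u - l) i)"
      by (simp add: prod_Basis_index inner_diff_left *)
    also have "\<dots> = (\<Prod>b\<in>Basis. (u - l) \<bullet> b)"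
    proof -
      have "(\<Prod>b\<in>Basis. (u - l) \<bullet> b) = (\<Prod>b\<in>range (\<lambda>i. axis i 1). (u - l) \<bullet> b)"
        by (rule prod.cong) (auto simp: Basis_vec_def)
      also have "\<dots> = (\<Prod>i\<in>UNIV. vec_nth (u - l) i)"
        by (subst prod.reindex) (auto simp: inj_on_def axis_eq_axis inner_axis)
      finally show ?thesis by simp
    qed
    finally show ?thesis .
  qed
  ultimately show "emeasure (distr lborel borel (to_coords :: 'a \<Rightarrow> _)) (box l u) = (\<Prod>b\<in>Basis. (u - l) \<bullet> b)"
    by (simp add: emeasure_distr)
qed simp

lemma integral_to_coords:
  fixes f :: "real ^ 'a::euclidean_space basis_index \<Rightarrow> real"
  assumes "f \<in> borel_measurable borel"
  shows "integral\<^sup>L lborel f = integral\<^sup>L lborel (\<lambda>x. f (to_coords x))"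
  using integral_distr[of to_coords lborel borel f] assms by (simp add: distr_to_coords)

lemma integrable_to_coords:
  fixes f :: "real ^ 'a::euclidean_space basis_index \<Rightarrow> real"
  assumes "f \<in> borel_measurable borel"
  shows "integrable lborel f \<longleftrightarrow> integrable lborel (\<lambda>x. f (to_coords x))"
  using integrable_distr_eq[of to_coords lborel borel f] assms by (simp add: distr_to_coords)

section \<open>Determinants of endomorphisms\<close>

definition lin_det :: "('a::euclidean_space \<Rightarrow> 'a) \<Rightarrow> real" where
  "lin_det L = Determinants.det (matrix (\<lambda>y. to_coords (L (of_coords y))))"

text \<open>In the Leibniz expansion each of the \<open>DIM('a)\<close> factors is affine in
  \<open>t\<close>. This is where the degree bound of the Steiner polynomial comes from.\<close>

lemma lin_det_pencil:
  fixes A B :: "'a::euclidean_space \<Rightarrow> 'a"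
  obtains p where "degree p \<le> DIM('a)"
    "\<And>t::real. lin_det (\<lambda>v. t *\<^sub>R A v + (1 - t) *\<^sub>R B v) = poly p t"
proof -
  define a where "a = matrix (\<lambda>y. to_coords (A (of_coords y)))"
  define b where "b = matrix (\<lambda>y. to_coords (B (of_coords y)))"
  define p where "p = (\<Sum>\<pi> | \<pi> permutes (UNIV :: 'a basis_index set). Polynomial.smult (of_int (sign \<pi>))
     (\<Prod>i\<in>UNIV. [:vec_nth (vec_nth b i) (\<pi> i), vec_nth (vec_nth a i) (\<pi> i) - vec_nth (vec_nth b i) (\<pi> i):]))"
  show ?thesis
  proof
    have "degree (\<Prod>i\<in>UNIV. [:vec_nth (vec_nth b i) (\<pi> i), vec_nth (vec_nth a i) (\<pi> i) - vec_nth (vec_nth b i) (\<pi> i):]) \<le> DIM('a)"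
      for \<pi> :: "'a basis_index \<Rightarrow> 'a basis_index"
    proof -
      have "degree (\<Prod>i\<in>UNIV. [:vec_nth (vec_nth b i) (\<pi> i), vec_nth (vec_nth a i) (\<pi> i) - vec_nth (vec_nth b i) (\<pi> i):])
        \<le> (\<Sum>i\<in>UNIV. degree [:vec_nth (vec_nth b i) (\<pi> i), vec_nth (vec_nth a i) (\<pi> i) - vec_nth (vec_nth b i) (\<pi> i):])"
        using degree_prod_sum_le[of UNIV "\<lambda>i. [:vec_nth (vec_nth b i) (\<pi> i), vec_nth (vec_nth a i) (\<pi> i) - vec_nth (vec_nth b i) (\<pi> i):]"] by (simp add: o_def)
      also have "\<dots> \<le> (\<Sum>i\<in>(UNIV::'a basis_index set). 1)"
        by (rule sum_mono) simp
      finally show ?thesis by (simp add: CARD_basis_index)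
    qed
    then show "degree p \<le> DIM('a)"
      unfolding p_def by (intro degree_sum_le) (auto intro: order.trans[OF degree_smult_le])
    fix t :: real
    have "vec_nth (vec_nth (matrix (\<lambda>y. to_coords (t *\<^sub>R A (of_coords y) + (1 - t) *\<^sub>R B (of_coords y)))) i) j =
       vec_nth (vec_nth b i) j + t * (vec_nth (vec_nth a i) j - vec_nth (vec_nth b i) j)" for i j
      by (simp add: matrix_def a_def b_def to_coords_def inner_add_left algebra_simps)
    then show "lin_det (\<lambda>v. t *\<^sub>R A v + (1 - t) *\<^sub>R B v) = poly p t"
      by (simp add: lin_det_def Determinants.det_def p_def poly_sum poly_prod)
  qed
qed

lemma lin_det_id: "lin_det (\<lambda>v. v) = 1"
  by (simp add: lin_det_def matrix_id_mat_1[unfolded id_def])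

lemma lin_det_nz:
  assumes "linear L" "inj L"
  shows "lin_det L \<noteq> 0"
proof -
  have "linear (\<lambda>y. to_coords (L (of_coords y)))"
    using linear_compose[OF linear_compose[OF linear_of_coords assms(1)] linear_to_coords] by (simp add: o_def)
  moreover have "inj (\<lambda>y. to_coords (L (of_coords y)))"
    by (intro injI) (metis assms(2) injD inj_to_coords inj_of_coords)
  ultimately show ?thesis
    by (simp add: lin_det_def det_nz_iff_inj)
qed

text \<open>Positivity by connecting \<open>L\<close> to the identity through invertible maps.\<close>

lemma lin_det_pos:
  fixes L :: "'a::euclidean_space \<Rightarrow> 'a"
  assumes lin: "linear L" and pos: "\<And>v. v \<noteq> 0 \<Longrightarrow> L v \<bullet> v > 0"
  shows "lin_det L > 0"
proof -
  obtain p where p: "\<And>t::real. lin_det (\<lambda>v. t *\<^sub>R L v + (1 - t) *\<^sub>R v) = poly p t"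
    using lin_det_pencil[of L "\<lambda>v. v"] by metis
  have nz: "poly p t \<noteq> 0" if t: "0 \<le> t" "t \<le> 1" for t
  proof -
    let ?M = "\<lambda>v. t *\<^sub>R L v + (1 - t) *\<^sub>R v"
    have "linear ?M"
      using lin by (intro linearI) (auto simp: linear_add linear_scale algebra_simps)
    moreover have "?M v = 0 \<Longrightarrow> v = 0" for v
    proof (rule ccontr)
      assume "?M v = 0" "v \<noteq> 0"
      then have "t * (L v \<bullet> v) + (1 - t) * (v \<bullet> v) = 0"
        by (metis inner_add_left inner_scaleR_left inner_zero_left)
      moreover have "t * (L v \<bullet> v) + (1 - t) * (v \<bullet> v) > 0"
        using pos[OF \<open>v \<noteq> 0\<close>] \<open>v \<noteq> 0\<close> t
        by (cases "t = 0") (simp, intro add_pos_nonneg, auto)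
      ultimately show False by simp
    qed
    ultimately have "lin_det ?M \<noteq> 0"
      by (intro lin_det_nz) (use linear_injective_0 in blast)+
    then show ?thesis by (simp add: p)
  qed
  have p0: "poly p 0 = 1" "poly p 1 = lin_det L"
    using p[of 0] p[of 1] by (simp_all add: lin_det_id)
  show ?thesis
  proof (rule ccontr)
    assume "\<not> ?thesis"
    then have "poly p 1 \<le> 0" using p0 by simp
    then obtain t where "0 \<le> t" "t \<le> 1" "poly p t = 0"
      using IVT2'[of "poly p" 1 0 0] p0(1) continuous_on_poly[OF continuous_on_id, of "{0..1}" p] by auto
    then show False using nz by blast
  qed
qed

text \<open>\<open>f'\<close> is not assumed continuous, so measurability of the integrand is a
  hypothesis; it carries integrability from \<open>lebesgue\<close> down to \<open>lborel\<close>.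
  The function \<open>g\<close> need only live on the image, which suits the later use with a
  function composed with the inverse of \<open>f\<close>.\<close>

lemma change_of_variables:
  fixes f :: "'a::euclidean_space \<Rightarrow> 'a" and g :: "'a \<Rightarrow> real"
  assumes S: "compact S"
    and der: "\<And>x. x \<in> S \<Longrightarrow> (f has_derivative f' x) (at x within S)"
    and inj: "inj_on f S"
    and g: "continuous_on (f ` S) g"
    and meas: "(\<lambda>x. indicator S x * (\<bar>lin_det (f' x)\<bar> * g (f x))) \<in> borel_measurable borel"
  shows "integrable lborel (\<lambda>x. indicator S x * (\<bar>lin_det (f' x)\<bar> * g (f x)))" (is "integrable lborel ?h")
    and "(\<integral>x. indicator S x * (\<bar>lin_det (f' x)\<bar> * g (f x)) \<partial>lborel) = (\<integral>y. indicator (f ` S) y * g y \<partial>lborel)"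
proof -
  let ?S = "to_coords ` S"
  define F where "F = (\<lambda>y. to_coords (f (of_coords y)))"
  define F' where "F' = (\<lambda>y v. to_coords (f' (of_coords y) (of_coords v)))"
  have cf: "continuous_on S f"
    using der by (auto simp: continuous_on_eq_continuous_within intro: has_derivative_continuous)
  have cS: "compact ?S" "compact (f ` S)" "compact (to_coords ` f ` S)"
    using S cf by (auto intro!: compact_continuous_image continuous_on_to_coords)
  have FS: "F ` ?S = to_coords ` f ` S"
    by (auto simp: F_def image_image)
  have SS: "?S \<in> sets lebesgue"
    using cS(1) by (simp add: lmeasurable_compact fmeasurableD)
  have derF: "(F has_derivative F' y) (at y within ?S)" if "y \<in> ?S" for y
  proof -
    obtain x where x: "x \<in> S" "y = to_coords x" using \<open>y \<in> ?S\<close> by blast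
    have "of_coords ` ?S = S" by (auto simp: image_image)
    then have "(f has_derivative f' x) (at (of_coords y) within of_coords ` ?S)"
      using der x by simp
    then have "((f \<circ> of_coords) has_derivative (f' x \<circ> of_coords)) (at y within ?S)"
      by (intro diff_chain_within) (auto intro: bounded_linear_imp_has_derivative)
    then have "((\<lambda>y. to_coords ((f \<circ> of_coords) y)) has_derivative (\<lambda>v. to_coords ((f' x \<circ> of_coords) v))) (at y within ?S)"
      by (rule bounded_linear.has_derivative[OF bounded_linear_to_coords])
    then show ?thesis using x by (simp add: F_def F'_def o_def)
  qed
  have injF: "inj_on F ?S"
    using inj inj_to_coords by (auto simp: inj_on_def F_def)
  have "continuous_on (to_coords ` f ` S) (\<lambda>y. g (of_coords y))"
    by (rule continuous_on_compose2[OF g continuous_on_of_coords]) auto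
  \<comment> \<open>A vector with a single entry:
    \<open>has_absolute_integral_change_of_variables\<close> takes vector-valued integrands.\<close>
  define G :: "_ \<Rightarrow> real ^ 1" where "G = (\<lambda>y. \<chi> _. g (of_coords y))"
  have cG: "continuous_on (F ` ?S) G"
    unfolding G_def FS by (intro continuous_on_vec_lambda) fact
  have absG: "G absolutely_integrable_on (F ` ?S)"
  proof -
    have *: "integrable lborel (\<lambda>y. indicator (F ` ?S) y *\<^sub>R G y)"
      using borel_integrable_compact[OF cS(3), of G] cG unfolding FS by blast
    show ?thesis
      unfolding set_integrable_def using * borel_measurable_integrable[OF *] by (simp add: integrable_completion)
  qed
  define D where "D = (\<lambda>y. \<bar>Determinants.det (matrix (F' y))\<bar> *\<^sub>R G (F y))"
  have cov: "D absolutely_integrable_on ?S" "integral ?S D = integral (F ` ?S) G"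
    using has_absolute_integral_change_of_variables[OF SS derF injF, of G "integral (F ` ?S) G"] absG
    unfolding D_def by blast+
  define d where "d = (\<lambda>y. vec_nth (D y) 1)"
  define h where "h = (\<lambda>x. indicator S x * (\<bar>lin_det (f' x)\<bar> * g (f x)))"
  have meas_h: "h \<in> borel_measurable borel" using meas by (simp add: h_def)
  have hd: "indicator ?S y * d y = h (of_coords y)" for y
  proof -
    have "y \<in> ?S \<longleftrightarrow> of_coords y \<in> S" by (metis image_iff of_to_coords to_of_coords)
    then show ?thesis
      by (simp add: d_def D_def F_def G_def F'_def h_def lin_det_def indicator_def)
  qed
  have meas_of: "of_coords \<in> borel \<rightarrow>\<^sub>M (borel :: 'a measure)"
    by (rule borel_measurable_continuous_onI) (rule continuous_on_of_coords)
  have meas_d: "(\<lambda>y. h (of_coords y)) \<in> borel_measurable borel"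
    using meas_h meas_of by measurable
  have d: "integrable lebesgue (\<lambda>y. indicator ?S y * d y)"
    using absolutely_integrable_on_1_iff[THEN iffD1, OF cov(1)] unfolding set_integrable_def d_def real_scaleR_def .
  then have d': "integrable lborel (\<lambda>y. h (of_coords y))"
    using meas_d by (simp add: hd integrable_completion)
  then show "integrable lborel ?h" unfolding h_def[symmetric]
    using integrable_to_coords[OF meas_d] by simp
  have "integrable lborel (\<lambda>y. indicator (f ` S) y * g y)"
    using borel_integrable_compact[OF cS(2) g] by simp
  then have measg: "(\<lambda>y. indicator (f ` S) y * g y) \<in> borel_measurable borel"
    by (simp add: borel_measurable_integrable)
  have "integral\<^sup>L lborel h = integral\<^sup>L lborel (\<lambda>y. h (of_coords y))"
    using integral_to_coords[OF meas_d] by simp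
  also have "\<dots> = integral\<^sup>L lebesgue (\<lambda>y. indicator ?S y * d y)"
    using meas_d by (simp add: hd integral_completion)
  also have "\<dots> = integral ?S d"
    using set_lebesgue_integral_eq_integral(2)[of ?S d] d
    by (simp add: set_lebesgue_integral_def set_integrable_def)
  also have "\<dots> = vec_nth (integral ?S D) 1"
    unfolding d_def using cov(1) by (intro integral_component_eq_cart) (simp add: absolutely_integrable_on_def)
  also have "\<dots> = integral (F ` ?S) (\<lambda>y. vec_nth (G y) 1)"
    unfolding cov(2) using absG by (intro integral_component_eq_cart[symmetric]) (simp add: absolutely_integrable_on_def)
  also have "\<dots> = integral\<^sup>L lebesgue (\<lambda>y. indicator (F ` ?S) y * vec_nth (G y) 1)"
    using set_lebesgue_integral_eq_integral(2)[of "F ` ?S" "\<lambda>y. vec_nth (G y) 1"] absolutely_integrable_on_1_iff[THEN iffD1, OF absG]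
    by (simp add: set_lebesgue_integral_def)
  also have "\<dots> = integral\<^sup>L lebesgue (\<lambda>y. indicator (f ` S) (of_coords y) * g (of_coords y))"
  proof -
    have "y \<in> F ` ?S \<longleftrightarrow> of_coords y \<in> f ` S" for y unfolding FS by (metis image_iff of_to_coords to_of_coords)
    then show ?thesis by (simp add: G_def indicator_def)
  qed
  also have "\<dots> = integral\<^sup>L lborel (\<lambda>y. indicator (f ` S) (of_coords y) * g (of_coords y))"
    using measurable_compose[OF meas_of measg] by (intro integral_completion) simp
  also have "\<dots> = (\<integral>y. indicator (f ` S) y * g y \<partial>lborel)"
    using measg meas_of by (subst integral_to_coords) (auto intro: measurable_compose)
  finally show "integral\<^sup>L lborel ?h = (\<integral>y. indicator (f ` S) y * g y \<partial>lborel)" unfolding h_def .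
qed


section \<open>Nearest points\<close>

lemma closest_point_props:
  fixes K :: "'a::euclidean_space set"
  assumes "compact K" "K \<noteq> {}"
  shows "closest_point K x \<in> K" "dist x (closest_point K x) = infdist x K"
proof -
  have K: "closed K" using assms by (simp add: compact_imp_closed)
  note * = closest_point_exists[OF K assms(2), of x]
  show "closest_point K x \<in> K" using * by simp
  show "dist x (closest_point K x) = infdist x K"
  proof (rule antisym)
    show "dist x (closest_point K x) \<le> infdist x K"
      unfolding infdist_notempty[OF assms(2)] by (rule cINF_greatest[OF assms(2)]) (use * in auto)
    show "infdist x K \<le> dist x (closest_point K x)"
      using * by (simp add: infdist_le)
  qed
qed

definition unique_nearest :: "'a::euclidean_space set \<Rightarrow> 'a set" where
  "unique_nearest K = {x. \<forall>y\<in>K. dist x y = infdist x K \<longrightarrow> y = closest_point K x}"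

text \<open>A map into a compact set is continuous as soon as its graph is closed. Over
  \<open>S\<close> the graph consists of the pairs in \<open>S \<times> K\<close> that realize the
  distance, a closed condition.\<close>

lemma continuous_on_closest_point:
  fixes K :: "'a::euclidean_space set"
  assumes K: "compact K" "K \<noteq> {}" and S: "S \<subseteq> unique_nearest K"
  shows "continuous_on S (closest_point K)"
proof -
  let ?C = "{z::'a \<times> 'a. dist (fst z) (snd z) = infdist (fst z) K}"
  have "closed ?C"
    by (intro closed_Collect_eq continuous_intros)
  moreover have "(\<lambda>x. (x, closest_point K x)) ` S = (S \<times> K) \<inter> ?C"
    using S closest_point_props[OF K] by (fastforce simp: unique_nearest_def image_iff)
  ultimately have "closedin (top_of_set (S \<times> K)) ((\<lambda>x. (x, closest_point K x)) ` S)"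
    by (simp add: closedin_closed_Int)
  then show ?thesis
    using continuous_closed_graph_eq[OF K(1), of "closest_point K" S] closest_point_props[OF K] by auto
qed

text \<open>A real radius replaces the possibly infinite reach. Uniqueness is required only at
  distances strictly below \<open>r\<close>, so that every positive \<open>r\<close> below the reach
  qualifies, in particular the largest radius of the estimator.\<close>

locale prox_regular =
  fixes K :: "'a::euclidean_space set" and r :: real
  assumes compact_K: "compact K" and K_nonempty: "K \<noteq> {}" and r_pos: "r > 0"
    and unique: "\<And>x y z. infdist x K < r \<Longrightarrow> y \<in> K \<Longrightarrow> z \<in> K \<Longrightarrow>
      dist x y = infdist x K \<Longrightarrow> dist x z = infdist x K \<Longrightarrow> y = z"
begin

abbreviation "proj \<equiv> closest_point K"

lemma proj_in: "proj x \<in> K"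
  and dist_proj: "dist x (proj x) = infdist x K"
  using closest_point_props[OF compact_K K_nonempty] by auto

lemma norm_proj: "norm (x - proj x) = infdist x K"
  using dist_proj[of x] by (simp add: dist_norm)

lemma proj_eqI: "infdist x K < r \<Longrightarrow> y \<in> K \<Longrightarrow> dist x y = infdist x K \<Longrightarrow> proj x = y"
  using unique proj_in dist_proj by blast

lemma continuous_on_proj: "continuous_on {x. infdist x K < r} proj"
  by (rule continuous_on_closest_point[OF compact_K K_nonempty])
     (auto simp: unique_nearest_def intro: proj_eqI[symmetric])

text \<open>A point \<open>y\<close> with \<open>x0\<close> on the segment from \<open>y\<close> to its nearest point is a fixed point of
  \<open>f\<close> below; Brouwer's theorem thus prolongs the normal segment.\<close>

lemma normal_prolong:
  assumes x0: "0 < infdist x0 K" "infdist x0 K + \<delta> < r" and \<delta>: "0 < \<delta>"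
  defines "y \<equiv> proj x0 + ((infdist x0 K + \<delta>) / infdist x0 K) *\<^sub>R (x0 - proj x0)"
  shows "infdist y K = infdist x0 K + \<delta>"
proof -
  define f where "f = (\<lambda>y. x0 + (\<delta> / norm (x0 - proj y)) *\<^sub>R (x0 - proj y))"
  have ne: "x0 \<noteq> proj z" for z
    using x0(1) proj_in[of z] by auto
  have sub: "cball x0 \<delta> \<subseteq> {x. infdist x K < r}"
  proof safe
    fix z assume "z \<in> cball x0 \<delta>"
    then have "infdist z K \<le> infdist x0 K + \<delta>"
      using infdist_triangle[of z K x0] by (simp add: dist_commute)
    then show "infdist z K < r" using x0 by simp
  qed
  have "continuous_on (cball x0 \<delta>) f"
    unfolding f_def by (intro continuous_intros continuous_on_subset[OF continuous_on_proj sub]) (use ne in auto)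
  moreover have "f \<in> cball x0 \<delta> \<rightarrow> cball x0 \<delta>"
    using ne \<delta> by (auto simp: f_def dist_norm)
  ultimately obtain z where z: "z \<in> cball x0 \<delta>" "f z = z"
    using brouwer[of "cball x0 \<delta>" f] \<delta> by (metis compact_cball convex_cball cball_eq_empty not_less_iff_gr_or_eq)
  define e where "e = norm (x0 - proj z)"
  have e: "e > 0" using ne by (simp add: e_def)
  have zx: "z - x0 = (\<delta> / e) *\<^sub>R (x0 - proj z)" using z(2) by (simp add: f_def e_def algebra_simps)
  have "z - proj z = (\<delta> / e + 1) *\<^sub>R (x0 - proj z)" using zx by (simp add: algebra_simps)
  then have "norm (z - proj z) = (\<delta> / e + 1) * e" using e \<delta> by (simp add: e_def)
  then have dz: "infdist z K = \<delta> + e" using e by (simp add: norm_proj distrib_right)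
  have "infdist z K \<le> infdist x0 K + \<delta>"
    using infdist_triangle[of z K x0] z(1) by (simp add: dist_commute)
  then have "e \<le> infdist x0 K" using dz by simp
  moreover have "infdist x0 K \<le> e"
    using infdist_le[OF proj_in, of x0 z] by (simp add: e_def dist_norm)
  ultimately have eq: "e = infdist x0 K" by simp
  then have "proj x0 = proj z"
    using x0 \<delta> by (intro proj_eqI proj_in) (auto simp: e_def dist_norm)
  moreover have "((infdist x0 K + \<delta>) / infdist x0 K) = 1 + \<delta> / e"
    using x0 eq by (simp add: field_simps)
  ultimately have "y = z"
    using zx by (simp add: y_def algebra_simps)
  then show ?thesis using dz eq by simp
qed

text \<open>\<open>g t \<le> t\<close> for nonnegative \<open>t\<close> and \<open>g\<close> is
  1-Lipschitz, so the identity \<open>g t = t\<close> passes from a parameter to all smaller ones.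
  From the last parameter at which it holds, \<open>normal_prolong\<close> carries it on to
  \<open>\<tau>\<close>.\<close>

lemma infdist_normal_ray:
  assumes x: "0 < infdist x K" "infdist x K < r" and \<tau>: "0 \<le> \<tau>" "\<tau> < r"
  shows "infdist (proj x + (\<tau> / infdist x K) *\<^sub>R (x - proj x)) K = \<tau>"
proof -
  define u where "u = (1 / infdist x K) *\<^sub>R (x - proj x)"
  have u: "norm u = 1" using x by (simp add: u_def norm_proj)
  define g where "g = (\<lambda>t. infdist (proj x + t *\<^sub>R u) K)"
  have g_le: "g t \<le> t" if "t \<ge> 0" for t
    using infdist_le[OF proj_in, of "proj x + t *\<^sub>R u" x] that u by (simp add: g_def dist_norm)
  have g_lip: "g t \<le> g s + \<bar>t - s\<bar>" for s t
  proof -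
    have "dist (proj x + t *\<^sub>R u) (proj x + s *\<^sub>R u) = \<bar>t - s\<bar>"
      using u by (simp add: dist_norm scaleR_left_diff_distrib[symmetric])
    then show ?thesis
      using infdist_triangle[of "proj x + t *\<^sub>R u" K "proj x + s *\<^sub>R u"] by (simp add: g_def u)
  qed
  have g_down: "g s = s" if "g t = t" "0 \<le> s" "s \<le> t" for s t
    using g_lip[of t s] g_le[of s] that by simp
  have gx: "g (infdist x K) = infdist x K"
    using x by (simp add: g_def u_def)
  have cg: "continuous_on UNIV g"
    unfolding g_def by (intro continuous_intros)
  have "g \<tau> = \<tau>"
  proof (rule ccontr)
    assume neq: "g \<tau> \<noteq> \<tau>"
    define T where "T = {t. 0 \<le> t \<and> t \<le> \<tau> \<and> g t = t}"
    have T_lt: "t < \<tau>" if "t \<in> T" for t using that neq by (cases "t = \<tau>") (auto simp: T_def)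
    have xT: "infdist x K \<in> T"
      using gx x g_down[of "infdist x K" \<tau>] neq \<tau> by (cases "\<tau> \<le> infdist x K") (auto simp: T_def)
    have "T = {0..\<tau>} \<inter> {t. g t = t}" by (auto simp: T_def)
    moreover have "closed {t. g t = t}" by (intro closed_Collect_eq cg continuous_on_id)
    ultimately have "compact T" by (simp add: compact_Int_closed)
    then obtain s where s: "s \<in> T" "\<And>t. t \<in> T \<Longrightarrow> t \<le> s"
      using compact_attains_sup[of T] xT by blast
    have s_pos: "s > 0" using s(2)[OF xT] x by simp
    have s_lt: "s < \<tau>" using T_lt s(1) .
    define x0 where "x0 = proj x + s *\<^sub>R u"
    have dx0: "infdist x0 K = s" using s(1) by (simp add: T_def x0_def g_def)
    have px0: "proj x0 = proj x"
    proof (rule proj_eqI[OF _ proj_in])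
      show "infdist x0 K < r" using s_lt \<tau> dx0 by simp
      show "dist x0 (proj x) = infdist x0 K" using s_pos u unfolding dx0 by (simp add: x0_def dist_norm)
    qed
    define \<delta> where "\<delta> = (\<tau> - s)"
    have "infdist (proj x0 + ((s + \<delta>) / s) *\<^sub>R (x0 - proj x0)) K = s + \<delta>"
      using normal_prolong[of x0 \<delta>] dx0 s_pos s_lt \<tau> by (simp add: \<delta>_def)
    then have "g (s + \<delta>) = s + \<delta>"
      using s_pos unfolding px0 g_def by (simp add: x0_def)
    then show False using neq by (simp add: \<delta>_def)
  qed
  then show ?thesis using x by (simp add: g_def u_def)
qed

text \<open>Federer's inequality for sets of positive reach. For \<open>\<tau> < r\<close> the open
  ball of radius \<open>\<tau>\<close> that touches \<open>K\<close> at \<open>proj x\<close> in the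
  direction of \<open>x\<close> contains no point of \<open>K\<close>; expanding the squared
  distance from its centre to \<open>q\<close> bounds \<open>\<tau>\<close>, and
  \<open>\<tau>\<close> may tend to \<open>r\<close>.\<close>

lemma prox_inequality:
  assumes x: "infdist x K < r" and q: "q \<in> K"
  shows "2 * r * ((q - proj x) \<bullet> (x - proj x)) \<le> (norm (q - proj x))\<^sup>2 * infdist x K"
proof (cases "infdist x K = 0 \<or> (q - proj x) \<bullet> (x - proj x) \<le> 0")
  case True
  show ?thesis
  proof (cases "infdist x K = 0")
    case True
    then have "x = proj x" using norm_proj[of x] by simp
    then show ?thesis using True by simp
  next
    case False
    then have "(q - proj x) \<bullet> (x - proj x) \<le> 0" using \<open>_ \<or> _\<close> by simp
    then have "2 * r * ((q - proj x) \<bullet> (x - proj x)) \<le> 0"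
      using r_pos by (simp add: mult_nonneg_nonpos)
    also have "0 \<le> (norm (q - proj x))\<^sup>2 * infdist x K" by (simp add: infdist_nonneg)
    finally show ?thesis .
  qed
next
  case False
  define c where "c = (q - proj x) \<bullet> (x - proj x)"
  define D where "D = infdist x K"
  define N where "N = norm (q - proj x)"
  have c: "c > 0" and D: "D > 0" using False infdist_nonneg[of x K] by (auto simp: c_def D_def)
  have "\<tau> \<le> N\<^sup>2 * D / (2 * c)" if \<tau>: "0 < \<tau>" "\<tau> < r" for \<tau>
  proof -
    define w where "w = (\<tau> / D) *\<^sub>R (x - proj x)"
    have "\<tau> = infdist (proj x + w) K"
      unfolding w_def D_def using infdist_normal_ray[of x \<tau>] D x \<tau> by (simp add: D_def)
    also have "\<dots> \<le> dist (proj x + w) q" by (rule infdist_le[OF q])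
    also have "\<dots> = norm ((q - proj x) - w)" by (simp add: dist_norm norm_minus_commute algebra_simps)
    finally have "\<tau>\<^sup>2 \<le> (norm ((q - proj x) - w))\<^sup>2" using \<tau> by (intro power_mono) auto
    also have "\<dots> = N\<^sup>2 - 2 * ((q - proj x) \<bullet> w) + (norm w)\<^sup>2"
      by (simp add: N_def power2_norm_eq_inner inner_diff_left inner_diff_right inner_commute algebra_simps)
    also have "norm w = \<tau>" using D \<tau> by (simp add: w_def D_def norm_proj)
    also have "(q - proj x) \<bullet> w = \<tau> / D * c" by (simp add: w_def c_def)
    finally have "2 * (\<tau> / D * c) \<le> N\<^sup>2" by simp
    then show ?thesis using D c by (simp add: field_simps)
  qed
  then have "r \<le> N\<^sup>2 * D / (2 * c)"
    by (intro dense_le_bounded[OF r_pos]) auto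
  then show ?thesis using c by (simp add: N_def[symmetric] D_def[symmetric] c_def[symmetric] field_simps)
qed

text \<open>Add \<open>prox_inequality\<close> for \<open>x\<close> with \<open>q = proj y\<close>
  to the same for \<open>y\<close> with \<open>q = proj x\<close>. The constant
  \<open>1 - t / r\<close> degenerates at \<open>t = r\<close>; the Steiner formula uses only its
  sign.\<close>

lemma proj_strongly_monotone:
  assumes x: "infdist x K \<le> t" and y: "infdist y K \<le> t" and t: "t < r"
  shows "(1 - t / r) * (norm (proj x - proj y))\<^sup>2 \<le> (proj x - proj y) \<bullet> (x - y)"
proof -
  define N where "N = (norm (proj x - proj y))\<^sup>2"
  have N: "N \<ge> 0" by (simp add: N_def)
  have "2 * r * ((proj y - proj x) \<bullet> (x - proj x)) \<le> N * t"
  proof -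
    have "2 * r * ((proj y - proj x) \<bullet> (x - proj x)) \<le> N * infdist x K"
      using prox_inequality[of x "proj y"] x t proj_in by (simp add: N_def norm_minus_commute)
    also have "\<dots> \<le> N * t" using x N by (rule mult_left_mono)
    finally show ?thesis .
  qed
  moreover have "2 * r * ((proj x - proj y) \<bullet> (y - proj y)) \<le> N * t"
  proof -
    have "2 * r * ((proj x - proj y) \<bullet> (y - proj y)) \<le> N * infdist y K"
      using prox_inequality[of y "proj x"] y t proj_in by (simp add: N_def norm_minus_commute)
    also have "\<dots> \<le> N * t" using y N by (rule mult_left_mono)
    finally show ?thesis .
  qed
  ultimately have "2 * r * ((proj y - proj x) \<bullet> (x - proj x) + (proj x - proj y) \<bullet> (y - proj y)) \<le> 2 * (N * t)"
    unfolding distrib_left by linarith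
  moreover have "(proj y - proj x) \<bullet> (x - proj x) + (proj x - proj y) \<bullet> (y - proj y) =
     N - (proj x - proj y) \<bullet> (x - y)"
    by (simp add: N_def power2_norm_eq_inner inner_diff_left inner_diff_right inner_commute algebra_simps)
  ultimately have "2 * r * (N - (proj x - proj y) \<bullet> (x - y)) \<le> 2 * (N * t)"
    by simp
  then have "r * (N - (proj x - proj y) \<bullet> (x - y)) \<le> N * t" by simp
  then show ?thesis using r_pos by (simp add: N_def[symmetric] field_simps)
qed

lemma proj_monotone:
  assumes "infdist x K < r" "infdist y K < r"
  shows "0 \<le> (proj x - proj y) \<bullet> (x - y)"
proof -
  define t where "t = max (infdist x K) (infdist y K)"
  have "0 \<le> (1 - t / r) * (norm (proj x - proj y))\<^sup>2"
    using assms r_pos by (auto simp: t_def)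
  also have "\<dots> \<le> (proj x - proj y) \<bullet> (x - y)"
    using assms by (intro proj_strongly_monotone) (auto simp: t_def)
  finally show ?thesis .
qed

text \<open>The homothety with factor \<open>l\<close> along each normal segment, centred at the
  foot point. It multiplies the distance to \<open>K\<close> by \<open>l\<close> and keeps the
  normal direction, which is why it scales local tubes.\<close>

definition rescale :: "real \<Rightarrow> 'a \<Rightarrow> 'a" where
  "rescale l x = proj x + l *\<^sub>R (x - proj x)"

lemma rescale_props:
  assumes l: "l > 0" and x: "infdist x K < r" "l * infdist x K < r"
  shows "infdist (rescale l x) K = l * infdist x K" "proj (rescale l x) = proj x"
    "rescale (1 / l) (rescale l x) = x"
proof -
  show 1: "infdist (rescale l x) K = l * infdist x K"
  proof (cases "infdist x K = 0")
    case True
    then have "x = proj x" using norm_proj[of x] by simp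
    then have "rescale l x = x" by (simp add: rescale_def)
    then show ?thesis using True by simp
  next
    case False
    then have "infdist x K > 0" using infdist_nonneg[of x K] by simp
    then show ?thesis
      using infdist_normal_ray[of x "l * infdist x K"] x l by (simp add: rescale_def)
  qed
  show 2: "proj (rescale l x) = proj x"
    by (rule proj_eqI[OF _ proj_in]) (use 1 x l in \<open>auto simp: rescale_def dist_norm norm_proj\<close>)
  show "rescale (1 / l) (rescale l x) = x"
    unfolding rescale_def[of "1 / l"] 2 using l by (simp add: rescale_def)
qed

end


section \<open>Smooth approximation of monotone maps\<close>

lemma has_derivative_max_0_squared:
  "((\<lambda>t::real. (max 0 t)\<^sup>2) has_real_derivative 2 * max 0 t) (at t)"
proof -
  have neg: "((\<lambda>t::real. (max 0 t)\<^sup>2) has_real_derivative 2 * max 0 t) (at t)" if "t < 0"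
  proof -
    have "((\<lambda>t::real. 0) has_real_derivative 0) (at t)" by simp
    then show ?thesis
      by (rule has_field_derivative_transform_within_open[of _ _ _ "{..<0}", THEN DERIV_cong]) (use that in auto)
  qed
  have pos: "((\<lambda>t::real. (max 0 t)\<^sup>2) has_real_derivative 2 * max 0 t) (at t)" if "t > 0"
  proof -
    have "((\<lambda>t::real. t\<^sup>2) has_real_derivative 2 * t) (at t)"
      by (auto intro!: derivative_eq_intros)
    then show ?thesis
      by (rule has_field_derivative_transform_within_open[of _ _ _ "{0<..}", THEN DERIV_cong]) (use that in auto)
  qed
  have zero: "((\<lambda>t::real. (max 0 t)\<^sup>2) has_real_derivative 2 * max 0 t) (at t)" if "t = 0"
  proof -
    have "(\<lambda>h::real. \<bar>h\<bar>) \<midarrow>0\<rightarrow> 0" by (intro tendsto_eq_intros) auto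
    then have "(\<lambda>h::real. (max 0 h)\<^sup>2 / h) \<midarrow>0\<rightarrow> 0"
      by (rule Lim_null_comparison[rotated])
         (auto simp: eventually_at_filter max_def power2_eq_square)
    then show ?thesis using that by (simp add: DERIV_def)
  qed
  show ?thesis using neg pos zero by linarith
qed

text \<open>An unnormalized smoothing kernel. It is once continuously differentiable, which is
  enough for Jacobians to exist and be continuous.\<close>

definition bump :: "real \<Rightarrow> 'a::euclidean_space \<Rightarrow> real" where
  "bump e z = (max 0 (e\<^sup>2 - z \<bullet> z))\<^sup>2"

lemma continuous_on_bump [continuous_intros]:
  "continuous_on S f \<Longrightarrow> continuous_on S (\<lambda>x. bump e (f x))"
  unfolding bump_def by (intro continuous_intros)

lemma bump_nonneg: "bump e z \<ge> 0" by (simp add: bump_def)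

lemma bump_eq_0: "0 < e \<Longrightarrow> norm z \<ge> e \<Longrightarrow> bump e z = 0"
  using power_mono[of e "norm z" 2] by (simp add: bump_def power2_norm_eq_inner max_def)

lemma bump_has_derivative:
  "((\<lambda>x. bump e (t - x)) has_derivative (\<lambda>h. 4 * max 0 (e\<^sup>2 - (t - x) \<bullet> (t - x)) * ((t - x) \<bullet> h))) (at x)"
proof -
  have "((\<lambda>x. e\<^sup>2 - (t - x) \<bullet> (t - x)) has_derivative (\<lambda>h. 2 * ((t - x) \<bullet> h))) (at x)"
    by (auto intro!: derivative_eq_intros simp: inner_commute algebra_simps)
  from has_derivative_compose[OF this has_derivative_max_0_squared[unfolded has_field_derivative_def]]
  show ?thesis unfolding bump_def by (rule has_derivative_eq_rhs) (auto simp: fun_eq_iff)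
qed

lemma integrable_bump_scaleR:
  fixes f :: "'a::euclidean_space \<Rightarrow> 'b::euclidean_space"
  assumes "0 < e" "continuous_on UNIV f"
  shows "integrable lborel (\<lambda>z. bump e z *\<^sub>R f z)"
proof -
  have "integrable lborel (\<lambda>z. indicator (cball 0 e) z *\<^sub>R (bump e z *\<^sub>R f z))"
    by (intro borel_integrable_compact compact_cball continuous_intros continuous_on_subset[OF assms(2)]) auto
  moreover have "indicator (cball 0 e) z *\<^sub>R (bump e z *\<^sub>R f z) = bump e z *\<^sub>R f z" for z
    using bump_eq_0[OF assms(1), of z] by (cases "norm z \<le> e") auto
  ultimately show ?thesis by (simp only:)
qed

lemma integral_bump_pos:
  assumes "0 < e"
  shows "0 < (\<integral>z. bump e (z::'a::euclidean_space) \<partial>lborel)"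
proof -
  have int: "integrable lborel (bump e :: 'a \<Rightarrow> real)"
    using integrable_bump_scaleR[OF assms, of "\<lambda>_. 1::real"] by simp
  have "(\<integral>z. bump e (z::'a) \<partial>lborel) \<noteq> 0"
  proof
    assume "(\<integral>z. bump e (z::'a) \<partial>lborel) = 0"
    then have "AE z in lborel. bump e (z::'a) = 0"
      using integral_nonneg_eq_0_iff_AE[OF int] by (simp add: bump_nonneg)
    then have "AE z::'a in lborel. z \<notin> ball 0 e"
    proof (rule AE_mp, intro AE_I2 impI)
      fix z :: 'a assume "bump e z = 0"
      then have "e\<^sup>2 \<le> (norm z)\<^sup>2" by (simp add: bump_def power2_norm_eq_inner max_def split: if_splits)
      then show "z \<notin> ball 0 e" using assms by (simp add: power2_le_iff_abs_le)
    qed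
    then have "emeasure lborel (ball (0::'a) e) = 0"
      by (subst (asm) AE_iff_null_sets[symmetric]) auto
    then show False
      using content_ball_pos[OF assms, of "0::'a"] by (simp add: measure_def)
  qed
  moreover have "0 \<le> (\<integral>z. bump e (z::'a) \<partial>lborel)" by (simp add: bump_nonneg)
  ultimately show ?thesis by simp
qed

text \<open>\<open>P\<close> is merely continuous, so the convolution is written with
  \<open>x\<close> inside the kernel and the Leibniz rule differentiates \<open>bump\<close> only.
  The fixed box makes the domain of integration compact.\<close>

lemma mollification_derivative:
  fixes P :: "'a::euclidean_space \<Rightarrow> 'a"
  assumes P: "continuous_on UNIV P" and Q_def: "Q = (\<lambda>x. integral (cbox a b) (\<lambda>y. bump e (y - x) *\<^sub>R P y))"
  obtains Q' where "\<And>x. (Q has_derivative blinfun_apply (Q' x)) (at x)" "continuous_on UNIV Q'"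
proof -
  define fx where "fx x t = (4 * max 0 (e\<^sup>2 - (t - x) \<bullet> (t - x))) *\<^sub>R
     (blinfun_scaleR_left (P t) o\<^sub>L blinfun_inner_right (t - x))" for x t
  have P': "continuous_on S P" for S using P continuous_on_subset by blast
  have cont: "continuous_on (UNIV \<times> cbox a b) (\<lambda>(x, t). fx x t)"
    unfolding fx_def split_beta
    by (intro continuous_intros continuous_on_compose2[OF P])  auto
  have "(Q has_derivative blinfun_apply (integral (cbox a b) (fx x))) (at x)" for x
    unfolding Q_def
  proof (rule leibniz_rule[where U = UNIV])
    fix x t
    have "((\<lambda>x. bump e (t - x) *\<^sub>R P t) has_derivative (\<lambda>h. (4 * max 0 (e\<^sup>2 - (t - x) \<bullet> (t - x)) * ((t - x) \<bullet> h)) *\<^sub>R P t)) (at x)"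
      by (rule bounded_linear.has_derivative[OF bounded_linear_scaleR_left bump_has_derivative])
    then show "((\<lambda>x. bump e (t - x) *\<^sub>R P t) has_derivative blinfun_apply (fx x t)) (at x within UNIV)"
      by (rule has_derivative_eq_rhs) (auto simp: fx_def fun_eq_iff blinfun.scaleR_left)
  next
    show "(\<lambda>y. bump e (y - x) *\<^sub>R P y) integrable_on cbox a b" for x
      by (intro integrable_continuous continuous_intros P')
  qed (use cont in auto)
  moreover have "continuous_on UNIV (\<lambda>x. integral (cbox a b) (fx x))"
    using integral_continuous_on_param[OF cont] .
  ultimately show ?thesis by (rule that)
qed

text \<open>The convolution is an average of translates of \<open>P\<close>, and averages of
  monotone maps are monotone. That is why \<open>mono\<close> speaks of all translates by vectors of
  length at most \<open>e0\<close> and not of \<open>P\<close> alone.\<close>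

lemma smooth_monotone_approx:
  fixes P :: "'a::euclidean_space \<Rightarrow> 'a"
  assumes P: "continuous_on UNIV P" and S: "compact S" and \<epsilon>: "\<epsilon> > 0" and e0: "e0 > 0"
    and mono: "\<And>x y z. x \<in> S \<Longrightarrow> y \<in> S \<Longrightarrow> norm z \<le> e0 \<Longrightarrow> 0 \<le> (P (x + z) - P (y + z)) \<bullet> (x - y)"
  obtains Q Q' where "\<And>x. (Q has_derivative blinfun_apply (Q' x)) (at x)" "continuous_on UNIV Q'"
    "\<And>x. x \<in> S \<Longrightarrow> norm (Q x - P x) \<le> \<epsilon>"
    "\<And>x y. x \<in> S \<Longrightarrow> y \<in> S \<Longrightarrow> 0 \<le> (Q x - Q y) \<bullet> (x - y)"
proof -
  \<comment> \<open>All points met by a kernel of radius at most \<open>e0\<close> centred at a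
    point of \<open>S\<close>.\<close>
  define T where "T = {x + y | x y. x \<in> S \<and> y \<in> cball (0::'a) e0}"
  have cT: "compact T" unfolding T_def using S by (rule compact_sums) simp
  then have "uniformly_continuous_on T P"
    using P by (intro compact_uniformly_continuous) (auto intro: continuous_on_subset)
  then obtain \<delta> where \<delta>: "\<delta> > 0" "\<And>x y. x \<in> T \<Longrightarrow> y \<in> T \<Longrightarrow> dist y x < \<delta> \<Longrightarrow> dist (P y) (P x) < \<epsilon>"
    using \<epsilon> unfolding uniformly_continuous_on_def by metis
  define e where "e = min e0 (\<delta> / 2)"
  have e: "e > 0" "e \<le> e0" "e < \<delta>" using e0 \<delta> by (auto simp: e_def)
  define c where "c = (\<integral>z. bump e (z::'a) \<partial>lborel)"
  have c: "c > 0" using integral_bump_pos[OF e(1)] by (simp add: c_def)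
  obtain a b where ab: "T \<subseteq> cbox a b"
    using compact_imp_bounded[OF cT] bounded_subset_cbox_symmetric by metis
  define Q0 where "Q0 = (\<lambda>x. integral (cbox a b) (\<lambda>y. bump e (y - x) *\<^sub>R P y))"
  obtain Q0' where Q0': "\<And>x. (Q0 has_derivative blinfun_apply (Q0' x)) (at x)" "continuous_on UNIV Q0'"
    using mollification_derivative[OF P Q0_def] by blast
  have intg: "integrable lborel (\<lambda>z. bump e z *\<^sub>R P (x + z))" for x
    by (intro integrable_bump_scaleR e continuous_on_compose2[OF P] continuous_intros) auto
  have int1: "integrable lborel (bump e :: 'a \<Rightarrow> real)"
    using integrable_bump_scaleR[OF e(1), of "\<lambda>_. 1::real"] by simp
  \<comment> \<open>The integral over the box can be differentiated; the one over the whole space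
    shows the averaging of translates. They agree for \<open>x \<in> S\<close>, since the kernel
    centred at \<open>x\<close> vanishes outside \<open>T\<close>.\<close>
  have Q0: "Q0 x = (\<integral>z. bump e z *\<^sub>R P (x + z) \<partial>lborel)" if x: "x \<in> S" for x
  proof -
    have cont: "continuous_on A (\<lambda>y. bump e (y - x) *\<^sub>R P y)" for A
      by (intro continuous_intros continuous_on_subset[OF P]) auto
    have "set_integrable lborel (cbox a b) (\<lambda>y. bump e (y - x) *\<^sub>R P y)"
      unfolding set_integrable_def by (rule borel_integrable_compact[OF compact_cbox cont])
    then have "Q0 x = (\<integral>y. indicator (cbox a b) y *\<^sub>R (bump e (y - x) *\<^sub>R P y) \<partial>lborel)"
      unfolding Q0_def by (simp add: set_borel_integral_eq_integral(2)[symmetric] set_lebesgue_integral_def)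
    also have "\<dots> = (\<integral>y. bump e (y - x) *\<^sub>R P y \<partial>lborel)"
    proof (intro Bochner_Integration.integral_cong refl)
      fix y
      have "bump e (y - x) = 0" if "y \<notin> cbox a b"
      proof (rule bump_eq_0[OF e(1)], rule ccontr)
        assume "\<not> e \<le> norm (y - x)"
        then have "y - x \<in> cball 0 e0" using e(2) by simp
        then have "x + (y - x) \<in> T" using x unfolding T_def by blast
        then show False using ab that by auto
      qed
      then show "indicator (cbox a b) y *\<^sub>R (bump e (y - x) *\<^sub>R P y) = bump e (y - x) *\<^sub>R P y"
        by (auto simp: indicator_def)
    qed
    also have "\<dots> = (\<integral>y. bump e (y - x) *\<^sub>R P y \<partial>distr lborel borel ((+) x))"
      by (simp add: lborel_distr_plus)
    also have "\<dots> = (\<integral>z. bump e z *\<^sub>R P (x + z) \<partial>lborel)"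
      using borel_measurable_continuous_onI[OF cont] by (subst integral_distr) auto
    finally show ?thesis .
  qed
  define Q where "Q = (\<lambda>x. (1 / c) *\<^sub>R Q0 x)"
  define Q' where "Q' = (\<lambda>x. (1 / c) *\<^sub>R Q0' x)"
  show ?thesis
  proof
    show "(Q has_derivative blinfun_apply (Q' x)) (at x)" for x
      unfolding Q_def Q'_def
      by (rule has_derivative_eq_rhs[OF has_derivative_scaleR_right[OF Q0'(1)]]) (simp add: fun_eq_iff blinfun.scaleR_left)
    show "continuous_on UNIV Q'" unfolding Q'_def by (intro continuous_intros Q0'(2))
    fix x assume x: "x \<in> S"
    have "c *\<^sub>R (Q x - P x) = (\<integral>z. bump e z *\<^sub>R P (x + z) \<partial>lborel) - (\<integral>z. bump e (z::'a) \<partial>lborel) *\<^sub>R P x"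
      using c x by (simp add: Q_def Q0 c_def[symmetric] algebra_simps)
    also have "\<dots> = (\<integral>z. bump e z *\<^sub>R (P (x + z) - P x) \<partial>lborel)"
      using intg int1 by (simp add: scaleR_diff_right)
    finally have "c * norm (Q x - P x) = norm (\<integral>z. bump e z *\<^sub>R (P (x + z) - P x) \<partial>lborel)"
      using c by (metis abs_of_pos norm_scaleR)
    also have "\<dots> \<le> (\<integral>z. norm (bump e z *\<^sub>R (P (x + z) - P x)) \<partial>lborel)"
      by (rule integral_norm_bound)
    also have "\<dots> \<le> (\<integral>z. bump e (z::'a) * \<epsilon> \<partial>lborel)"
    proof (rule integral_mono)
      show "integrable lborel (\<lambda>z. norm (bump e z *\<^sub>R (P (x + z) - P x)))"
        using intg[of x] int1 by (intro integrable_norm) (simp add: scaleR_diff_right)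
      show "integrable lborel (\<lambda>z::'a. bump e z * \<epsilon>)" using int1 by simp
      fix z :: 'a
      show "norm (bump e z *\<^sub>R (P (x + z) - P x)) \<le> bump e z * \<epsilon>"
      proof (cases "norm z < e")
        case True
        have "x + z \<in> T" using x True e(2) unfolding T_def by (intro CollectI exI[of _ x] exI[of _ z]) auto
        moreover have "x + 0 \<in> T" using x e0 unfolding T_def by (intro CollectI exI[of _ x] exI[of _ 0]) auto
        ultimately have "dist (P (x + z)) (P x) < \<epsilon>"
          using \<delta>(2)[of x "x + z"] True e(3) by (simp add: dist_norm)
        then show ?thesis by (simp add: bump_nonneg dist_norm mult_left_mono)
      next
        case False
        then show ?thesis using bump_eq_0[OF e(1), of z] by simp
      qed
    qed
    also have "\<dots> = c * \<epsilon>" by (simp add: c_def)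
    finally show "norm (Q x - P x) \<le> \<epsilon>" using c by simp
  next
    fix x y assume xy: "x \<in> S" "y \<in> S"
    have "0 \<le> (\<integral>z. (bump e z *\<^sub>R (P (x + z) - P (y + z))) \<bullet> (x - y) \<partial>lborel)"
    proof (rule Bochner_Integration.integral_nonneg)
      fix z
      show "0 \<le> (bump e z *\<^sub>R (P (x + z) - P (y + z))) \<bullet> (x - y)"
        using mono[OF xy, of z] bump_nonneg[of e z] bump_eq_0[OF e(1), of z] e(2)
        by (cases "norm z \<le> e0") auto
    qed
    also have "\<dots> = (\<integral>z. bump e z *\<^sub>R (P (x + z) - P (y + z)) \<partial>lborel) \<bullet> (x - y)"
      using intg by (intro integral_inner_left) (simp add: scaleR_diff_right)
    also have "\<dots> = (Q0 x - Q0 y) \<bullet> (x - y)"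
      using intg by (simp add: Q0 xy scaleR_diff_right)
    finally show "0 \<le> (Q x - Q y) \<bullet> (x - y)"
      using c by (simp add: Q_def scaleR_diff_right[symmetric] zero_le_divide_iff)
  qed
qed

text \<open>Otherwise normalizing \<open>- F\<close> would give a map of the ball into its boundary sphere
  without fixed points, against Brouwer's theorem.\<close>

lemma coercive_zero:
  fixes F :: "'a::euclidean_space \<Rightarrow> 'a"
  assumes \<delta>: "\<delta> > 0" and F: "continuous_on (cball x \<delta>) F"
    and pos: "\<And>z. dist x z = \<delta> \<Longrightarrow> 0 \<le> F z \<bullet> (z - x)"
  shows "\<exists>z\<in>cball x \<delta>. F z = 0"
proof (rule ccontr)
  assume "\<not> ?thesis"
  then have nz: "F z \<noteq> 0" if "z \<in> cball x \<delta>" for z using that by blast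
  define f where "f = (\<lambda>z. x - (\<delta> / norm (F z)) *\<^sub>R F z)"
  have "continuous_on (cball x \<delta>) f"
    unfolding f_def by (intro continuous_intros F) (use nz in auto)
  moreover have "f \<in> cball x \<delta> \<rightarrow> cball x \<delta>"
    using nz \<delta> by (auto simp: f_def dist_norm)
  ultimately obtain z where z: "z \<in> cball x \<delta>" "f z = z"
    using brouwer[of "cball x \<delta>" f] \<delta> by (metis compact_cball convex_cball cball_eq_empty not_less_iff_gr_or_eq)
  have zx: "z - x = - ((\<delta> / norm (F z)) *\<^sub>R F z)" using z(2) by (simp add: f_def algebra_simps)
  then have "dist x z = \<delta>" using nz[OF z(1)] \<delta> by (simp add: dist_norm norm_minus_commute[of x])
  then have "0 \<le> F z \<bullet> (z - x)" by (rule pos)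
  also have "\<dots> = - (\<delta> / norm (F z) * (norm (F z))\<^sup>2)"
    unfolding zx by (simp add: power2_norm_eq_inner)
  also have "\<dots> < 0" using nz[OF z(1)] \<delta> by simp
  finally show False by simp
qed


section \<open>Transport of integrals by the rescaling maps\<close>

lemma continuous_on_lin_det:
  fixes L :: "'b::topological_space \<Rightarrow> 'a::euclidean_space \<Rightarrow>\<^sub>L 'a"
  assumes "continuous_on S L"
  shows "continuous_on S (\<lambda>x. lin_det (blinfun_apply (L x)))"
  unfolding lin_det_def Determinants.det_def matrix_def to_coords_def
  by (auto intro!: continuous_intros assms)

text \<open>Otherwise, along the line through \<open>x\<close> in direction \<open>v\<close>, the
  component of \<open>Q\<close> along \<open>v\<close> would drop strictly below its value at
  \<open>x\<close> just after \<open>x\<close>, against monotonicity.\<close>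

lemma monotone_derivative_nonneg:
  fixes Q :: "'a::real_inner \<Rightarrow> 'a"
  assumes der: "(Q has_derivative Q') (at x)" and U: "open U" "x \<in> U"
    and mono: "\<And>y. y \<in> U \<Longrightarrow> 0 \<le> (Q y - Q x) \<bullet> (y - x)"
  shows "0 \<le> Q' v \<bullet> v"
proof (rule ccontr)
  assume neg: "\<not> 0 \<le> Q' v \<bullet> v"
  interpret Q': bounded_linear Q' using der by (rule has_derivative_bounded_linear)
  have "((\<lambda>h. x + h *\<^sub>R v) has_derivative (\<lambda>h. h *\<^sub>R v)) (at (0::real))"
    by (auto intro!: derivative_eq_intros)
  then have "((\<lambda>h. Q (x + h *\<^sub>R v)) has_derivative (\<lambda>h. Q' (h *\<^sub>R v))) (at (0::real))"
    by (rule has_derivative_compose) (use der in simp)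
  then have "((\<lambda>h. Q (x + h *\<^sub>R v) \<bullet> v) has_derivative (\<lambda>h. Q' (h *\<^sub>R v) \<bullet> v)) (at (0::real))"
    by (rule has_derivative_inner_left)
  then have "((\<lambda>h. Q (x + h *\<^sub>R v) \<bullet> v) has_real_derivative (Q' v \<bullet> v)) (at 0)"
    unfolding has_field_derivative_def
    by (rule has_derivative_eq_rhs) (simp add: fun_eq_iff Q'.scaleR mult.commute)
  then obtain d where d: "d > 0" "\<And>h. 0 < h \<Longrightarrow> h < d \<Longrightarrow> Q (x + h *\<^sub>R v) \<bullet> v < Q x \<bullet> v"
    using DERIV_neg_dec_right[of _ "Q' v \<bullet> v" 0] neg by force
  have "((\<lambda>h. x + h *\<^sub>R v) \<longlongrightarrow> x + 0 *\<^sub>R v) (at_right (0::real))" by (intro tendsto_intros)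
  then have "\<forall>\<^sub>F h in at_right 0. x + h *\<^sub>R v \<in> U"
    using U by (auto dest: topological_tendstoD)
  moreover have "\<forall>\<^sub>F h in at_right (0::real). h < d" using d(1) by (simp add: eventually_at_right_field) blast
  moreover have "\<forall>\<^sub>F h in at_right (0::real). 0 < h" by (simp add: eventually_at_right_less)
  ultimately have "\<forall>\<^sub>F h in at_right (0::real). 0 < h \<and> h < d \<and> x + h *\<^sub>R v \<in> U"
    by eventually_elim auto
  then obtain h where h: "0 < h" "h < d" "x + h *\<^sub>R v \<in> U"
    using eventually_happens'[OF trivial_limit_at_right_real] by blast
  have "0 \<le> h * ((Q (x + h *\<^sub>R v) - Q x) \<bullet> v)"
    using mono[OF h(3)] by simp
  then show False using d(2)[OF h(1,2)] h(1) by (simp add: zero_le_mult_iff inner_diff_left)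
qed

context prox_regular
begin

lemma compact_parallel: "0 < t \<Longrightarrow> compact {x. infdist x K \<le> t}"
  by (rule compact_infdist_le[OF K_nonempty compact_K])

lemma rescale_domain:
  assumes l: "0 < l" "l \<le> 1" and y: "infdist y K < l * t" and t: "t < r"
  shows "infdist y K < r" "1 / l * infdist y K < r"
proof -
  have *: "1 / l * infdist y K < t" using y l by (simp add: field_simps)
  have "infdist y K \<le> 1 / l * infdist y K"
    using l infdist_nonneg[of y K] mult_left_le_one_le[of "infdist y K" l] by (simp add: field_simps)
  then show "infdist y K < r" "1 / l * infdist y K < r" using * t by auto
qed

text \<open>For \<open>l \<le> 1\<close> the map \<open>rescale l = l id + (1 - l) proj\<close> is strongly monotone, and
  the Jacobian of its smooth approximations is a polynomial in \<open>l\<close>. Only the transported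
  integrals, not the Jacobians, need to converge.\<close>

lemma rescale_integral_polynomial:
  fixes g :: "'a \<Rightarrow> real"
  assumes st: "0 < s" "s < t" "t < r" and g: "continuous_on UNIV g"
    and g0: "\<And>x. s \<le> infdist x K \<Longrightarrow> g x = 0"
  obtains p where "degree p \<le> DIM('a)"
    "\<And>l. 0 < l \<Longrightarrow> l \<le> 1 \<Longrightarrow>
      (\<integral>y. indicator {y. infdist y K < l * t} y * g (rescale (1 / l) y) \<partial>lborel) = poly p l"
proof -
  \<comment> \<open>Room between \<open>t\<close> and \<open>r\<close>: translates of
    \<open>S\<close> by vectors of length at most \<open>t' - t\<close> remain where
    \<open>proj\<close> is continuous and monotone, as the smoothing requires. Beyond distance
    \<open>t'\<close> any continuous extension will do.\<close>
  define t' where "t' = (t + r) / 2"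
  have t': "t < t'" "t' < r" "t' > 0" using st by (auto simp: t'_def)
  define S where "S = {x. infdist x K \<le> t}"
  have cS: "compact S" unfolding S_def using st by (intro compact_parallel) simp
  have "closed {x. infdist x K \<le> t'}" using compact_parallel[OF t'(3)] by (rule compact_imp_closed)
  moreover have "continuous_on {x. infdist x K \<le> t'} proj"
    by (rule continuous_on_subset[OF continuous_on_proj]) (use t' in auto)
  ultimately obtain P where P: "continuous_on UNIV P" "\<And>x. infdist x K \<le> t' \<Longrightarrow> P x = proj x"
    using Tietze_unbounded[of "{x. infdist x K \<le> t'}" proj UNIV] by auto
  have PS: "P x = proj x" if "x \<in> S" for x using that P(2) t' by (simp add: S_def)
  have mono: "0 \<le> (P (x + z) - P (y + z)) \<bullet> (x - y)" if xy: "x \<in> S" "y \<in> S" and z: "norm z \<le> t' - t" for x y z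
  proof -
    have "infdist (w + z) K \<le> t'" if "w \<in> S" for w
      using infdist_triangle[of "w + z" K w] that z by (simp add: S_def dist_norm)
    then show ?thesis using xy P(2) proj_monotone[of "x + z" "y + z"] t' by simp (metis le_less_trans)
  qed
  have "\<exists>Q Q'. (\<forall>x. (Q has_derivative blinfun_apply (Q' x)) (at x)) \<and> continuous_on UNIV Q' \<and>
     (\<forall>x\<in>S. norm (Q x - P x) \<le> 1 / real (Suc n)) \<and> (\<forall>x\<in>S. \<forall>y\<in>S. 0 \<le> (Q x - Q y) \<bullet> (x - y))" for n
  proof -
    have pos: "0 < 1 / real (Suc n)" "0 < t' - t" using t' by simp_all
    show ?thesis
      by (rule smooth_monotone_approx[OF P(1) cS pos mono]) blast+
  qed
  then obtain Q :: "nat \<Rightarrow> 'a \<Rightarrow> 'a" and Q' :: "nat \<Rightarrow> 'a \<Rightarrow> 'a \<Rightarrow>\<^sub>L 'a"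
    where Q: "\<And>n x. (Q n has_derivative blinfun_apply (Q' n x)) (at x)" "\<And>n. continuous_on UNIV (Q' n)"
     "\<And>n x. x \<in> S \<Longrightarrow> norm (Q n x - P x) \<le> 1 / real (Suc n)"
     "\<And>n x y. x \<in> S \<Longrightarrow> y \<in> S \<Longrightarrow> 0 \<le> (Q n x - Q n y) \<bullet> (x - y)"
    by metis
  define \<Phi> where "\<Phi> n l x = l *\<^sub>R x + (1 - l) *\<^sub>R Q n x" for n and l :: real and x
  define \<Phi>' where "\<Phi>' n l x = l *\<^sub>R id_blinfun + (1 - l) *\<^sub>R Q' n x" for n and l :: real and x
  have \<Phi>_der: "(\<Phi> n l has_derivative blinfun_apply (\<Phi>' n l x)) (at x)" for n l x
    unfolding \<Phi>_def \<Phi>'_def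
    by (rule has_derivative_eq_rhs[OF has_derivative_add[OF has_derivative_scaleR_right[OF has_derivative_ident]
          has_derivative_scaleR_right[OF Q(1)]]]) (simp add: fun_eq_iff blinfun.add_left blinfun.scaleR_left)
  have \<Phi>_cont: "continuous_on A (\<Phi> n l)" for A n l
    using \<Phi>_der has_derivative_continuous by (blast intro: continuous_at_imp_continuous_on)
  have \<Phi>_mono: "l * (norm (x - y))\<^sup>2 \<le> (\<Phi> n l x - \<Phi> n l y) \<bullet> (x - y)"
    if "x \<in> S" "y \<in> S" "0 < l" "l \<le> 1" for n l x y
  proof -
    have "(\<Phi> n l x - \<Phi> n l y) \<bullet> (x - y) = l * ((x - y) \<bullet> (x - y)) + (1 - l) * ((Q n x - Q n y) \<bullet> (x - y))"
      by (simp add: \<Phi>_def inner_diff_left inner_add_left algebra_simps)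
    moreover have "0 \<le> (1 - l) * ((Q n x - Q n y) \<bullet> (x - y))" using Q(4)[OF that(1,2)] that by simp
    ultimately show ?thesis by (simp add: power2_norm_eq_inner)
  qed
  have \<Phi>_inj: "inj_on (\<Phi> n l) S" if "0 < l" "l \<le> 1" for n l
  proof (rule inj_onI)
    fix x y assume *: "x \<in> S" "y \<in> S" "\<Phi> n l x = \<Phi> n l y"
    then have "l * (norm (x - y))\<^sup>2 \<le> 0" using \<Phi>_mono[OF *(1,2) that, of n] by simp
    then show "x = y" using that by (simp add: mult_le_0_iff)
  qed
  have \<Phi>_approx: "norm (\<Phi> n l x - rescale l x) \<le> 1 / real (Suc n)" if "x \<in> S" "0 < l" "l \<le> 1" for n l x
  proof -
    have "\<Phi> n l x - rescale l x = (1 - l) *\<^sub>R (Q n x - P x)"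
      using PS[OF that(1)] by (simp add: \<Phi>_def rescale_def algebra_simps)
    then have "norm (\<Phi> n l x - rescale l x) = (1 - l) * norm (Q n x - P x)" using that by simp
    also have "\<dots> \<le> 1 * norm (Q n x - P x)" using that by (intro mult_right_mono) auto
    finally show ?thesis using Q(3)[OF that(1), of n] by simp
  qed
  define \<Psi> where "\<Psi> n l = the_inv_into S (\<Phi> n l)" for n l
  have \<Psi>: "\<Psi> n l (\<Phi> n l x) = x" if "x \<in> S" "0 < l" "l \<le> 1" for n l x
    unfolding \<Psi>_def using that \<Phi>_inj by (intro the_inv_into_f_f) auto
  \<comment> \<open>\<open>H\<close> is \<open>g\<close> transported by \<open>\<Phi> n l\<close>,
    and \<open>J\<close> the corresponding integrand before the transport. \<open>J\<close> carries
    the determinant without absolute value, so that it is polynomial in \<open>l\<close>.\<close>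
  define H where "H n l y = indicator (\<Phi> n l ` S) y * g (\<Psi> n l y)" for n l y
  define J where "J n l x = indicator S x * (lin_det (blinfun_apply (\<Phi>' n l x)) * g x)" for n l x
  \<comment> \<open>Positivity of the derivative is available only in the interior of
    \<open>S\<close>. This is enough: \<open>g\<close> vanishes at distance \<open>s\<close> and
    beyond, and \<open>s < t\<close>.\<close>
  have J_eq: "J n l x = indicator S x * (\<bar>lin_det (blinfun_apply (\<Phi>' n l x))\<bar> * g (\<Psi> n l (\<Phi> n l x)))"
    if l: "0 < l" "l \<le> 1" for n l x
  proof (cases "x \<in> S \<and> g x \<noteq> 0")
    case True
    define U where "U = {y. infdist y K < t}"
    have U: "open U" unfolding U_def by (intro open_Collect_less continuous_intros)
    have "infdist x K < s" using g0[of x] True by force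
    then have xU: "x \<in> U" using st by (simp add: U_def)
    have US: "U \<subseteq> S" by (auto simp: U_def S_def)
    have "lin_det (blinfun_apply (\<Phi>' n l x)) > 0"
    proof (rule lin_det_pos)
      fix v :: 'a assume v: "v \<noteq> 0"
      have "0 \<le> Q' n x v \<bullet> v"
        by (rule monotone_derivative_nonneg[OF Q(1) U xU]) (use Q(4) US xU in blast)
      then have "0 \<le> (1 - l) * (Q' n x v \<bullet> v)" using l by simp
      moreover have "0 < l * (v \<bullet> v)" using l v by simp
      ultimately show "\<Phi>' n l x v \<bullet> v > 0"
        by (simp add: \<Phi>'_def blinfun.add_left blinfun.scaleR_left inner_add_left)
    qed (simp add: bounded_linear.linear[OF blinfun.bounded_linear_right])
    then show ?thesis using True \<Psi>[OF _ l] by (simp add: J_def)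
  qed (auto simp: J_def \<Psi>[OF _ l] indicator_def)
  have \<Phi>'_cont: "continuous_on A (\<Phi>' n l)" for A n l
    unfolding \<Phi>'_def by (intro continuous_intros continuous_on_subset[OF Q(2)]) auto
  have J_meas: "J n l \<in> borel_measurable borel" for n l
  proof -
    have "continuous_on S (\<lambda>x. lin_det (blinfun_apply (\<Phi>' n l x)) * g x)"
      by (intro continuous_intros continuous_on_lin_det \<Phi>'_cont continuous_on_subset[OF g]) auto
    from borel_measurable_continuous_on_indicator[OF _ this]
    have "(\<lambda>x. indicator S x *\<^sub>R (lin_det (blinfun_apply (\<Phi>' n l x)) * g x)) \<in> borel_measurable borel"
      using cS by (simp add: compact_imp_closed borel_closed)
    then show ?thesis unfolding J_def real_scaleR_def .
  qed
  have cinv: "continuous_on (\<Phi> n l ` S) (\<lambda>y. g (\<Psi> n l y))" if "0 < l" "l \<le> 1" for n l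
    unfolding \<Psi>_def using that
    by (intro continuous_on_compose2[OF g] continuous_on_inv_into \<Phi>_cont cS \<Phi>_inj) auto
  have cov: "integrable lborel (J n l)" "integral\<^sup>L lborel (J n l) = integral\<^sup>L lborel (H n l)"
    if l: "0 < l" "l \<le> 1" for n l
  proof -
    have *: "(\<lambda>x. indicator S x * (\<bar>lin_det (blinfun_apply (\<Phi>' n l x))\<bar> * g (\<Psi> n l (\<Phi> n l x)))) = J n l"
      using J_eq[OF l] by (simp add: fun_eq_iff)
    note cv = change_of_variables[OF cS has_derivative_at_withinI[OF \<Phi>_der] \<Phi>_inj[OF l] cinv[OF l], of n, unfolded *, OF J_meas]
    show "integrable lborel (J n l)" by (rule cv(1))
    show "integral\<^sup>L lborel (J n l) = integral\<^sup>L lborel (H n l)" unfolding H_def by (rule cv(2))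
  qed
  \<comment> \<open>\<open>DIM('a) + 1\<close> distinct nodes in (0, 1]; the value 0 is avoided
    because \<open>\<Phi> n 0\<close> need not be injective.\<close>
  define \<nu> where "\<nu> i = real (Suc i) / real (Suc DIM('a))" for i
  have \<nu>: "0 < \<nu> i" "\<nu> i \<le> 1" if "i \<le> DIM('a)" for i using that by (auto simp: \<nu>_def field_simps)
  have "inj_on \<nu> {..DIM('a)}" by (auto simp: inj_on_def \<nu>_def)
  then obtain L where L: "\<And>i. i \<le> DIM('a) \<Longrightarrow> degree (L i) \<le> DIM('a)"
    "\<And>p t. degree p \<le> DIM('a) \<Longrightarrow> poly p t = (\<Sum>i\<le>DIM('a). poly (L i) t * poly p (\<nu> i))"
    by (rule lagrange_weights) blast
  have J_lagrange: "J n l x = (\<Sum>i\<le>DIM('a). poly (L i) l * J n (\<nu> i) x)" for n l x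
  proof -
    obtain p where p: "degree p \<le> DIM('a)" "\<And>l. lin_det (\<lambda>v. l *\<^sub>R v + (1 - l) *\<^sub>R Q' n x v) = poly p l"
      using lin_det_pencil[of "\<lambda>v. v" "blinfun_apply (Q' n x)"] by metis
    have *: "lin_det (blinfun_apply (\<Phi>' n l x)) = poly p l" for l
      using p(2)[of l] by (simp add: \<Phi>'_def blinfun.add_left[abs_def] blinfun.scaleR_left[abs_def])
    have "J n l x = indicator S x * ((\<Sum>i\<le>DIM('a). poly (L i) l * poly p (\<nu> i)) * g x)"
      unfolding J_def * using L(2)[OF p(1), of l] by (simp only:)
    also have "\<dots> = (\<Sum>i\<le>DIM('a). poly (L i) l * (indicator S x * (poly p (\<nu> i) * g x)))"
      unfolding sum_distrib_left sum_distrib_right by (rule sum.cong) auto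
    finally show ?thesis unfolding J_def * .
  qed
  have I_lagrange: "integral\<^sup>L lborel (H n l) = (\<Sum>i\<le>DIM('a). poly (L i) l * integral\<^sup>L lborel (H n (\<nu> i)))"
    if l: "0 < l" "l \<le> 1" for n l
  proof -
    have "integral\<^sup>L lborel (J n l) = (\<integral>x. (\<Sum>i\<le>DIM('a). poly (L i) l * J n (\<nu> i) x) \<partial>lborel)"
      by (rule Bochner_Integration.integral_cong[OF refl J_lagrange])
    also have "\<dots> = (\<Sum>i\<le>DIM('a). poly (L i) l * integral\<^sup>L lborel (J n (\<nu> i)))"
      using cov(1) \<nu> by (subst Bochner_Integration.integral_sum) auto
    finally show ?thesis using cov(2) l \<nu> by simp
  qed
  define G where "G l y = indicator {y. infdist y K < l * t} y * g (rescale (1 / l) y)" for l y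
  obtain B where B: "\<And>x. x \<in> S \<Longrightarrow> norm x \<le> B" "\<And>x. x \<in> S \<Longrightarrow> norm (P x) \<le> B"
  proof -
    obtain B1 where "\<And>x. x \<in> S \<Longrightarrow> norm x \<le> B1" using compact_imp_bounded[OF cS] by (auto simp: bounded_iff)
    moreover have "compact (P ` S)" using cS P(1) by (intro compact_continuous_image) (auto intro: continuous_on_subset)
    then obtain B2 where "\<And>x. x \<in> S \<Longrightarrow> norm (P x) \<le> B2" using compact_imp_bounded by (fastforce simp: bounded_iff)
    ultimately show ?thesis using that[of "max B1 B2"] by (meson max.coboundedI1 max.coboundedI2)
  qed
  obtain M where M: "\<And>x. \<bar>g x\<bar> \<le> M"
  proof -
    have "compact (g ` S)" using cS g by (intro compact_continuous_image) (auto intro: continuous_on_subset)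
    then obtain M where "\<And>x. x \<in> S \<Longrightarrow> \<bar>g x\<bar> \<le> M" using compact_imp_bounded by (fastforce simp: bounded_iff)
    moreover have "g x = 0" if "x \<notin> S" for x using g0[of x] that st by (simp add: S_def)
    ultimately show ?thesis using that[of "max 0 M"] by (metis abs_zero max.cobounded1 max.coboundedI2)
  qed
  have H_lim: "(\<lambda>n. H n l y) \<longlonglongrightarrow> G l y" if l: "0 < l" "l \<le> 1" for l y
  proof (cases "infdist y K < l * t")
    case True
    define x where "x = rescale (1 / l) y"
    have "infdist y K < r" "1 / l * infdist y K < r"
      using rescale_domain[OF l True st(3)] by auto
    then have x: "infdist x K = infdist y K / l" "rescale l x = y"
      using rescale_props[of "1 / l" y] l by (auto simp: x_def)
    define \<kappa> where "\<kappa> = t - infdist x K"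
    have \<kappa>: "\<kappa> > 0" using True l by (simp add: \<kappa>_def x field_simps)
    have ball: "cball x d \<subseteq> S" if "d \<le> \<kappa>" for d
    proof
      fix z assume "z \<in> cball x d"
      then show "z \<in> S" using infdist_triangle[of z K x] that by (simp add: S_def \<kappa>_def dist_commute)
    qed
    have xS: "x \<in> S" using ball[of 0] \<kappa> by auto
    have near: "\<exists>z. H n l y = g z \<and> dist z x \<le> 1 / (l * real (Suc n))" if n: "1 / (l * real (Suc n)) \<le> \<kappa>" for n
    proof -
      \<comment> \<open>The radius at which the gain \<open>l * d\<^sup>2\<close> from strong
        monotonicity equals the loss \<open>1 / real (Suc n) * d\<close> from the approximation
        error at \<open>x\<close>. Hence \<open>\<Phi> n l\<close> attains the value
        \<open>y\<close> within \<open>d\<close> of \<open>x\<close>.\<close>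
      define d where "d = 1 / (l * real (Suc n))"
      have d: "d > 0" "d \<le> \<kappa>" using l n by (auto simp: d_def)
      have "\<exists>z\<in>cball x d. \<Phi> n l z - y = 0"
      proof (rule coercive_zero[OF d(1)])
        show "continuous_on (cball x d) (\<lambda>z. \<Phi> n l z - y)" by (intro continuous_intros \<Phi>_cont)
        fix z assume z: "dist x z = d"
        then have zS: "z \<in> S" using ball[OF d(2)] by auto
        have "(\<Phi> n l x - y) \<bullet> (z - x) \<ge> - (1 / real (Suc n) * d)"
        proof -
          have "\<bar>(\<Phi> n l x - y) \<bullet> (z - x)\<bar> \<le> norm (\<Phi> n l x - y) * norm (z - x)" by (rule Cauchy_Schwarz_ineq2)
          also have "\<dots> \<le> 1 / real (Suc n) * d"
            using \<Phi>_approx[OF xS l, of n] z by (intro mult_mono) (auto simp: x(2) dist_norm norm_minus_commute)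
          finally show ?thesis by simp
        qed
        moreover have "(\<Phi> n l z - \<Phi> n l x) \<bullet> (z - x) \<ge> l * d\<^sup>2"
          using \<Phi>_mono[OF zS xS l, of n] z by (simp add: dist_norm norm_minus_commute)
        moreover have "l * d\<^sup>2 = 1 / real (Suc n) * d"
          using l by (simp add: d_def power2_eq_square)
        ultimately show "0 \<le> (\<Phi> n l z - y) \<bullet> (z - x)"
          by (simp add: inner_diff_left)
      qed
      then obtain z where z: "z \<in> cball x d" "\<Phi> n l z = y" by auto
      then have "z \<in> S" using ball[OF d(2)] by auto
      moreover have "y \<in> \<Phi> n l ` S" using \<open>z \<in> S\<close> z(2) by blast
      ultimately have "H n l y = g z" using \<Psi>[OF _ l, of z n] z(2) by (auto simp: H_def)
      then show ?thesis using z by (auto simp: d_def dist_commute)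
    qed
    have lim0: "(\<lambda>n. 1 / (l * real (Suc n))) \<longlonglongrightarrow> 0"
      using tendsto_mult[OF tendsto_const[of "1 / l"] LIMSEQ_inverse_real_of_nat] by (simp add: field_simps)
    have "(\<lambda>n. H n l y) \<longlonglongrightarrow> g x"
    proof (rule tendstoI)
      fix e :: real assume "e > 0"
      then obtain \<delta> where \<delta>: "\<delta> > 0" "\<And>z. dist z x < \<delta> \<Longrightarrow> dist (g z) (g x) < e"
        using g unfolding continuous_on_iff by (metis UNIV_I)
      have "\<forall>\<^sub>F n in sequentially. 1 / (l * real (Suc n)) < min \<delta> \<kappa>"
        using order_tendstoD(2)[OF lim0, of "min \<delta> \<kappa>"] \<delta> \<kappa> by simp
      then show "\<forall>\<^sub>F n in sequentially. dist (H n l y) (g x) < e"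
      proof eventually_elim
        case (elim n)
        then obtain z where "H n l y = g z" "dist z x \<le> 1 / (l * real (Suc n))" using near[of n] by auto
        then show ?case using \<delta>(2)[of z] elim by simp
      qed
    qed
    then show ?thesis using True by (simp add: G_def x_def)
  next
    case False
    \<comment> \<open>Once the approximation error is below \<open>l * (t - s)\<close>, a point
      \<open>y\<close> at distance at least \<open>l * t\<close> can only be the image of points
      farther than \<open>s\<close> from \<open>K\<close>, where \<open>g\<close> vanishes. The gap
      between \<open>s\<close> and \<open>t\<close> thus disposes of the boundary of the
      image.\<close>
    have "\<forall>\<^sub>F n in sequentially. 1 / real (Suc n) < l * (t - s)"
      using order_tendstoD(2)[OF LIMSEQ_inverse_real_of_nat, of "l * (t - s)"] l st by (simp add: field_simps)
    then have "\<forall>\<^sub>F n in sequentially. H n l y = 0"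
    proof eventually_elim
      case (elim n)
      show ?case
      proof (cases "y \<in> \<Phi> n l ` S")
        case True
        then obtain z where z: "z \<in> S" "y = \<Phi> n l z" by blast
        have z': "infdist z K < r" "l * infdist z K < r"
          using z(1) st l mult_left_le_one_le[of "infdist z K" l] infdist_nonneg[of z K] by (auto simp: S_def)
        have "l * t \<le> infdist y K" using False by simp
        also have "\<dots> \<le> infdist (rescale l z) K + dist y (rescale l z)" by (rule infdist_triangle)
        also have "\<dots> \<le> l * infdist z K + 1 / real (Suc n)"
          using rescale_props(1)[OF l(1) z'] \<Phi>_approx[OF z(1) l, of n] z(2) by (simp add: dist_norm)
        also have "\<dots> < l * infdist z K + l * (t - s)" using elim by simp
        finally have "l * s < l * infdist z K" by (simp add: algebra_simps)
        then have "g z = 0" using l by (intro g0) simp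
        then show ?thesis using \<Psi>[OF z(1) l, of n] z(2) by (simp add: H_def)
      qed (simp add: H_def)
    qed
    then show ?thesis using False by (simp add: G_def tendsto_eventually)
  qed
  have H_meas: "H n l \<in> borel_measurable borel" if "0 < l" "l \<le> 1" for n l
  proof -
    have "compact (\<Phi> n l ` S)" using cS \<Phi>_cont by (intro compact_continuous_image)
    then show ?thesis
      using borel_measurable_continuous_on_indicator[OF _ cinv[OF that], of n]
      unfolding H_def by (simp add: compact_imp_closed borel_closed)
  qed
  have I_lim: "(\<lambda>n. integral\<^sup>L lborel (H n l)) \<longlonglongrightarrow> integral\<^sup>L lborel (G l)" if l: "0 < l" "l \<le> 1" for l
  proof (rule integral_dominated_convergence)
    show "H n l \<in> borel_measurable lborel" for n using H_meas[OF l] by simp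
    show "G l \<in> borel_measurable lborel"
      by (rule borel_measurable_LIMSEQ_real[of _ "\<lambda>n. H n l"]) (use H_lim[OF l] H_meas[OF l] in auto)
    show "AE y in lborel. (\<lambda>n. H n l y) \<longlonglongrightarrow> G l y" using H_lim[OF l] by simp
    \<comment> \<open>The ball contains the images of \<open>S\<close> under all
      \<open>\<Phi> n l\<close>: \<open>B\<close> bounds the identity part and \<open>B + 1\<close>
      the smoothed projection, independently of \<open>n\<close>.\<close>
    show "integrable lborel (\<lambda>y. M * indicator (cball 0 (2 * B + 1)) (y :: 'a))"
      using emeasure_lborel_cball_finite[of "0::'a" "2 * B + 1"]
      by (intro integrable_mult_right integrable_real_indicator) auto
    show "AE y in lborel. norm (H n l y) \<le> M * indicator (cball 0 (2 * B + 1)) y" for n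
    proof (intro AE_I2)
      fix y
      show "norm (H n l y) \<le> M * indicator (cball 0 (2 * B + 1)) y"
      proof (cases "y \<in> \<Phi> n l ` S")
        case True
        then obtain z where z: "z \<in> S" "y = \<Phi> n l z" by blast
        have "norm y \<le> l * norm z + (1 - l) * norm (Q n z)"
          unfolding z(2) \<Phi>_def using l by (metis abs_of_nonneg diff_ge_0_iff_ge less_imp_le norm_scaleR norm_triangle_ineq)
        also have "\<dots> \<le> 1 * B + 1 * (B + 1)"
        proof (intro add_mono mult_mono)
          have "norm (Q n z) \<le> norm (P z) + norm (Q n z - P z)" by (metis add.commute diff_add_cancel norm_triangle_ineq)
          also have "\<dots> \<le> B + 1" using B(2)[OF z(1)] Q(3)[OF z(1), of n]
            by (intro add_mono) (auto intro: order.trans)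
          finally show "norm (Q n z) \<le> B + 1" .
        qed (use l B(1)[OF z(1)] in auto)
        finally have "y \<in> cball 0 (2 * B + 1)" by simp
        then show ?thesis using M by (simp add: H_def True)
      next
        case False
        then show ?thesis using order.trans[OF abs_ge_zero M] by (simp add: H_def indicator_def)
      qed
    qed
  qed
  define p where "p = (\<Sum>i\<le>DIM('a). Polynomial.smult (integral\<^sup>L lborel (G (\<nu> i))) (L i))"
  show ?thesis
  proof
    show "degree p \<le> DIM('a)" unfolding p_def
      by (rule degree_sum_le) (auto intro: order.trans[OF degree_smult_le] L(1))
    fix l :: real assume l: "0 < l" "l \<le> 1"
    have "(\<lambda>n. integral\<^sup>L lborel (H n l)) \<longlonglongrightarrow> (\<Sum>i\<le>DIM('a). poly (L i) l * integral\<^sup>L lborel (G (\<nu> i)))"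
      unfolding I_lagrange[OF l] by (intro tendsto_intros I_lim \<nu>) auto
    then have "integral\<^sup>L lborel (G l) = (\<Sum>i\<le>DIM('a). poly (L i) l * integral\<^sup>L lborel (G (\<nu> i)))"
      using I_lim[OF l] LIMSEQ_unique by blast
    then show "(\<integral>y. indicator {y. infdist y K < l * t} y * g (rescale (1 / l) y) \<partial>lborel) = poly p l"
      by (simp add: G_def[abs_def] p_def poly_sum mult.commute)
  qed
qed

end


section \<open>The local Steiner formula\<close>

lemma borel_preimage_on:
  assumes "continuous_on U f" "U \<in> sets borel" "B \<in> sets borel"
  shows "{x \<in> U. f x \<in> B} \<in> sets borel"
proof -
  have "f \<in> borel_measurable (restrict_space borel U)"
    using assms by (intro borel_measurable_continuous_on_restrict)
  then have "f -` B \<inter> space (restrict_space borel U) \<in> sets (restrict_space borel U)"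
    using assms(3) by (rule measurable_sets)
  then show ?thesis
    using assms(2) by (simp add: sets_restrict_space_iff space_restrict_space vimage_def Int_def conj_commute)
qed

section \<open>Functions that are polynomial on (0, 1]\<close>

definition polynomial_on_01 :: "nat \<Rightarrow> (real \<Rightarrow> real) \<Rightarrow> bool" where
  "polynomial_on_01 d f \<longleftrightarrow> (\<exists>p. degree p \<le> d \<and> (\<forall>l. 0 < l \<longrightarrow> l \<le> 1 \<longrightarrow> f l = poly p l))"

lemma polynomial_on_01_zero: "polynomial_on_01 d (\<lambda>_. 0)"
  unfolding polynomial_on_01_def by (rule exI[of _ 0]) simp

lemma polynomial_on_01_add:
  assumes "polynomial_on_01 d f" "polynomial_on_01 d g"
  shows "polynomial_on_01 d (\<lambda>l. f l + g l)"
proof -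
  obtain p q where "degree p \<le> d" "degree q \<le> d" "\<forall>l. 0 < l \<longrightarrow> l \<le> 1 \<longrightarrow> f l = poly p l"
    "\<forall>l. 0 < l \<longrightarrow> l \<le> 1 \<longrightarrow> g l = poly q l"
    using assms unfolding polynomial_on_01_def by blast
  then show ?thesis
    unfolding polynomial_on_01_def by (intro exI[of _ "p + q"]) (auto intro: degree_add_le)
qed

lemma polynomial_on_01_diff:
  assumes "polynomial_on_01 d f" "polynomial_on_01 d g"
  shows "polynomial_on_01 d (\<lambda>l. f l - g l)"
proof -
  obtain p q where "degree p \<le> d" "degree q \<le> d" "\<forall>l. 0 < l \<longrightarrow> l \<le> 1 \<longrightarrow> f l = poly p l"
    "\<forall>l. 0 < l \<longrightarrow> l \<le> 1 \<longrightarrow> g l = poly q l"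
    using assms unfolding polynomial_on_01_def by blast
  then show ?thesis
    unfolding polynomial_on_01_def by (intro exI[of _ "p - q"]) (auto intro: degree_diff_le)
qed

lemma polynomial_on_01_sum:
  "(\<And>i. i \<in> I \<Longrightarrow> polynomial_on_01 d (f i)) \<Longrightarrow> polynomial_on_01 d (\<lambda>l. \<Sum>i\<in>I. f i l)"
  by (induction I rule: infinite_finite_induct) (auto intro: polynomial_on_01_zero polynomial_on_01_add)

text \<open>Each \<open>f n\<close> is recovered from its values at \<open>d + 1\<close> nodes
  through weights independent of \<open>n\<close>, so the limit obeys the same Lagrange
  formula.\<close>

lemma polynomial_on_01_limit:
  assumes f: "\<And>n. polynomial_on_01 d (f n)"
    and lim: "\<And>l. 0 < l \<Longrightarrow> l \<le> 1 \<Longrightarrow> (\<lambda>n. f n l) \<longlonglongrightarrow> F l"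
  shows "polynomial_on_01 d F"
proof -
  define \<nu> where "\<nu> i = real (Suc i) / real (Suc d)" for i
  have \<nu>: "0 < \<nu> i" "\<nu> i \<le> 1" if "i \<le> d" for i using that by (auto simp: \<nu>_def field_simps)
  have "inj_on \<nu> {..d}" by (auto simp: inj_on_def \<nu>_def)
  then obtain L where L: "\<And>i. i \<le> d \<Longrightarrow> degree (L i) \<le> d"
    "\<And>p t. degree p \<le> d \<Longrightarrow> poly p t = (\<Sum>i\<le>d. poly (L i) t * poly p (\<nu> i))"
    by (rule lagrange_weights) blast
  have fL: "f n l = (\<Sum>i\<le>d. poly (L i) l * f n (\<nu> i))" if l: "0 < l" "l \<le> 1" for n l
  proof -
    obtain p where p: "degree p \<le> d" "\<And>l. 0 < l \<Longrightarrow> l \<le> 1 \<Longrightarrow> f n l = poly p l"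
      using f[of n] unfolding polynomial_on_01_def by blast
    have "f n l = poly p l" using p(2) l by blast
    also have "\<dots> = (\<Sum>i\<le>d. poly (L i) l * poly p (\<nu> i))" by (rule L(2)[OF p(1)])
    also have "\<dots> = (\<Sum>i\<le>d. poly (L i) l * f n (\<nu> i))" by (rule sum.cong) (auto simp: p(2) \<nu>)
    finally show ?thesis .
  qed
  define p where "p = (\<Sum>i\<le>d. Polynomial.smult (F (\<nu> i)) (L i))"
  have "degree p \<le> d" unfolding p_def
    by (rule degree_sum_le) (auto intro: order.trans[OF degree_smult_le] L(1))
  moreover have "F l = poly p l" if l: "0 < l" "l \<le> 1" for l
  proof -
    have "(\<lambda>n. f n l) \<longlonglongrightarrow> (\<Sum>i\<le>d. poly (L i) l * F (\<nu> i))"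
      unfolding fL[OF l] by (intro tendsto_intros lim \<nu>) auto
    then have "F l = (\<Sum>i\<le>d. poly (L i) l * F (\<nu> i))"
      using lim[OF l] LIMSEQ_unique by blast
    then show ?thesis by (simp add: p_def poly_sum mult.commute)
  qed
  ultimately show ?thesis unfolding polynomial_on_01_def by blast
qed

section \<open>Volumes of local tubes\<close>

definition normal_pair :: "'a::euclidean_space set \<Rightarrow> 'a \<Rightarrow> 'a \<times> 'a" where
  "normal_pair K x = (closest_point K x, (x - closest_point K x) /\<^sub>R norm (x - closest_point K x))"

definition local_tube :: "'a::euclidean_space set \<Rightarrow> real \<Rightarrow> ('a \<times> 'a) set \<Rightarrow> 'a set" where
  "local_tube K R B = {x \<in> parallel_set K R - K. normal_pair K x \<in> B}"

context prox_regular
begin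

lemma infdist_pos_iff: "0 < infdist x K \<longleftrightarrow> x \<notin> K"
  using in_closed_iff_infdist_zero[OF compact_imp_closed[OF compact_K] K_nonempty, of x] infdist_nonneg[of x K]
  by auto

lemma local_tube_eq: "local_tube K R B = {x. 0 < infdist x K \<and> infdist x K \<le> R \<and> normal_pair K x \<in> B}"
  by (auto simp: local_tube_def parallel_set_def infdist_pos_iff)

lemma open_infdist_less: "open {x. infdist x K < t}"
  by (intro open_Collect_less continuous_intros)

lemma continuous_on_normal_pair: "continuous_on {x. 0 < infdist x K \<and> infdist x K < r} (normal_pair K)"
proof -
  have "norm (x - proj x) \<noteq> 0" if "0 < infdist x K" for x
    using that by (simp add: norm_proj del: norm_eq_zero)
  then show ?thesis
    unfolding normal_pair_def
    by (intro continuous_intros continuous_on_subset[OF continuous_on_proj]) auto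
qed

lemma continuous_on_rescale: "continuous_on {x. infdist x K < r} (rescale l)"
  unfolding rescale_def by (intro continuous_intros continuous_on_proj)

lemma normal_pair_rescale:
  assumes "l > 0" "infdist x K < r" "l * infdist x K < r"
  shows "normal_pair K (rescale l x) = normal_pair K x"
proof -
  have "rescale l x - proj (rescale l x) = l *\<^sub>R (x - proj x)"
    unfolding rescale_props(2)[OF assms] by (simp add: rescale_def)
  then show ?thesis
    unfolding normal_pair_def rescale_props(2)[OF assms] using assms(1) by simp
qed

lemma emeasure_parallel_finite: "emeasure lborel {x. infdist x K < t} < \<infinity>"
proof -
  have "{x. infdist x K < t} \<subseteq> {x. infdist x K \<le> max t 1}" by auto
  moreover have "bounded {x. infdist x K \<le> max t 1}"
    by (intro compact_imp_bounded compact_parallel) simp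
  ultimately show ?thesis using bounded_subset emeasure_bounded_finite by blast
qed

text \<open>\<open>N l\<close> is the image of Lebesgue measure on \<open>U l\<close> under
  \<open>rescale (1 / l)\<close>. Polynomial dependence on \<open>l\<close> is known for integrals
  of continuous functions, passes to open sets by approximating their indicators, and then to Borel
  sets by Dynkin's theorem, since open sets are stable under intersection.\<close>

lemma rescale_measure_polynomial:
  assumes st: "0 < s" "s < t" "t < r" and A: "A \<in> sets borel" "A \<subseteq> {x. infdist x K < s}"
  shows "polynomial_on_01 DIM('a) (\<lambda>l. measure lborel {y. infdist y K < l * t \<and> rescale (1 / l) y \<in> A})"
proof -
  define U where "U l = {y. infdist y K < l * t}" for l
  define N where "N l = distr (restrict_space lborel (U l)) borel (rescale (1 / l))" for l
  define V where "V = {x. infdist x K < s}"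
  have U_sub: "U l \<subseteq> {x. infdist x K < r}" if "0 < l" "l \<le> 1" for l
  proof -
    have lt: "l * t \<le> t" using that st by (intro mult_left_le_one_le) auto
    show ?thesis
    proof
      fix x assume "x \<in> U l"
      then have "infdist x K < l * t" by (simp add: U_def)
      then have "infdist x K < r" using lt st(3) by linarith
      then show "x \<in> {x. infdist x K < r}" by simp
    qed
  qed
  have U_borel [measurable]: "U l \<in> sets borel" for l using open_infdist_less by (simp add: U_def)
  have V_borel [measurable]: "V \<in> sets borel" using open_infdist_less by (simp add: V_def)
  have resc [measurable]: "rescale (1 / l) \<in> restrict_space lborel (U l) \<rightarrow>\<^sub>M borel" if "0 < l" "l \<le> 1" for l
  proof -
    have "rescale (1 / l) \<in> borel_measurable (restrict_space borel (U l))"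
      by (intro borel_measurable_continuous_on_restrict continuous_on_subset[OF continuous_on_rescale U_sub] that)
    then show ?thesis by (simp add: measurable_def sets_restrict_space space_restrict_space)
  qed
  have N_meas: "measure (N l) A = measure lborel {y. infdist y K < l * t \<and> rescale (1 / l) y \<in> A}"
    if l: "0 < l" "l \<le> 1" and A: "A \<in> sets borel" for l A
  proof -
    have "measure (N l) A = measure (restrict_space lborel (U l)) (rescale (1 / l) -` A \<inter> U l)"
      unfolding N_def using measure_distr[OF resc[OF l] A] by (simp add: space_restrict_space)
    also have "\<dots> = measure lborel (rescale (1 / l) -` A \<inter> U l)"
      by (rule measure_restrict_space) auto
    also have "rescale (1 / l) -` A \<inter> U l = {y. infdist y K < l * t \<and> rescale (1 / l) y \<in> A}"
      by (auto simp: U_def)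
    finally show ?thesis .
  qed
  have N_fin: "finite_measure (N l)" if l: "0 < l" "l \<le> 1" for l
  proof
    have "emeasure (N l) (space (N l)) = emeasure (restrict_space lborel (U l)) (U l)"
      unfolding N_def using emeasure_distr[OF resc[OF l], of UNIV] by (simp add: space_restrict_space)
    also have "\<dots> = emeasure lborel (U l)" by (rule emeasure_restrict_space) auto
    also have "\<dots> < \<infinity>" unfolding U_def by (rule emeasure_parallel_finite)
    finally show "emeasure (N l) (space (N l)) \<noteq> \<infinity>" by simp
  qed
  have sets_N [measurable_cong]: "sets (N l) = sets borel" for l by (simp add: N_def)
  have N_int: "integral\<^sup>L (N l) g = (\<integral>y. indicator (U l) y * g (rescale (1 / l) y) \<partial>lborel)"
    if l: "0 < l" "l \<le> 1" and g: "g \<in> borel_measurable borel" for g :: "'a \<Rightarrow> real" and l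
    unfolding N_def using integral_distr[OF resc[OF l] g]
      integral_restrict_space[of "U l" lborel "\<lambda>y. g (rescale (1 / l) y)"] by simp
  \<comment> \<open>Intersecting with \<open>V\<close> keeps the test functions zero at distance
    \<open>s\<close> and beyond, as \<open>rescale_integral_polynomial\<close> demands, while
    \<open>A\<close> may still range over all Borel sets.\<close>
  let ?P = "\<lambda>A. polynomial_on_01 DIM('a) (\<lambda>l. measure (N l) (A \<inter> V))"
  have P_open: "?P W" if W: "open W" for W
  proof -
    define W' where "W' = W \<inter> V"
    have W': "open W'" using W open_infdist_less by (auto simp: W'_def V_def)
    \<comment> \<open>The distance to the empty set is 0 by convention, so the complement of
      \<open>W'\<close> has to be nonempty for \<open>g\<close> to be positive on
      \<open>W'\<close>.\<close>
    have "V \<noteq> UNIV"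
    proof -
      have "bounded V" using compact_imp_bounded[OF compact_parallel[OF st(1)]]
        by (rule bounded_subset) (auto simp: V_def)
      then show ?thesis using not_bounded_UNIV by metis
    qed
    then have ne: "- W' \<noteq> {}" by (auto simp: W'_def)
    define g where "g k x = min 1 (real k * infdist x (- W'))" for k x
    have g_cont: "continuous_on UNIV (g k)" for k unfolding g_def by (intro continuous_intros)
    then have g_meas: "g k \<in> borel_measurable borel" for k by (rule borel_measurable_continuous_onI)
    have g_lim: "(\<lambda>k. g k x) \<longlonglongrightarrow> indicator W' x" for x
    proof (cases "x \<in> W'")
      case True
      then have pos: "infdist x (- W') > 0"
        using W' ne by (intro infdist_pos_not_in_closed) auto
      obtain k0 where "real k0 * infdist x (- W') > 1" using reals_Archimedean3[OF pos] by blast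
      then have "\<forall>\<^sub>F k in sequentially. g k x = 1"
        by (intro eventually_sequentiallyI[of k0])
           (smt (verit, best) g_def min_def mult_right_mono of_nat_le_iff pos)
      then show ?thesis using True by (simp add: tendsto_eventually)
    qed (simp add: g_def)
    have "polynomial_on_01 DIM('a) (\<lambda>l. integral\<^sup>L (N l) (g k))" for k
    proof -
      have g0: "g k x = 0" if "s \<le> infdist x K" for x using that by (simp add: g_def W'_def V_def)
      obtain p where "degree p \<le> DIM('a)"
        "\<And>l. 0 < l \<Longrightarrow> l \<le> 1 \<Longrightarrow>
          (\<integral>y. indicator {y. infdist y K < l * t} y * g k (rescale (1 / l) y) \<partial>lborel) = poly p l"
        using rescale_integral_polynomial[OF st g_cont g0] by metis
      then show ?thesis
        unfolding polynomial_on_01_def using N_int g_meas by (intro exI[of _ p]) (auto simp: U_def)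
    qed
    moreover have "(\<lambda>k. integral\<^sup>L (N l) (g k)) \<longlonglongrightarrow> measure (N l) (W \<inter> V)" if l: "0 < l" "l \<le> 1" for l
    proof -
      interpret finite_measure "N l" using N_fin[OF l] .
      have "(\<lambda>k. integral\<^sup>L (N l) (g k)) \<longlonglongrightarrow> integral\<^sup>L (N l) (indicator W')"
      proof (rule integral_dominated_convergence[where w = "\<lambda>_. 1"])
        show "indicator W' \<in> borel_measurable (N l)" using W' by (intro borel_measurable_indicator) (simp add: borel_open sets_N)
        show "g k \<in> borel_measurable (N l)" for k using g_meas by (simp add: N_def)
        show "AE x in N l. norm (g k x) \<le> 1" for k by (simp add: g_def infdist_nonneg)
        show "AE x in N l. (\<lambda>k. g k x) \<longlonglongrightarrow> indicator W' x" using g_lim by simp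
      qed simp
      moreover have "integral\<^sup>L (N l) (indicator W') = measure (N l) (W \<inter> V)"
        by (simp add: N_def W'_def)
      ultimately show ?thesis by simp
    qed
    ultimately show ?thesis by (rule polynomial_on_01_limit)
  qed
  have "?P A"
  proof -
    have A': "A \<in> sigma_sets UNIV {S. open S}" using A(1) by (simp add: borel_def)
    show ?thesis
    proof (induction rule: sigma_sets_induct_disjoint[OF _ _ A', case_names Int sub basic empty compl union])
      case Int then show ?case by (auto simp: Int_stable_def)
    next
      case sub then show ?case by auto
    next
      case (basic W) then show ?case using P_open by simp
    next
      case empty then show ?case by (simp add: polynomial_on_01_zero)
    next
      case (compl W)
      have W: "W \<in> sets borel" using compl(1) by (simp add: borel_def)
      have "polynomial_on_01 DIM('a) (\<lambda>l. measure (N l) (UNIV \<inter> V) - measure (N l) (W \<inter> V))"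
        by (intro polynomial_on_01_diff P_open compl) auto
      moreover have "measure (N l) ((UNIV - W) \<inter> V) = measure (N l) (UNIV \<inter> V) - measure (N l) (W \<inter> V)"
        if l: "0 < l" "l \<le> 1" for l
      proof -
        interpret finite_measure "N l" using N_fin[OF l] .
        have "(UNIV - W) \<inter> V = (UNIV \<inter> V) - (W \<inter> V)" by auto
        then show ?thesis using W by (simp add: finite_measure_Diff sets_N)
      qed
      ultimately show ?case unfolding polynomial_on_01_def by simp
    next
      case (union W)
      have W: "W i \<in> sets borel" for i using union(2) by (auto simp: borel_def)
      have "polynomial_on_01 DIM('a) (\<lambda>l. \<Sum>i<n. measure (N l) (W i \<inter> V))" for n
        by (intro polynomial_on_01_sum union)
      moreover have "(\<lambda>n. \<Sum>i<n. measure (N l) (W i \<inter> V)) \<longlonglongrightarrow> measure (N l) ((\<Union>i. W i) \<inter> V)"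
        if l: "0 < l" "l \<le> 1" for l
      proof -
        interpret finite_measure "N l" using N_fin[OF l] .
        have "(\<lambda>i. measure (N l) (W i \<inter> V)) sums measure (N l) (\<Union>i. W i \<inter> V)"
          using W union(1) by (intro finite_measure_UNION) (auto simp: sets_N disjoint_family_on_def)
        then show ?thesis by (simp add: sums_def)
      qed
      ultimately show ?case by (rule polynomial_on_01_limit)
    qed
  qed
  moreover have "A \<inter> V = A" using A(2) by (auto simp: V_def)
  ultimately show ?thesis
    unfolding polynomial_on_01_def using N_meas A(1) by simp
qed

lemma local_tube_borel:
  assumes "R < r" "B \<in> sets borel"
  shows "local_tube K R B \<in> sets borel"
proof -
  let ?U = "{x. 0 < infdist x K \<and> infdist x K \<le> R}"
  have "?U = {x. 0 < infdist x K} \<inter> {x. infdist x K \<le> R}" by auto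
  then have "?U \<in> sets borel"
    by (simp add: borel_closed borel_open closed_Collect_le open_Collect_less continuous_intros sets.Int)
  moreover have "continuous_on ?U (normal_pair K)"
    by (rule continuous_on_subset[OF continuous_on_normal_pair]) (use assms in auto)
  ultimately have "{x \<in> ?U. normal_pair K x \<in> B} \<in> sets borel" using assms(2) by (intro borel_preimage_on)
  then show ?thesis by (simp add: local_tube_eq conj_assoc)
qed

lemma local_tube_finite: "emeasure lborel (local_tube K R B) < \<infinity>"
proof -
  have "bounded {x. infdist x K \<le> max R 1}"
    by (intro compact_imp_bounded compact_parallel) simp
  moreover have "local_tube K R B \<subseteq> {x. infdist x K \<le> max R 1}" by (auto simp: local_tube_eq)
  ultimately show ?thesis using bounded_subset emeasure_bounded_finite by blast
qed

text \<open>Normal pairs are invariant under rescaling, hence the preimage of the open tube of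
  radius \<open>s\<close> under \<open>rescale (1 / l)\<close> is the open tube of radius
  \<open>l * s\<close>. Closed tubes are decreasing limits of open ones, and continuity of the
  polynomial transfers the formula to them.\<close>

lemma local_tube_polynomial:
  assumes s: "0 < s" "s < r" and B: "B \<in> sets borel"
  obtains q where "degree q \<le> DIM('a)" "poly q 0 = 0"
    "\<And>R. 0 < R \<Longrightarrow> R < s \<Longrightarrow> measure lborel (local_tube K R B) = poly q R"
proof -
  define t where "t = (s + r) / 2"
  have t: "s < t" "t < r" using s by (auto simp: t_def)
  define O' where "O' R = {x. 0 < infdist x K \<and> infdist x K < R \<and> normal_pair K x \<in> B}" for R
  let ?U = "{x. 0 < infdist x K \<and> infdist x K < s}"
  have "?U = {x. 0 < infdist x K} \<inter> {x. infdist x K < s}" by auto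
  then have "?U \<in> sets borel"
    by (simp add: borel_open open_Collect_less continuous_intros sets.Int)
  moreover have "continuous_on ?U (normal_pair K)"
    by (rule continuous_on_subset[OF continuous_on_normal_pair]) (use s in auto)
  ultimately have "{x \<in> ?U. normal_pair K x \<in> B} \<in> sets borel" using B by (intro borel_preimage_on)
  then have O_borel: "O' s \<in> sets borel" by (simp add: O'_def conj_assoc)
  have "O' s \<subseteq> {x. infdist x K < s}" by (auto simp: O'_def)
  from rescale_measure_polynomial[OF s(1) t O_borel this]
  obtain p where p: "degree p \<le> DIM('a)"
    "\<And>l. 0 < l \<Longrightarrow> l \<le> 1 \<Longrightarrow> measure lborel {y. infdist y K < l * t \<and> rescale (1 / l) y \<in> O' s} = poly p l"
    unfolding polynomial_on_01_def by blast
  have O_eq: "{y. infdist y K < l * t \<and> rescale (1 / l) y \<in> O' s} = O' (l * s)" if l: "0 < l" "l \<le> 1" for l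
  proof -
    have "rescale (1 / l) y \<in> O' s \<longleftrightarrow> y \<in> O' (l * s)" if y: "infdist y K < l * t" for y
    proof -
      have y': "infdist y K < r" "1 / l * infdist y K < r"
        using rescale_domain[OF l y t(2)] by auto
      have "1 / l > 0" using l by simp
      note * = rescale_props(1)[OF this y'] normal_pair_rescale[OF this y']
      show ?thesis
        unfolding O'_def mem_Collect_eq * using l by (auto simp: field_simps zero_less_divide_iff)
    qed
    moreover have "infdist y K < l * t" if "y \<in> O' (l * s)" for y
      using that l t(1) by (auto simp: O'_def intro: order.strict_trans)
    ultimately show ?thesis by blast
  qed
  define q where "q = p \<circ>\<^sub>p [:0, 1 / s:]"
  have O_poly: "measure lborel (O' R) = poly q R" if "0 < R" "R \<le> s" for R
    using p(2)[of "R / s"] O_eq[of "R / s"] that s by (simp add: q_def poly_pcompose)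
  have "degree q \<le> DIM('a)"
    unfolding q_def degree_pcompose using p(1) s by simp
  have O_fin: "O' R \<in> fmeasurable lborel" if "R \<le> s" for R
  proof -
    have "O' R = O' s \<inter> {x. infdist x K < R}" using that by (auto simp: O'_def)
    then have "O' R \<in> sets borel" using O_borel open_infdist_less by (simp add: sets.Int)
    moreover have "emeasure lborel (O' R) \<le> emeasure lborel {x. infdist x K < R}"
      using open_infdist_less by (intro emeasure_mono) (auto simp: O'_def)
    ultimately show ?thesis
      using emeasure_parallel_finite[of R] by (auto simp: fmeasurable_def)
  qed
  have lim: "(\<lambda>n. poly q (R + (s - R) / real (Suc n))) \<longlonglongrightarrow> poly q R" for R
  proof -
    have "(\<lambda>n. R + (s - R) * (1 / real (Suc n))) \<longlonglongrightarrow> R + (s - R) * 0"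
      by (intro tendsto_intros) (use LIMSEQ_inverse_real_of_nat in \<open>simp add: inverse_eq_divide\<close>)
    then have "(\<lambda>n. R + (s - R) / real (Suc n)) \<longlonglongrightarrow> R" by simp
    then show ?thesis by (rule continuous_imp_tendsto[OF poly_isCont, unfolded o_def])
  qed
  \<comment> \<open>\<open>R = 0\<close> is included on purpose: the limit set is then empty, which
    yields \<open>poly q 0 = 0\<close>.\<close>
  have key: "poly q R = measure lborel {x. 0 < infdist x K \<and> infdist x K \<le> R \<and> normal_pair K x \<in> B}" if R: "0 \<le> R" "R < s" for R
  proof -
    define \<rho> where "\<rho> n = R + (s - R) / real (Suc n)" for n
    have \<rho>: "R < \<rho> n" "\<rho> n \<le> s" "0 < \<rho> n" for n
    proof -
      show "R < \<rho> n" using R by (simp add: \<rho>_def)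
      then show "0 < \<rho> n" using R by simp
      have "(s - R) / real (Suc n) \<le> (s - R) / 1" using R by (intro divide_left_mono) auto
      then show "\<rho> n \<le> s" by (simp add: \<rho>_def)
    qed
    have \<rho>lim: "\<rho> \<longlonglongrightarrow> R"
    proof -
      have "(\<lambda>n. R + (s - R) * (1 / real (Suc n))) \<longlonglongrightarrow> R + (s - R) * 0"
        by (intro tendsto_intros) (use LIMSEQ_inverse_real_of_nat in \<open>simp add: inverse_eq_divide\<close>)
      then show ?thesis by (simp add: \<rho>_def[abs_def])
    qed
    have "decseq \<rho>" unfolding \<rho>_def decseq_def using R by (auto intro!: divide_left_mono)
    then have dec: "decseq (\<lambda>n. O' (\<rho> n))" by (fastforce simp: decseq_def O'_def)
    have eq: "(\<Inter>n. O' (\<rho> n)) = {x. 0 < infdist x K \<and> infdist x K \<le> R \<and> normal_pair K x \<in> B}"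
    proof safe
      fix x assume x: "x \<in> (\<Inter>n. O' (\<rho> n))"
      then show "0 < infdist x K" "normal_pair K x \<in> B" by (auto simp: O'_def)
      have "infdist x K \<le> \<rho> n" for n using x by (auto simp: O'_def less_imp_le)
      then show "infdist x K \<le> R" using LIMSEQ_le_const[OF \<rho>lim] by blast
    qed (use \<rho> in \<open>auto simp: O'_def intro: le_less_trans\<close>)
    have "(\<lambda>n. measure lborel (O' (\<rho> n))) \<longlonglongrightarrow> measure lborel (\<Inter>n. O' (\<rho> n))"
      using fmeasurableD[OF O_fin[OF \<rho>(2)]] fmeasurableD2[OF O_fin[OF \<rho>(2)]] dec by (intro Lim_measure_decseq) auto
    moreover have "(\<lambda>n. measure lborel (O' (\<rho> n))) \<longlonglongrightarrow> poly q R"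
      using lim[of R, folded \<rho>_def] unfolding O_poly[OF \<rho>(3,2)] .
    ultimately show ?thesis using eq LIMSEQ_unique by metis
  qed
  show ?thesis
  proof
    show "degree q \<le> DIM('a)" by fact
    have "{x. 0 < infdist x K \<and> infdist x K \<le> 0 \<and> normal_pair K x \<in> B} = {}" by auto
    then show "poly q 0 = 0" using key[OF order.refl s(1)] by (simp only: measure_empty)
    show "measure lborel (local_tube K R B) = poly q R" if "0 < R" "R < s" for R
      using key[of R] that by (simp add: local_tube_eq)
  qed
qed

end


section \<open>From the reach to measures on the normal bundle\<close>

lemma reach_imp_prox_regular:
  fixes K :: "'a::euclidean_space set"
  assumes K: "compact K" "K \<noteq> {}" and r: "0 < r" "ereal r < reach K"
  shows "prox_regular K r"
proof -
  obtain R where R: "R > r" "\<And>x. infdist x K < R \<Longrightarrow> \<exists>!y. y \<in> K \<and> (\<forall>z\<in>K. dist x y \<le> dist x z)"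
    using r(2) unfolding reach_def less_Sup_iff by auto
  show ?thesis
  proof
    fix x y z assume x: "infdist x K < r" and yz: "y \<in> K" "z \<in> K" "dist x y = infdist x K" "dist x z = infdist x K"
    have "\<forall>w\<in>K. dist x y \<le> dist x w" "\<forall>w\<in>K. dist x z \<le> dist x w"
      using yz by (simp_all add: infdist_le)
    moreover have "infdist x K < R" using x R(1) by simp
    ultimately show "y = z" using R(2)[of x] yz(1,2) by blast
  qed (use K r in auto)
qed

lemma poly_eq_on_interval:
  fixes p q :: "real poly"
  assumes "a < b" "\<And>x. a < x \<Longrightarrow> x < b \<Longrightarrow> poly p x = poly q x"
  shows "p = q"
proof -
  have "infinite {a<..<b}" using assms(1) by simp
  moreover have "{a<..<b} \<subseteq> {x. poly (p - q) x = 0}" using assms(2) by auto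
  ultimately have "infinite {x. poly (p - q) x = 0}" using finite_subset by blast
  then show ?thesis using poly_roots_finite[of "p - q"] by auto
qed

text \<open>The polynomials obtained for different radii below the reach agree near 0 and therefore
  coincide, so that one polynomial serves up to the reach, finite or not.\<close>

lemma local_tube_polynomial_reach:
  fixes K :: "'a::euclidean_space set"
  assumes K: "compact K" "K \<noteq> {}" and pos: "0 < reach K" and B: "B \<in> sets borel"
  obtains q where "degree q \<le> DIM('a)" "poly q 0 = 0"
    "\<And>R. 0 < R \<Longrightarrow> ereal R < reach K \<Longrightarrow> measure lborel (local_tube K R B) = poly q R"
proof -
  have ex: "\<exists>q. degree q \<le> DIM('a) \<and> poly q 0 = 0 \<and>
      (\<forall>R. 0 < R \<longrightarrow> R < s \<longrightarrow> measure lborel (local_tube K R B) = poly q R)"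
    if s: "0 < s" "ereal s < reach K" for s
  proof -
    obtain r where r: "s < r" "ereal r < reach K"
      using ereal_dense2[OF s(2)] by auto
    then have "prox_regular K r" using s by (intro reach_imp_prox_regular K) auto
    from prox_regular.local_tube_polynomial[OF this s(1) r(1) B] show ?thesis by metis
  qed
  obtain s0 where s0: "0 < s0" "ereal s0 < reach K"
    using ereal_dense2[OF pos] by auto
  obtain q where q: "degree q \<le> DIM('a)" "poly q 0 = 0"
    "\<And>R. 0 < R \<Longrightarrow> R < s0 \<Longrightarrow> measure lborel (local_tube K R B) = poly q R"
    using ex[OF s0] by blast
  show ?thesis
  proof
    fix R assume R: "0 < R" "ereal R < reach K"
    obtain s where s: "R < s" "ereal s < reach K" using ereal_dense2[OF R(2)] by auto
    obtain q' where q': "\<And>R. 0 < R \<Longrightarrow> R < s \<Longrightarrow> measure lborel (local_tube K R B) = poly q' R"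
      using ex[of s] s R by force
    have "q = q'"
      by (rule poly_eq_on_interval[of 0 "min s0 s"]) (use q q' s0 s R in \<open>auto simp flip: q(3)\<close>)
    then show "measure lborel (local_tube K R B) = poly q R" using q' R s by simp
  qed (use q in auto)
qed

text \<open>The left-hand side of the local Steiner formula at a fixed radius, as a measure in the
  Borel set. For radii below the reach these measures are finite, and the support measures turn out
  to be signed combinations of them.\<close>

definition tube_measure :: "'a::euclidean_space set \<Rightarrow> real \<Rightarrow> ('a \<times> 'a) measure" where
  "tube_measure K R = distr (restrict_space lborel (parallel_set K R - K)) normal_bundle_space (normal_pair K)"

lemma sets_normal_bundle_space:
  "B \<in> sets normal_bundle_space \<longleftrightarrow> B \<in> sets borel \<and> B \<subseteq> UNIV \<times> sphere 0 1"
  unfolding normal_bundle_space_def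
  by (subst sets_restrict_space_iff) (auto intro!: borel_closed closed_Times)

lemma sets_tube_measure [simp]: "sets (tube_measure K R) = sets normal_bundle_space"
  by (simp add: tube_measure_def)

context prox_regular
begin

lemma tube_borel: "parallel_set K R - K \<in> sets borel"
proof -
  have "parallel_set K R - K = {x. infdist x K \<le> R} - K" by (auto simp: parallel_set_def)
  then show ?thesis
    using compact_imp_closed[OF compact_K] by (simp add: borel_closed closed_Collect_le continuous_intros sets.Diff)
qed

lemma tube_finite: "emeasure lborel (parallel_set K R - K) < \<infinity>"
  using local_tube_finite[of R UNIV] by (simp add: local_tube_def set_diff_eq)

lemma normal_pair_measurable:
  assumes "R < r"
  shows "normal_pair K \<in> restrict_space lborel (parallel_set K R - K) \<rightarrow>\<^sub>M normal_bundle_space"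
  unfolding normal_bundle_space_def
proof (rule measurable_restrict_space2)
  show "normal_pair K \<in> space (restrict_space lborel (parallel_set K R - K)) \<rightarrow> UNIV \<times> sphere 0 1"
  proof
    fix x assume "x \<in> space (restrict_space lborel (parallel_set K R - K))"
    then have "norm (x - proj x) \<noteq> 0"
      using infdist_pos_iff[of x] by (simp add: space_restrict_space norm_proj del: norm_eq_zero)
    then show "normal_pair K x \<in> UNIV \<times> sphere 0 1" by (simp add: normal_pair_def)
  qed
  have "normal_pair K \<in> borel_measurable (restrict_space borel (parallel_set K R - K))"
    by (rule borel_measurable_continuous_on_restrict[OF continuous_on_subset[OF continuous_on_normal_pair]])
       (use assms infdist_pos_iff in \<open>auto simp: parallel_set_def\<close>)
  then show "normal_pair K \<in> restrict_space lborel (parallel_set K R - K) \<rightarrow>\<^sub>M borel"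
    by (simp add: measurable_def sets_restrict_space space_restrict_space)
qed

lemma normal_pair_props:
  "proj x \<in> K" "x \<notin> K \<Longrightarrow> norm ((x - proj x) /\<^sub>R norm (x - proj x)) = 1"
proof -
  show "proj x \<in> K" by (rule proj_in)
  then have "norm (x - proj x) \<noteq> 0" if "x \<notin> K" using that by auto
  then show "norm ((x - proj x) /\<^sub>R norm (x - proj x)) = 1" if "x \<notin> K" using that by simp
qed

text \<open>The bound on \<open>F\<close> is available only over \<open>K\<close>, while the measure
  lives on the whole normal bundle space; hence an almost everywhere statement.\<close>

lemma AE_tube_measure:
  fixes F :: "'a \<times> 'a \<Rightarrow> real"
  assumes R: "R < r" and F: "F \<in> borel_measurable normal_bundle_space"
    and bd: "\<And>x u. x \<in> K \<Longrightarrow> norm u = 1 \<Longrightarrow> \<bar>F (x, u)\<bar> \<le> C"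
  shows "AE x in tube_measure K R. \<bar>F x\<bar> \<le> C"
proof -
  have "{x \<in> space normal_bundle_space. \<bar>F x\<bar> \<le> C} \<in> sets normal_bundle_space"
    using F by measurable
  moreover have "AE x in restrict_space lborel (parallel_set K R - K). \<bar>F (normal_pair K x)\<bar> \<le> C"
    using bd[OF normal_pair_props] by (intro AE_I2) (simp add: space_restrict_space normal_pair_def)
  ultimately show ?thesis
    unfolding tube_measure_def by (simp add: AE_distr_iff[OF normal_pair_measurable[OF R]])
qed

lemma emeasure_tube_measure:
  assumes R: "R < r" and B: "B \<in> sets normal_bundle_space"
  shows "emeasure (tube_measure K R) B = emeasure lborel (local_tube K R B)"
proof -
  have "emeasure (tube_measure K R) B =
      emeasure (restrict_space lborel (parallel_set K R - K)) (normal_pair K -` B \<inter> (parallel_set K R - K))"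
    unfolding tube_measure_def
    using emeasure_distr[OF normal_pair_measurable[OF R] B] by (simp add: space_restrict_space)
  also have "\<dots> = emeasure lborel (normal_pair K -` B \<inter> (parallel_set K R - K))"
    by (rule emeasure_restrict_space) (auto simp: tube_borel)
  also have "normal_pair K -` B \<inter> (parallel_set K R - K) = local_tube K R B"
    by (auto simp: local_tube_def)
  finally show ?thesis .
qed

lemma measure_tube_measure:
  "R < r \<Longrightarrow> B \<in> sets normal_bundle_space \<Longrightarrow> measure (tube_measure K R) B = measure lborel (local_tube K R B)"
  by (simp add: measure_def emeasure_tube_measure)

lemma finite_tube_measure: "R < r \<Longrightarrow> finite_measure (tube_measure K R)"
proof
  assume R: "R < r"
  have sp: "space (tube_measure K R) \<in> sets normal_bundle_space"
    by (simp add: tube_measure_def sets.top)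
  show "emeasure (tube_measure K R) (space (tube_measure K R)) \<noteq> \<infinity>"
    unfolding emeasure_tube_measure[OF R sp] using local_tube_finite[of R] by (metis infinity_ennreal_def less_irrefl)
qed

lemma integral_tube_measure:
  fixes F :: "'a \<times> 'a \<Rightarrow> real"
  assumes R: "R < r" and F: "F \<in> borel_measurable normal_bundle_space"
  shows "integral\<^sup>L (tube_measure K R) F = (\<integral>x. indicator (parallel_set K R - K) x * F (normal_pair K x) \<partial>lborel)"
  unfolding tube_measure_def using integral_distr[OF normal_pair_measurable[OF R] F]
    integral_restrict_space[of "parallel_set K R - K" lborel "\<lambda>x. F (normal_pair K x)"] tube_borel by simp

end

lemma local_tube_lebesgue:
  assumes "prox_regular K r" "R < r" "B \<in> sets borel"
  shows "measure lebesgue {x \<in> parallel_set K R - K.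
    (closest_point K x, (x - closest_point K x) /\<^sub>R norm (x - closest_point K x)) \<in> B} = measure lborel (local_tube K R B)"
  using prox_regular.local_tube_borel[OF assms]
  by (simp add: local_tube_def normal_pair_def)

section \<open>Existence of the support measures\<close>

lemma unit_ball_vol_nat_pos: "unit_ball_vol (real n) > 0"
  by (rule unit_ball_vol_pos) simp

text \<open>Passes from the index \<open>k < n\<close> of the support measures to the exponent
  \<open>j = n - k\<close>. The exponent 0 is not reached, so its coefficient has to vanish.\<close>

lemma sum_atMost_reverse:
  fixes f :: "nat \<Rightarrow> real"
  assumes "f 0 = 0"
  shows "(\<Sum>k<n. f (n - k)) = (\<Sum>j\<le>n. f j)"
proof -
  have "(\<Sum>k<n. f (n - k)) = (\<Sum>j\<in>{1..n}. f j)"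
    by (rule sum.reindex_bij_witness[of _ "\<lambda>j. n - j" "\<lambda>k. n - k"]) auto
  also have "\<dots> = (\<Sum>j\<in>insert 0 {1..n}. f j)" using assms by simp
  also have "insert 0 {1..n} = {..n}" by auto
  finally show ?thesis .
qed

text \<open>The coefficients of the tube polynomial are fixed linear combinations \<open>c\<close>
  of the tube volumes at d + 1 radii. Defined in this way for all \<open>B\<close> at once, they
  inherit countable additivity from the tube measures.\<close>

lemma support_measure_exists:
  fixes K :: "'a::euclidean_space set"
  assumes K: "compact K" "K \<noteq> {}" and pos: "0 < reach K"
  shows "\<exists>\<Lambda>. is_support_measures K \<Lambda>"
proof -
  let ?d = "DIM('a)"
  obtain s0 where s0: "0 < s0" "ereal s0 < reach K"
    using ereal_dense2[OF pos] by auto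
  have reg: "prox_regular K s0" by (rule reach_imp_prox_regular[OF K s0])
  \<comment> \<open>The denominator \<open>?d + 2\<close> keeps the largest of the d + 1 radii
    strictly below \<open>s0\<close>.\<close>
  define \<nu> where "\<nu> i = s0 * (real (Suc i) / real (?d + 2))" for i
  have \<nu>: "0 < \<nu> i" "\<nu> i < s0" if "i \<le> ?d" for i
  proof -
    show "0 < \<nu> i" using s0 by (simp add: \<nu>_def)
    have "s0 * (real (Suc i) / real (?d + 2)) < s0 * 1" using s0 that by (intro mult_strict_left_mono) auto
    then show "\<nu> i < s0" by (simp add: \<nu>_def)
  qed
  have \<nu>_reach: "ereal (\<nu> i) < reach K" if "i \<le> ?d" for i
    using \<nu>(2)[OF that] s0(2) by (metis ereal_less_le less_imp_le order.strict_trans1)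
  have "inj_on \<nu> {..?d}" using s0 by (auto simp: inj_on_def \<nu>_def)
  then obtain W where W: "\<And>c k. k \<le> ?d \<Longrightarrow> (\<Sum>i\<le>?d. W k i * (\<Sum>j\<le>?d. c j * \<nu> i ^ j)) = c k"
    using vandermonde_weights[of \<nu> ?d] by blast
  define c where "c B k = (\<Sum>i\<le>?d. W k i * measure lborel (local_tube K (\<nu> i) B))" for B k
  have c: "c B 0 = 0" "\<And>R. 0 < R \<Longrightarrow> ereal R < reach K \<Longrightarrow> measure lborel (local_tube K R B) = (\<Sum>j\<le>?d. c B j * R ^ j)"
    if B: "B \<in> sets borel" for B
  proof -
    obtain q where q: "degree q \<le> ?d" "poly q 0 = 0"
      "\<And>R. 0 < R \<Longrightarrow> ereal R < reach K \<Longrightarrow> measure lborel (local_tube K R B) = poly q R"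
      using local_tube_polynomial_reach[OF K pos B] by blast
    have ev: "poly q x = (\<Sum>j\<le>?d. coeff q j * x ^ j)" for x
      by (subst poly_as_sum_of_monoms'[OF q(1), symmetric]) (simp add: poly_sum poly_monom)
    have "c B k = (\<Sum>i\<le>?d. W k i * (\<Sum>j\<le>?d. coeff q j * \<nu> i ^ j))" for k
      unfolding c_def by (rule sum.cong) (auto simp: q(3)[OF \<nu>(1) \<nu>_reach] ev)
    then have ck: "c B k = coeff q k" if "k \<le> ?d" for k using W that by simp
    show "c B 0 = 0" using ck[of 0] q(2) by (simp add: poly_0_coeff_0)
    show "measure lborel (local_tube K R B) = (\<Sum>j\<le>?d. c B j * R ^ j)" if "0 < R" "ereal R < reach K" for R
      using q(3)[OF that] by (simp add: ev ck)
  qed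
  define \<Lambda> where "\<Lambda> k B = c B (?d - k) / unit_ball_vol (real (?d - k))" for k B
  have "signed_measure normal_bundle_space (\<Lambda> k)" for k
    unfolding signed_measure_def
  proof (intro conjI allI impI)
    show "\<Lambda> k {} = 0" by (simp add: \<Lambda>_def c_def local_tube_def)
    fix A :: "nat \<Rightarrow> ('a \<times> 'a) set" assume A: "range A \<subseteq> sets normal_bundle_space" "disjoint_family A"
    have "(\<lambda>i. c (A i) k') sums c (\<Union>i. A i) k'" for k'
      unfolding c_def
    proof (intro sums_sum sums_mult)
      fix i assume "i \<in> {..?d}"
      then have i: "i \<le> ?d" by simp
      interpret finite_measure "tube_measure K (\<nu> i)"
        by (rule prox_regular.finite_tube_measure[OF reg \<nu>(2)[OF i]])
      have Ai: "A j \<in> sets normal_bundle_space" for j using A(1) by auto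
      have "(\<lambda>j. measure (tube_measure K (\<nu> i)) (A j)) sums measure (tube_measure K (\<nu> i)) (\<Union>j. A j)"
        using A by (intro finite_measure_UNION) auto
      then show "(\<lambda>j. measure lborel (local_tube K (\<nu> i) (A j))) sums measure lborel (local_tube K (\<nu> i) (\<Union>j. A j))"
        using Ai by (simp add: prox_regular.measure_tube_measure[OF reg \<nu>(2)[OF i]] sets.countable_UN)
    qed
    then show "(\<lambda>i. \<Lambda> k (A i)) sums \<Lambda> k (\<Union>i. A i)"
      unfolding \<Lambda>_def by (intro sums_divide)
  qed
  moreover have "measure lebesgue {x \<in> parallel_set K R - K.
          (closest_point K x, (x - closest_point K x) /\<^sub>R norm (x - closest_point K x)) \<in> B} =
        (\<Sum>k<?d. R ^ (?d - k) * unit_ball_vol (real (?d - k)) * \<Lambda> k B)"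
    if R: "0 < R" "ereal R < reach K" and B: "B \<in> sets normal_bundle_space" for R B
  proof -
    obtain r where r: "R < r" "ereal r < reach K" using ereal_dense2[OF R(2)] by auto
    have reg': "prox_regular K r" using r R by (intro reach_imp_prox_regular K) auto
    have B': "B \<in> sets borel" using B by (simp add: sets_normal_bundle_space)
    have "(\<Sum>k<?d. R ^ (?d - k) * unit_ball_vol (real (?d - k)) * \<Lambda> k B) = (\<Sum>k<?d. c B (?d - k) * R ^ (?d - k))"
      using unit_ball_vol_nat_pos by (intro sum.cong) (simp_all add: \<Lambda>_def less_imp_neq[symmetric])
    also have "\<dots> = (\<Sum>j\<le>?d. c B j * R ^ j)" by (rule sum_atMost_reverse) (simp add: c(1)[OF B'])
    finally show ?thesis
      using local_tube_lebesgue[OF reg' r(1) B'] c(2)[OF B' R] by simp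
  qed
  ultimately show ?thesis unfolding is_support_measures_def by blast
qed

lemma is_support_measures_support_measure:
  fixes K :: "'a::euclidean_space set"
  assumes "compact K" "K \<noteq> {}" "0 < reach K"
  shows "is_support_measures K (support_measure K)"
  unfolding support_measure_def by (rule someI_ex[OF support_measure_exists[OF assms]])

section \<open>Integration with respect to signed measures\<close>

text \<open>By linearity the hypothesis on sets gives the claim for functions with finitely many
  values, and \<open>\<lfloor>N * F x\<rfloor> / N\<close> approximates the bounded \<open>F\<close>
  uniformly within \<open>1 / N\<close>. Identities between signed combinations of integrals are
  brought to this form, which avoids subtracting measures.\<close>

lemma finite_combination_integral:
  fixes F :: "'b \<Rightarrow> real"
  assumes J: "finite J" and fin: "\<And>j. j \<in> J \<Longrightarrow> finite_measure (n j)" and sets: "\<And>j. j \<in> J \<Longrightarrow> sets (n j) = sets M"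
    and zero: "\<And>B. B \<in> sets M \<Longrightarrow> (\<Sum>j\<in>J. b j * measure (n j) B) = 0"
    and F: "F \<in> borel_measurable M" and bd: "\<And>x. x \<in> space M \<Longrightarrow> \<bar>F x\<bar> \<le> C"
  shows "(\<Sum>j\<in>J. b j * integral\<^sup>L (n j) F) = 0"
proof -
  define D where "D = (\<Sum>j\<in>J. \<bar>b j\<bar> * measure (n j) (space M))"
  have D: "D \<ge> 0" unfolding D_def by (intro sum_nonneg) auto
  have le: "\<bar>\<Sum>j\<in>J. b j * integral\<^sup>L (n j) F\<bar> \<le> D / real (Suc m)" for m
  proof -
    define N where "N = real (Suc m)"
    have N: "N > 0" by (simp add: N_def)
    define f where "f x = \<lfloor>N * F x\<rfloor>" for x
    define Z where "Z = {\<lfloor>N * (- C)\<rfloor>..\<lfloor>N * C\<rfloor>}"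
    have f_meas: "f \<in> M \<rightarrow>\<^sub>M count_space UNIV" unfolding f_def using F by measurable
    have level: "{x \<in> space M. f x = z} \<in> sets M" for z
      using measurable_sets[OF f_meas, of "{z}"] by (simp add: vimage_def Int_def conj_commute)
    have fZ: "f x \<in> Z" if "x \<in> space M" for x
    proof -
      have "- C \<le> F x" "F x \<le> C" using bd[OF that] by auto
      then have "N * (- C) \<le> N * F x" "N * F x \<le> N * C" using N by (auto simp only: mult_le_cancel_left_pos)
      then show ?thesis unfolding f_def Z_def by (simp only: atLeastAtMost_iff floor_mono)
    qed
    define G where "G x = (\<Sum>z\<in>Z. (real_of_int z / N) * indicator {x \<in> space M. f x = z} x)" for x
    have G: "G x = real_of_int (f x) / N" if "x \<in> space M" for x
    proof -
      have "G x = (\<Sum>z\<in>Z. if f x = z then real_of_int z / N else 0)"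
        unfolding G_def using that by (intro sum.cong) auto
      also have "\<dots> = real_of_int (f x) / N" using fZ[OF that] by (simp add: Z_def)
      finally show ?thesis .
    qed
    have FG: "\<bar>F x - G x\<bar> \<le> 1 / N" if "x \<in> space M" for x
    proof -
      have "\<bar>N * F x - real_of_int (f x)\<bar> \<le> 1" unfolding f_def by linarith
      then have "\<bar>N * (F x - G x)\<bar> \<le> 1" using N by (simp add: G[OF that] algebra_simps)
      then show ?thesis using N by (simp add: abs_mult pos_le_divide_eq mult.commute)
    qed
    have intG: "integral\<^sup>L (n j) G = (\<Sum>z\<in>Z. (real_of_int z / N) * measure (n j) {x \<in> space M. f x = z})"
      "integrable (n j) G" "integrable (n j) F" "\<bar>integral\<^sup>L (n j) F - integral\<^sup>L (n j) G\<bar> \<le> measure (n j) (space M) / N" if j: "j \<in> J" for j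
    proof -
      interpret finite_measure "n j" by (rule fin[OF j])
      have sp: "space (n j) = space M" by (rule sets_eq_imp_space_eq[OF sets[OF j]])
      have lv: "{x \<in> space M. f x = z} \<in> sets (n j)" for z using level by (simp add: sets[OF j])
      have ii: "integrable (n j) (indicator {x \<in> space M. f x = z} :: _ \<Rightarrow> real)" for z
        using lv by (intro integrable_real_indicator) (simp_all add: emeasure_finite less_top[symmetric])
      show 1: "integrable (n j) G" unfolding G_def by (intro Bochner_Integration.integrable_sum integrable_mult_right ii)
      have "{x \<in> space M. f x = z} \<inter> space (n j) = {x \<in> space M. f x = z}" for z by (auto simp: sp)
      then show "integral\<^sup>L (n j) G = (\<Sum>z\<in>Z. (real_of_int z / N) * measure (n j) {x \<in> space M. f x = z})"
        unfolding G_def using ii by (subst Bochner_Integration.integral_sum) auto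
      have "F \<in> borel_measurable (n j)" using F sets[OF j] by (simp cong: measurable_cong_sets)
      then show 2: "integrable (n j) F"
        using bd by (intro integrable_const_bound[where B = C]) (auto simp: sp)
      have "\<bar>integral\<^sup>L (n j) F - integral\<^sup>L (n j) G\<bar> = \<bar>\<integral>x. F x - G x \<partial>n j\<bar>" using 1 2 by simp
      also have "\<dots> \<le> (\<integral>x. \<bar>F x - G x\<bar> \<partial>n j)" by (rule integral_abs_bound)
      also have "\<dots> \<le> (\<integral>x. 1 / N \<partial>n j)"
        using 1 2 FG by (intro integral_mono) (auto simp: sp)
      finally show "\<bar>integral\<^sup>L (n j) F - integral\<^sup>L (n j) G\<bar> \<le> measure (n j) (space M) / N" by (simp add: sp)
    qed
    have "(\<Sum>j\<in>J. b j * integral\<^sup>L (n j) G) = (\<Sum>j\<in>J. \<Sum>z\<in>Z. (real_of_int z / N) * (b j * measure (n j) {x \<in> space M. f x = z}))"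
      by (intro sum.cong) (auto simp: intG(1) sum_distrib_left mult_ac)
    also have "\<dots> = (\<Sum>z\<in>Z. (real_of_int z / N) * (\<Sum>j\<in>J. b j * measure (n j) {x \<in> space M. f x = z}))"
      by (subst sum.swap) (simp add: sum_distrib_left)
    also have "\<dots> = 0" using zero[OF level] by simp
    finally have "\<bar>\<Sum>j\<in>J. b j * integral\<^sup>L (n j) F\<bar> = \<bar>\<Sum>j\<in>J. b j * (integral\<^sup>L (n j) F - integral\<^sup>L (n j) G)\<bar>"
      by (simp add: right_diff_distrib sum_subtractf)
    also have "\<dots> \<le> (\<Sum>j\<in>J. \<bar>b j\<bar> * (measure (n j) (space M) / N))"
      by (rule order.trans[OF sum_abs], rule sum_mono, unfold abs_mult, rule mult_left_mono[OF intG(4)]) auto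
    also have "\<dots> = D / N" by (simp add: D_def sum_divide_distrib)
    finally show ?thesis by (simp add: N_def)
  qed
  have "(\<lambda>m. D / real (Suc m)) \<longlonglongrightarrow> 0"
    using tendsto_mult[OF tendsto_const[of D] LIMSEQ_inverse_real_of_nat] by (simp add: field_simps)
  then have "\<bar>\<Sum>j\<in>J. b j * integral\<^sup>L (n j) F\<bar> \<le> 0"
    by (rule LIMSEQ_le_const) (use le in blast)
  then show ?thesis by simp
qed


text \<open>Clipping \<open>F\<close> at \<open>C\<close> changes none of the integrals and makes
  the bound hold everywhere.\<close>

lemma finite_combination_integral_AE:
  fixes F :: "'b \<Rightarrow> real"
  assumes J: "finite J" and fin: "\<And>j. j \<in> J \<Longrightarrow> finite_measure (n j)" and sets: "\<And>j. j \<in> J \<Longrightarrow> sets (n j) = sets M"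
    and zero: "\<And>B. B \<in> sets M \<Longrightarrow> (\<Sum>j\<in>J. b j * measure (n j) B) = 0"
    and F: "F \<in> borel_measurable M" and C: "0 \<le> C" and bd: "\<And>j. j \<in> J \<Longrightarrow> AE x in n j. \<bar>F x\<bar> \<le> C"
  shows "(\<Sum>j\<in>J. b j * integral\<^sup>L (n j) F) = 0"
proof -
  define F' where "F' x = max (- C) (min C (F x))" for x
  have F': "F' \<in> borel_measurable M" using F unfolding F'_def by measurable
  have "integral\<^sup>L (n j) F = integral\<^sup>L (n j) F'" if j: "j \<in> J" for j
  proof (rule integral_cong_AE)
    show "F \<in> borel_measurable (n j)" "F' \<in> borel_measurable (n j)"
      using F F' sets[OF j] by (simp_all cong: measurable_cong_sets)
    show "AE x in n j. F x = F' x"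
      using bd[OF j] by eventually_elim (auto simp: F'_def)
  qed
  moreover have "(\<Sum>j\<in>J. b j * integral\<^sup>L (n j) F') = 0"
    by (rule finite_combination_integral[OF J fin sets zero F', of C]) (use C in \<open>auto simp: F'_def\<close>)
  ultimately show ?thesis by simp
qed

lemma weighted_sum_measure:
  fixes a :: "'i \<Rightarrow> real"
  assumes I: "finite I" and sets: "\<And>i. i \<in> I \<Longrightarrow> sets (m i) = sets M"
  obtains \<alpha> where "sets \<alpha> = sets M" "\<And>A. A \<in> sets M \<Longrightarrow> emeasure \<alpha> A = (\<Sum>i\<in>I. ennreal (a i) * emeasure (m i) A)"
proof -
  define f where "f A = (\<Sum>i\<in>I. ennreal (a i) * emeasure (m i) A)" for A
  define \<alpha> where "\<alpha> = measure_of (space M) (sets M) f"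
  have ca: "countably_additive (sets M) f"
  proof (rule countably_additiveI)
    fix A :: "nat \<Rightarrow> _" assume A: "range A \<subseteq> sets M" "disjoint_family A"
    have "(\<Sum>j. f (A j)) = (\<Sum>i\<in>I. \<Sum>j. ennreal (a i) * emeasure (m i) (A j))"
      unfolding f_def by (rule suminf_sum) simp
    also have "\<dots> = (\<Sum>i\<in>I. ennreal (a i) * emeasure (m i) (\<Union>j. A j))"
      using A sets by (intro sum.cong refl) (simp add: suminf_emeasure)
    finally show "(\<Sum>j. f (A j)) = f (\<Union>j. A j)" by (simp add: f_def)
  qed
  have pos: "positive (sets M) f" by (simp add: positive_def f_def)
  show ?thesis
  proof (rule that[of \<alpha>])
    show "sets \<alpha> = sets M" by (simp add: \<alpha>_def)
    show "emeasure \<alpha> A = (\<Sum>i\<in>I. ennreal (a i) * emeasure (m i) A)" if "A \<in> sets M" for A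
      unfolding \<alpha>_def using emeasure_measure_of_sigma[OF sets.sigma_algebra_axioms pos ca that] by (simp add: f_def)
  qed
qed

text \<open>The supremum in \<open>positive_part\<close> is attained at \<open>A \<inter> Y\<close>:
  discarding from a competitor its part outside \<open>Y\<close> and adding what is left of
  \<open>A \<inter> Y\<close> never decreases \<open>\<nu>\<close>.\<close>

lemma positive_part_hahn:
  assumes \<alpha>: "finite_measure \<alpha>" "sets \<alpha> = sets M" and \<beta>: "finite_measure \<beta>" "sets \<beta> = sets M"
    and \<nu>: "\<And>B. B \<in> sets M \<Longrightarrow> \<nu> B = measure \<alpha> B - measure \<beta> B"
    and Y: "Y \<in> sets M" "\<And>X. X \<in> sets M \<Longrightarrow> X \<subseteq> Y \<Longrightarrow> 0 \<le> \<nu> X"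
      "\<And>X. X \<in> sets M \<Longrightarrow> X \<inter> Y = {} \<Longrightarrow> \<nu> X \<le> 0"
  shows "sets (positive_part M \<nu>) = sets M" "finite_measure (positive_part M \<nu>)"
    "\<And>A. A \<in> sets M \<Longrightarrow> measure (positive_part M \<nu>) A = \<nu> (A \<inter> Y)"
proof -
  interpret \<alpha>: finite_measure \<alpha> by fact
  interpret \<beta>: finite_measure \<beta> by fact
  show sets: "sets (positive_part M \<nu>) = sets M" by (simp add: positive_part_def)
  have add: "\<nu> (A \<union> B) = \<nu> A + \<nu> B" if "A \<in> sets M" "B \<in> sets M" "A \<inter> B = {}" for A B
    using that \<nu> \<alpha>.finite_measure_Union[of A B] \<beta>.finite_measure_Union[of A B] \<alpha>(2) \<beta>(2) by (simp add: sets.Un)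
  define f where "f A = (SUP B\<in>{B \<in> sets M. B \<subseteq> A}. ennreal (\<nu> B))" for A
  have f: "f A = ennreal (\<nu> (A \<inter> Y))" if A: "A \<in> sets M" for A
    unfolding f_def
  proof (rule antisym)
    show "(SUP B\<in>{B \<in> sets M. B \<subseteq> A}. ennreal (\<nu> B)) \<le> ennreal (\<nu> (A \<inter> Y))"
    proof (rule SUP_least, rule ennreal_leI)
      fix B assume B: "B \<in> {B \<in> sets M. B \<subseteq> A}"
      have "\<nu> B = \<nu> ((B \<inter> Y) \<union> (B - Y))" by (rule arg_cong[of _ _ \<nu>]) auto
      also have "\<dots> = \<nu> (B \<inter> Y) + \<nu> (B - Y)" using B Y(1) by (intro add) auto
      also have "\<dots> \<le> \<nu> (B \<inter> Y) + \<nu> ((A - B) \<inter> Y)"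
      proof -
        have "\<nu> (B - Y) \<le> 0" using B Y(1) by (intro Y(3)) auto
        also have "0 \<le> \<nu> ((A - B) \<inter> Y)" using A B Y(1) by (intro Y(2)) auto
        finally show ?thesis by simp
      qed
      also have "\<dots> = \<nu> ((B \<inter> Y) \<union> ((A - B) \<inter> Y))" using A B Y(1) by (intro add[symmetric]) auto
      also have "(B \<inter> Y) \<union> ((A - B) \<inter> Y) = A \<inter> Y" using B by auto
      finally show "\<nu> B \<le> \<nu> (A \<inter> Y)" .
    qed
    show "ennreal (\<nu> (A \<inter> Y)) \<le> (SUP B\<in>{B \<in> sets M. B \<subseteq> A}. ennreal (\<nu> B))"
      by (rule SUP_upper) (use A Y(1) in auto)
  qed
  have nonneg: "0 \<le> \<nu> (A \<inter> Y)" if "A \<in> sets M" for A using that Y(1) by (intro Y(2)) auto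
  have "\<nu> {} = 0" using \<nu>[of "{}"] by simp
  then have pos: "positive (sets M) f" by (simp add: positive_def f)
  have ca: "countably_additive (sets M) f"
  proof (rule countably_additiveI)
    fix A :: "nat \<Rightarrow> _" assume A: "range A \<subseteq> sets M" "disjoint_family A"
    have Ai: "A i \<in> sets M" for i using A by auto
    have "(\<lambda>i. measure \<alpha> (A i \<inter> Y) - measure \<beta> (A i \<inter> Y)) sums (measure \<alpha> (\<Union>i. A i \<inter> Y) - measure \<beta> (\<Union>i. A i \<inter> Y))"
      using A Ai Y(1) by (intro sums_diff \<alpha>.finite_measure_UNION \<beta>.finite_measure_UNION)
        (auto simp: \<alpha>(2) \<beta>(2) disjoint_family_on_def)
    moreover have "(\<Union>i. A i \<inter> Y) = (\<Union>i. A i) \<inter> Y" by auto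
    ultimately have "(\<lambda>i. \<nu> (A i \<inter> Y)) sums \<nu> ((\<Union>i. A i) \<inter> Y)"
      using Ai Y(1) by (simp add: \<nu> sets.Int sets.countable_UN)
    then show "(\<Sum>i. f (A i)) = f (\<Union>i. A i)"
      using Ai nonneg by (simp add: f sets.countable_UN suminf_ennreal_eq sums_unique[symmetric])
  qed
  have em: "emeasure (positive_part M \<nu>) A = ennreal (\<nu> (A \<inter> Y))" if "A \<in> sets M" for A
    unfolding positive_part_def f_def[abs_def, symmetric]
    using emeasure_measure_of_sigma[OF sets.sigma_algebra_axioms pos ca that] f[OF that] by simp
  then show "measure (positive_part M \<nu>) A = \<nu> (A \<inter> Y)" if "A \<in> sets M" for A
    using nonneg[OF that] that by (simp add: measure_def)
  show "finite_measure (positive_part M \<nu>)"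
  proof
    have "space (positive_part M \<nu>) = space M" by (rule sets_eq_imp_space_eq[OF sets])
    then show "emeasure (positive_part M \<nu>) (space (positive_part M \<nu>)) \<noteq> \<infinity>" by (simp add: em)
  qed
qed

text \<open>\<open>signed_integral\<close> goes through the Jordan decomposition, which cannot be
  read off from the coefficients \<open>a i\<close>. Both sides are therefore compared as one
  vanishing combination of finite measures: the \<open>m i\<close>, the positive part and the
  negative part.\<close>

lemma signed_integral_combination:
  fixes F :: "'b \<Rightarrow> real"
  assumes I: "finite I" and fin: "\<And>i. i \<in> I \<Longrightarrow> finite_measure (m i)" and sets: "\<And>i. i \<in> I \<Longrightarrow> sets (m i) = sets M"
    and \<nu>: "\<And>B. B \<in> sets M \<Longrightarrow> \<nu> B = (\<Sum>i\<in>I. a i * measure (m i) B)"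
    and F: "F \<in> borel_measurable M" and C: "0 \<le> C" and bd: "\<And>i. i \<in> I \<Longrightarrow> AE x in m i. \<bar>F x\<bar> \<le> C"
  shows "signed_integral M \<nu> F = (\<Sum>i\<in>I. a i * integral\<^sup>L (m i) F)"
proof -
  have sp: "space (m i) = space M" if "i \<in> I" for i by (rule sets_eq_imp_space_eq[OF sets[OF that]])
  have wm: "\<exists>\<alpha>. sets \<alpha> = sets M \<and> finite_measure \<alpha> \<and> (\<forall>A\<in>sets M. measure \<alpha> A = (\<Sum>i\<in>I. w i * measure (m i) A))"
    if w: "\<And>i. w i \<ge> 0" for w :: "'a \<Rightarrow> real"
  proof -
    obtain \<alpha> where \<alpha>: "sets \<alpha> = sets M" "\<And>A. A \<in> sets M \<Longrightarrow> emeasure \<alpha> A = (\<Sum>i\<in>I. ennreal (w i) * emeasure (m i) A)"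
      by (rule weighted_sum_measure[where a = w, OF I sets]) auto
    have em: "emeasure \<alpha> A = ennreal (\<Sum>i\<in>I. w i * measure (m i) A)" if "A \<in> sets M" for A
    proof -
      have "emeasure \<alpha> A = (\<Sum>i\<in>I. ennreal (w i * measure (m i) A))"
        unfolding \<alpha>(2)[OF that]
        by (rule sum.cong) (simp_all add: finite_measure.emeasure_eq_measure[OF fin] ennreal_mult w)
      also have "\<dots> = ennreal (\<Sum>i\<in>I. w i * measure (m i) A)" using w by (intro sum_ennreal) simp
      finally show ?thesis .
    qed
    have "finite_measure \<alpha>"
      by (rule finite_measureI) (use em[of "space M"] sets_eq_imp_space_eq[OF \<alpha>(1)] in simp)
    moreover have "measure \<alpha> A = (\<Sum>i\<in>I. w i * measure (m i) A)" if "A \<in> sets M" for A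
      using em[OF that] w by (simp add: measure_def sum_nonneg)
    ultimately show ?thesis using \<alpha>(1) by blast
  qed
  \<comment> \<open>Splitting the coefficients by sign represents \<open>\<nu>\<close> as a
    difference of finite measures. These are in general not mutually singular, so a Hahn set is
    still required.\<close>
  obtain \<alpha> where \<alpha>: "sets \<alpha> = sets M" "finite_measure \<alpha>" "\<And>A. A \<in> sets M \<Longrightarrow> measure \<alpha> A = (\<Sum>i\<in>I. max 0 (a i) * measure (m i) A)"
    using wm[of "\<lambda>i. max 0 (a i)"] by auto
  obtain \<beta> where \<beta>: "sets \<beta> = sets M" "finite_measure \<beta>" "\<And>A. A \<in> sets M \<Longrightarrow> measure \<beta> A = (\<Sum>i\<in>I. max 0 (- a i) * measure (m i) A)"
    using wm[of "\<lambda>i. max 0 (- a i)"] by auto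
  have \<nu>': "\<nu> B = measure \<alpha> B - measure \<beta> B" if "B \<in> sets M" for B
  proof -
    have "a i = max 0 (a i) - max 0 (- a i)" for i by auto
    then have "\<nu> B = (\<Sum>i\<in>I. (max 0 (a i) - max 0 (- a i)) * measure (m i) B)"
      using \<nu>[OF that] by simp
    then show ?thesis using that by (simp only: \<alpha>(3) \<beta>(3) left_diff_distrib sum_subtractf)
  qed
  have \<beta>\<alpha>: "sets \<beta> = sets \<alpha>" using \<alpha>(1) \<beta>(1) by simp
  interpret \<alpha>: finite_measure \<alpha> by (rule \<alpha>(2))
  interpret \<beta>: finite_measure \<beta> by (rule \<beta>(2))
  obtain Y where Y: "Y \<in> sets M" "\<And>X. X \<in> sets M \<Longrightarrow> X \<subseteq> Y \<Longrightarrow> measure \<beta> X \<le> measure \<alpha> X"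
    "\<And>X. X \<in> sets M \<Longrightarrow> X \<inter> Y = {} \<Longrightarrow> measure \<alpha> X \<le> measure \<beta> X"
    using finite_unsigned_Hahn_decomposition[OF \<alpha>(2) \<beta>(2) \<beta>\<alpha>]
    by (auto simp: \<alpha>(1) \<alpha>.emeasure_eq_measure \<beta>.emeasure_eq_measure)
  have P: "sets (positive_part M \<nu>) = sets M" "finite_measure (positive_part M \<nu>)"
    "\<And>A. A \<in> sets M \<Longrightarrow> measure (positive_part M \<nu>) A = \<nu> (A \<inter> Y)"
    using positive_part_hahn[OF \<alpha>(2,1) \<beta>(2,1) \<nu>' Y(1)] Y(2,3) by (simp_all add: \<nu>')
  have N: "sets (positive_part M (\<lambda>A. - \<nu> A)) = sets M" "finite_measure (positive_part M (\<lambda>A. - \<nu> A))"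
    "\<And>A. A \<in> sets M \<Longrightarrow> measure (positive_part M (\<lambda>A. - \<nu> A)) A = - \<nu> (A \<inter> (space M - Y))"
  proof -
    have 1: "- \<nu> B = measure \<beta> B - measure \<alpha> B" if "B \<in> sets M" for B using \<nu>'[OF that] by simp
    have 2: "space M - Y \<in> sets M" using Y(1) by auto
    have 3: "0 \<le> - \<nu> X" if "X \<in> sets M" "X \<subseteq> space M - Y" for X
      using Y(3)[OF that(1)] that \<nu>'[OF that(1)] by auto
    have 4: "- \<nu> X \<le> 0" if "X \<in> sets M" "X \<inter> (space M - Y) = {}" for X
    proof -
      have "X \<subseteq> Y" using that sets.sets_into_space[OF that(1)] by auto
      then show ?thesis using Y(2)[OF that(1)] \<nu>'[OF that(1)] by simp
    qed
    note * = positive_part_hahn[OF \<beta>(2,1) \<alpha>(2,1) 1 2 3 4]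
    show "sets (positive_part M (\<lambda>A. - \<nu> A)) = sets M" "finite_measure (positive_part M (\<lambda>A. - \<nu> A))"
      "\<And>A. A \<in> sets M \<Longrightarrow> measure (positive_part M (\<lambda>A. - \<nu> A)) A = - \<nu> (A \<inter> (space M - Y))"
      using * by blast+
  qed
  have PN: "measure (positive_part M \<nu>) B - measure (positive_part M (\<lambda>A. - \<nu> A)) B = \<nu> B" if B: "B \<in> sets M" for B
  proof -
    have "measure \<alpha> B = measure \<alpha> (B \<inter> Y) + measure \<alpha> (B \<inter> (space M - Y))"
      "measure \<beta> B = measure \<beta> (B \<inter> Y) + measure \<beta> (B \<inter> (space M - Y))"
    proof -
      have eq: "B = (B \<inter> Y) \<union> (B \<inter> (space M - Y))" "(B \<inter> Y) \<inter> (B \<inter> (space M - Y)) = {}"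
        using sets.sets_into_space[OF B] by auto
      show "measure \<alpha> B = measure \<alpha> (B \<inter> Y) + measure \<alpha> (B \<inter> (space M - Y))"
        using \<alpha>.finite_measure_Union[OF _ _ eq(2)] B Y(1) eq(1) \<alpha>(1) by (metis sets.Diff sets.Int sets.top)
      show "measure \<beta> B = measure \<beta> (B \<inter> Y) + measure \<beta> (B \<inter> (space M - Y))"
        using \<beta>.finite_measure_Union[OF _ _ eq(2)] B Y(1) eq(1) \<beta>(1) by (metis sets.Diff sets.Int sets.top)
    qed
    then show ?thesis using B Y(1) by (simp add: P(3) N(3) \<nu>' sets.Int sets.Diff)
  qed
  \<comment> \<open>\<open>Inl i\<close> stands for \<open>m i\<close>; \<open>Inr True\<close> and
    \<open>Inr False\<close> stand for the positive and the negative part, with weights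
    \<open>- 1\<close> and \<open>1\<close>.\<close>
  define J where "J = Inl ` I \<union> {Inr True, Inr False}"
  define n where "n j = (case j of Inl i \<Rightarrow> m i | Inr True \<Rightarrow> positive_part M \<nu> | Inr False \<Rightarrow> positive_part M (\<lambda>A. - \<nu> A))" for j
  define b where "b j = (case j of Inl i \<Rightarrow> a i | Inr True \<Rightarrow> - 1 | Inr False \<Rightarrow> 1)" for j
  have sumJ: "(\<Sum>j\<in>J. b j * h (n j)) = (\<Sum>i\<in>I. a i * h (m i)) - h (positive_part M \<nu>) + h (positive_part M (\<lambda>A. - \<nu> A))"
    for h :: "'b measure \<Rightarrow> real"
  proof -
    have "(\<Sum>j\<in>J. b j * h (n j)) = (\<Sum>j\<in>Inl ` I. b j * h (n j)) + (\<Sum>j\<in>{Inr True, Inr False}. b j * h (n j))"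
      unfolding J_def using I by (intro sum.union_disjoint) auto
    also have "(\<Sum>j\<in>Inl ` I. b j * h (n j)) = (\<Sum>i\<in>I. a i * h (m i))"
      by (subst sum.reindex) (auto simp: n_def b_def)
    finally show ?thesis by (simp add: n_def b_def)
  qed
  \<comment> \<open>The exceptional set is null for every \<open>m i\<close>, and
    \<open>\<nu>\<close> vanishes on all its measurable subsets, so it is null for both Jordan parts
    too.\<close>
  define E where "E = {x \<in> space M. \<not> \<bar>F x\<bar> \<le> C}"
  have E: "E \<in> sets M" unfolding E_def using F by measurable
  have null: "\<nu> (E \<inter> Z) = 0" if "Z \<in> sets M" for Z
  proof -
    have "measure (m i) (E \<inter> Z) = 0" if i: "i \<in> I" for i
    proof -
      have "emeasure (m i) E = 0"
        using AE_iff_measurable[of E "m i" "\<lambda>x. \<bar>F x\<bar> \<le> C"] bd[OF i] E sets[OF i] sp[OF i] by (auto simp: E_def)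
      then have "emeasure (m i) (E \<inter> Z) = 0"
        using E sets[OF i] by (metis emeasure_mono inf_le1 le_zero_eq)
      then show ?thesis by (simp add: measure_def)
    qed
    then show ?thesis using \<nu>[of "E \<inter> Z"] E \<open>Z \<in> sets M\<close> by simp
  qed
  have AE_part: "AE x in \<mu>. \<bar>F x\<bar> \<le> C" if \<mu>: "finite_measure \<mu>" "sets \<mu> = sets M" "measure \<mu> E = 0" for \<mu>
  proof (rule AE_I)
    show "{x \<in> space \<mu>. \<not> \<bar>F x\<bar> \<le> C} \<subseteq> E" by (simp add: E_def sets_eq_imp_space_eq[OF \<mu>(2)])
    show "emeasure \<mu> E = 0" using finite_measure.emeasure_eq_measure[OF \<mu>(1)] \<mu>(3) by simp
    show "E \<in> sets \<mu>" using E \<mu>(2) by simp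
  qed
  have "(\<Sum>j\<in>J. b j * integral\<^sup>L (n j) F) = 0"
  proof (rule finite_combination_integral_AE[where M = M, OF _ _ _ _ F C])
    show "AE x in n j. \<bar>F x\<bar> \<le> C" if "j \<in> J" for j
    proof -
      have P0: "measure (positive_part M \<nu>) E = 0" and N0: "measure (positive_part M (\<lambda>A. - \<nu> A)) E = 0"
        using P(3)[OF E] N(3)[OF E] null Y(1) by (auto simp: sets.Diff)
      consider i where "i \<in> I" "j = Inl i" | "j = Inr True" | "j = Inr False" using \<open>j \<in> J\<close> by (auto simp: J_def)
      then show ?thesis
      proof cases
        case 1
        then have "n j = m i" by (simp add: n_def)
        then show ?thesis using bd[OF 1(1)] by (simp only:)
      next
        case 2
        then have "n j = positive_part M \<nu>" by (simp add: n_def)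
        then show ?thesis using AE_part[OF P(2,1) P0] by (simp only:)
      next
        case 3
        then have "n j = positive_part M (\<lambda>A. - \<nu> A)" by (simp add: n_def)
        then show ?thesis using AE_part[OF N(2,1) N0] by (simp only:)
      qed
    qed
    show "finite J" using I by (simp add: J_def)
    show "finite_measure (n j)" "sets (n j) = sets M" if "j \<in> J" for j
      using that fin sets P N by (auto simp: J_def n_def)
    show "(\<Sum>j\<in>J. b j * measure (n j) B) = 0" if "B \<in> sets M" for B
      using sumJ[of "\<lambda>m. measure m B"] \<nu>[OF that] PN[OF that] by simp
  qed
  then show ?thesis
    using sumJ[of "\<lambda>m. integral\<^sup>L m F"] by (simp add: signed_integral_def)
qed


section \<open>The Steiner formula for Minkowski tensors\<close>

text \<open>\<open>support_measure\<close> is an unspecified choice, so only the Steiner formula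
  itself may be used. Inverting it at d + 1 radii shows that each support measure is a combination
  of tube measures; the formula for sets then gives the one for integrals.\<close>

lemma support_measure_integral:
  fixes K :: "'a::euclidean_space set" and F :: "'a \<times> 'a \<Rightarrow> real"
  assumes K: "compact K" "K \<noteq> {}" and R: "0 < R" "ereal R < reach K"
    and F: "F \<in> borel_measurable normal_bundle_space" and bd: "\<And>x u. x \<in> K \<Longrightarrow> norm u = 1 \<Longrightarrow> \<bar>F (x, u)\<bar> \<le> C"
  shows "integral\<^sup>L (tube_measure K R) F =
    (\<Sum>k<DIM('a). R ^ (DIM('a) - k) * unit_ball_vol (real (DIM('a) - k)) *
       signed_integral normal_bundle_space (support_measure K k) F)"
proof -
  let ?d = "DIM('a)" and ?\<Lambda> = "support_measure K"
  have C: "C \<ge> 0"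
  proof -
    obtain b :: 'a where "b \<in> Basis" using nonempty_Basis by blast
    moreover obtain x where "x \<in> K" using K by blast
    ultimately show ?thesis using bd[of x b] by force
  qed
  obtain s0 where s0: "R < s0" "ereal s0 < reach K" using ereal_dense2[OF R(2)] by auto
  then have s0_pos: "0 < s0" using R by simp
  have reg: "prox_regular K s0" by (rule reach_imp_prox_regular[OF K s0_pos s0(2)])
  have "0 < reach K" using R by (metis ereal_less(2) order.strict_trans)
  note \<Lambda> = is_support_measures_support_measure[OF K this]
  have tube: "measure (tube_measure K t) B = (\<Sum>k<?d. t ^ (?d - k) * unit_ball_vol (real (?d - k)) * ?\<Lambda> k B)"
    if t: "0 < t" "t < s0" and B: "B \<in> sets normal_bundle_space" for t B
  proof -
    have "ereal t < reach K" using t s0(2) by (metis ereal_less_le less_imp_le order.strict_trans1)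
    then have "measure lebesgue {x \<in> parallel_set K t - K.
          (closest_point K x, (x - closest_point K x) /\<^sub>R norm (x - closest_point K x)) \<in> B} =
        (\<Sum>k<?d. t ^ (?d - k) * unit_ball_vol (real (?d - k)) * ?\<Lambda> k B)"
      using \<Lambda> t B unfolding is_support_measures_def by blast
    moreover have "B \<in> sets borel" using B by (simp add: sets_normal_bundle_space)
    ultimately show ?thesis
      using local_tube_lebesgue[OF reg t(2)] prox_regular.measure_tube_measure[OF reg t(2) B] by simp
  qed
  define \<nu> where "\<nu> i = s0 * (real (Suc i) / real (?d + 2))" for i
  have \<nu>: "0 < \<nu> i" "\<nu> i < s0" if "i \<le> ?d" for i
  proof -
    show "0 < \<nu> i" using s0_pos by (simp add: \<nu>_def)
    have "s0 * (real (Suc i) / real (?d + 2)) < s0 * 1" using s0_pos that by (intro mult_strict_left_mono) auto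
    then show "\<nu> i < s0" by (simp add: \<nu>_def)
  qed
  have "inj_on \<nu> {..?d}" using s0_pos by (auto simp: inj_on_def \<nu>_def)
  then obtain W where W: "\<And>c k. k \<le> ?d \<Longrightarrow> (\<Sum>i\<le>?d. W k i * (\<Sum>j\<le>?d. c j * \<nu> i ^ j)) = c k"
    using vandermonde_weights[of \<nu> ?d] by blast
  have \<Lambda>_eq: "?\<Lambda> k B = (\<Sum>i\<le>?d. (W (?d - k) i / unit_ball_vol (real (?d - k))) * measure (tube_measure K (\<nu> i)) B)"
    if k: "k < ?d" and B: "B \<in> sets normal_bundle_space" for k B
  proof -
    \<comment> \<open>The constant coefficient is 0, in accordance with the missing term
      \<open>k = ?d\<close>; the others are read with exponent \<open>j\<close> and index
      \<open>?d - j\<close>.\<close>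
    define c where "c j = (if j = 0 then 0 else unit_ball_vol (real j) * ?\<Lambda> (?d - j) B)" for j
    have "measure (tube_measure K (\<nu> i)) B = (\<Sum>j\<le>?d. c j * \<nu> i ^ j)" if "i \<le> ?d" for i
    proof -
      have "measure (tube_measure K (\<nu> i)) B = (\<Sum>k<?d. c (?d - k) * \<nu> i ^ (?d - k))"
        unfolding tube[OF \<nu>[OF that] B] by (rule sum.cong) (auto simp: c_def)
      also have "\<dots> = (\<Sum>j\<le>?d. c j * \<nu> i ^ j)" by (rule sum_atMost_reverse) (simp add: c_def)
      finally show ?thesis .
    qed
    then have "(\<Sum>i\<le>?d. W (?d - k) i * measure (tube_measure K (\<nu> i)) B) = c (?d - k)"
      using W[of "?d - k" c] by simp
    also have "c (?d - k) = unit_ball_vol (real (?d - k)) * ?\<Lambda> k B" using k by (simp add: c_def)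
    finally have "?\<Lambda> k B = (\<Sum>i\<le>?d. W (?d - k) i * measure (tube_measure K (\<nu> i)) B) / unit_ball_vol (real (?d - k))"
      using less_imp_neq[OF unit_ball_vol_nat_pos[of "?d - k"]] by (simp only: nonzero_mult_div_cancel_left not_sym)
    then show ?thesis by (simp only: sum_divide_distrib times_divide_eq_left)
  qed
  have SI: "signed_integral normal_bundle_space (?\<Lambda> k) F =
      (\<Sum>i\<le>?d. (W (?d - k) i / unit_ball_vol (real (?d - k))) * integral\<^sup>L (tube_measure K (\<nu> i)) F)"
    if k: "k < ?d" for k
    by (rule signed_integral_combination[OF _ _ _ _ F C])
       (use prox_regular.finite_tube_measure[OF reg \<nu>(2)] \<Lambda>_eq[OF k] prox_regular.AE_tube_measure[OF reg \<nu>(2) F bd] in auto)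
  define b where "b i = (\<Sum>k<?d. R ^ (?d - k) * W (?d - k) i)" for i
  have comb: "(\<Sum>k<?d. R ^ (?d - k) * unit_ball_vol (real (?d - k)) *
      (\<Sum>i\<le>?d. (W (?d - k) i / unit_ball_vol (real (?d - k))) * h i)) = (\<Sum>i\<le>?d. b i * h i)" for h
  proof -
    have "(\<Sum>k<?d. R ^ (?d - k) * unit_ball_vol (real (?d - k)) *
      (\<Sum>i\<le>?d. (W (?d - k) i / unit_ball_vol (real (?d - k))) * h i)) = (\<Sum>k<?d. \<Sum>i\<le>?d. R ^ (?d - k) * W (?d - k) i * h i)"
      unfolding sum_distrib_left using unit_ball_vol_nat_pos by (intro sum.cong refl) (simp add: less_imp_neq[symmetric])
    also have "\<dots> = (\<Sum>i\<le>?d. b i * h i)" by (subst sum.swap) (simp add: b_def sum_distrib_right)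
    finally show ?thesis .
  qed
  \<comment> \<open>\<open>None\<close> stands for the radius \<open>R\<close>, with weight
    \<open>- 1\<close>, and \<open>Some i\<close> for the node \<open>\<nu> i\<close>.\<close>
  define J where "J = insert None (Some ` {..?d})"
  define n where "n j = (case j of None \<Rightarrow> tube_measure K R | Some i \<Rightarrow> tube_measure K (\<nu> i))" for j
  define a where "a j = (case j of None \<Rightarrow> - 1 | Some i \<Rightarrow> b i)" for j
  have sumJ: "(\<Sum>j\<in>J. a j * h (n j)) = - h (tube_measure K R) + (\<Sum>i\<le>?d. b i * h (tube_measure K (\<nu> i)))"
    for h :: "('a \<times> 'a) measure \<Rightarrow> real"
    unfolding J_def by (subst sum.insert) (auto simp: sum.reindex a_def n_def)
  have "(\<Sum>j\<in>J. a j * integral\<^sup>L (n j) F) = 0"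
  proof (rule finite_combination_integral_AE[where M = normal_bundle_space, OF _ _ _ _ F C])
    show "AE x in n j. \<bar>F x\<bar> \<le> C" if "j \<in> J" for j
    proof -
      obtain t where "n j = tube_measure K t" "t < s0" using \<open>j \<in> J\<close> \<nu> s0 by (auto simp: J_def n_def)
      then show ?thesis using prox_regular.AE_tube_measure[OF reg _ F bd] by (simp only:)
    qed
    show "finite J" by (simp add: J_def)
    show "finite_measure (n j)" "sets (n j) = sets normal_bundle_space" if "j \<in> J" for j
      using that prox_regular.finite_tube_measure[OF reg] \<nu> s0 by (auto simp: J_def n_def)
    show "(\<Sum>j\<in>J. a j * measure (n j) B) = 0" if B: "B \<in> sets normal_bundle_space" for B
      using sumJ[of "\<lambda>m. measure m B"] tube[OF R(1) s0(1) B] \<Lambda>_eq[OF _ B] comb[of "\<lambda>i. measure (tube_measure K (\<nu> i)) B"]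
      by simp
  qed
  then show ?thesis
    using sumJ[of "\<lambda>m. integral\<^sup>L m F"] SI comb[of "\<lambda>i. integral\<^sup>L (tube_measure K (\<nu> i)) F"] by simp
qed

text \<open>The layer-cake identity behind this is \<open>infdist x K ^ s = R ^ s - (\<integral>\<tau>\<in>{infdist x K..R}. s * \<tau> ^ (s - 1))\<close>;
  it reduces the moments to the volumes of the local tubes.\<close>

lemma tube_moment:
  fixes K :: "'a::euclidean_space set" and F :: "'a \<times> 'a \<Rightarrow> real"
  assumes K: "compact K" "K \<noteq> {}" and R: "0 < R" "ereal R < reach K"
    and F: "F \<in> borel_measurable normal_bundle_space" and bd: "\<And>x u. x \<in> K \<Longrightarrow> norm u = 1 \<Longrightarrow> \<bar>F (x, u)\<bar> \<le> C"
  shows "(\<integral>x. indicator (parallel_set K R - K) x * (infdist x K ^ s * F (normal_pair K x)) \<partial>lborel) =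
    (\<Sum>k<DIM('a). R ^ (DIM('a) - k + s) * unit_ball_vol (real (DIM('a) - k)) *
       (real (DIM('a) - k) / real (DIM('a) - k + s)) *
       signed_integral normal_bundle_space (support_measure K k) F)"
proof -
  let ?d = "DIM('a)"
  obtain r where r: "R < r" "ereal r < reach K" using ereal_dense2[OF R(2)] by auto
  interpret prox_regular K r using r R by (intro reach_imp_prox_regular K) auto
  define G where "G k = unit_ball_vol (real (?d - k)) * signed_integral normal_bundle_space (support_measure K k) F" for k
  define h where "h x = indicator (parallel_set K R - K) x * F (normal_pair K x)" for x
  have T: "(\<integral>x. indicator (parallel_set K t - K) x * F (normal_pair K x) \<partial>lborel) = (\<Sum>k<?d. t ^ (?d - k) * G k)"
    if t: "0 \<le> t" "t \<le> R" for t
  proof (cases "t = 0")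
    case True
    \<comment> \<open>At radius 0 both sides vanish, since only exponents \<open>?d - k > 0\<close>
      occur; the integration over radii below includes this value.\<close>
    have empty: "parallel_set K t - K = {}" using True infdist_pos_iff by (force simp: parallel_set_def)
    show ?thesis unfolding empty using True by (simp add: power_0_left)
  next
    case False
    then have t': "0 < t" "ereal t < reach K" "t < r"
      using t R r le_less_trans[of "ereal t" "ereal R" "reach K"] by auto
    show ?thesis
      using support_measure_integral[OF K t'(1,2) F bd] integral_tube_measure[OF t'(3) F] by (simp add: G_def mult.assoc)
  qed
  have C: "C \<ge> 0"
  proof -
    obtain b :: 'a where "b \<in> Basis" using nonempty_Basis by blast
    moreover obtain x where "x \<in> K" using K by blast
    ultimately show ?thesis using bd[of x b] by force
  qed
  have h_bd: "\<bar>h x\<bar> \<le> C" for x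
    using bd[OF normal_pair_props] C by (auto simp: h_def indicator_def normal_pair_def)
  have h_meas: "h \<in> borel_measurable borel"
  proof -
    have "(\<lambda>x. F (normal_pair K x)) \<in> borel_measurable (restrict_space lborel (parallel_set K R - K))"
      by (rule measurable_compose[OF normal_pair_measurable[OF r(1)] F])
    then show ?thesis
      using tube_borel[of R] unfolding h_def by (subst (asm) borel_measurable_restrict_space_iff) (auto simp: mult.commute)
  qed
  have h_int: "integrable lborel h"
    by (rule integrableI_bounded_set[where A = "parallel_set K R - K" and B = C])
       (use tube_borel[of R] tube_finite[of R] h_meas h_bd in \<open>simp_all add: h_def[of x for x, symmetric] AE_I2\<close>,
        simp add: h_def)
  show ?thesis
  proof (cases "s = 0")
    case True
    then show ?thesis using T[of R] R by (simp add: G_def mult_ac)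
  next
    case False
    then obtain m where m: "s = Suc m" by (cases s) auto
    \<comment> \<open>The layer-cake integrand on pairs of a point and a radius; its section at a
      fixed radius \<open>t\<close> in \<open>{0..R}\<close> is supported in the tube of radius
      \<open>t\<close>.\<close>
    define f where "f = (\<lambda>(x, t). indicator {0..R} t * (real s * t ^ m) * (indicator {z. infdist (fst z) K \<le> snd z} (x, t) * h x))"
    have f_meas: "f \<in> borel_measurable (lborel \<Otimes>\<^sub>M lborel)"
    proof -
      have "closed {z :: 'a \<times> real. infdist (fst z) K \<le> snd z}"
        by (intro closed_Collect_le continuous_intros)
      then have [measurable]: "{z :: 'a \<times> real. infdist (fst z) K \<le> snd z} \<in> sets (lborel \<Otimes>\<^sub>M lborel)"
        unfolding lborel_prod by simp
      note [measurable] = h_meas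
      show ?thesis unfolding f_def by measurable
    qed
    have f_int: "integrable (lborel \<Otimes>\<^sub>M lborel) f"
    proof (rule integrableI_bounded_set[where A = "(parallel_set K R - K) \<times> {0..R}" and B = "real s * R ^ m * C"])
      show "(parallel_set K R - K) \<times> {0..R} \<in> sets (lborel \<Otimes>\<^sub>M lborel)" using tube_borel[of R] by simp
      show "f \<in> borel_measurable (lborel \<Otimes>\<^sub>M lborel)" by (rule f_meas)
      have "emeasure (lborel \<Otimes>\<^sub>M lborel) ((parallel_set K R - K) \<times> {0..R}) =
          emeasure lborel (parallel_set K R - K) * emeasure lborel {0..R}"
        using tube_borel[of R] by (intro lborel.emeasure_pair_measure_Times) auto
      also have "\<dots> < \<infinity>" using tube_finite[of R] R by (simp add: ennreal_mult_less_top)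
      finally show "emeasure (lborel \<Otimes>\<^sub>M lborel) ((parallel_set K R - K) \<times> {0..R}) < \<infinity>" .
      have "norm (f z) \<le> real s * R ^ m * C" for z
      proof (cases "snd z \<in> {0..R}")
        case True
        have "norm (f z) = (real s * snd z ^ m) * (indicator {z. infdist (fst z) K \<le> snd z} z * \<bar>h (fst z)\<bar>)"
          using True by (simp add: f_def split_beta abs_mult)
        also have "\<dots> \<le> (real s * R ^ m) * (1 * C)"
          using True h_bd C R by (intro mult_mono power_mono) (auto simp: indicator_def)
        finally show ?thesis by simp
      qed (use C R in \<open>auto simp: f_def split_beta\<close>)
      then show "AE z in lborel \<Otimes>\<^sub>M lborel. z \<in> (parallel_set K R - K) \<times> {0..R} \<longrightarrow> norm (f z) \<le> real s * R ^ m * C"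
        by simp
      show "AE z in lborel \<Otimes>\<^sub>M lborel. z \<notin> (parallel_set K R - K) \<times> {0..R} \<longrightarrow> f z = 0"
        by (intro AE_I2) (auto simp: f_def h_def split_beta indicator_def)
    qed
    have power_int: "(\<integral>t. indicator {a..R} t * (real s * t ^ j) \<partial>lborel) = real s * (R ^ Suc j - a ^ Suc j) / real (Suc j)"
      if "a \<le> R" for a j
    proof -
      have "(\<integral>t. indicator {a..R} t * (real s * t ^ j) \<partial>lborel) = (\<integral>t. real s * (t ^ j * indicator {a..R} t) \<partial>lborel)"
        by (rule Bochner_Integration.integral_cong) auto
      then show ?thesis
        by (simp only: integral_mult_right_zero integral_power[OF that] times_divide_eq_right)
    qed
    \<comment> \<open>Integrating out the radius leaves the moment and a boundary term; integrating
      out the point, in \<open>inner2\<close>, leaves tube integrals, which are polynomial in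
      \<open>t\<close> by \<open>T\<close>.\<close>
    have inner1: "(\<integral>t. f (x, t) \<partial>lborel) = R ^ s * h x - infdist x K ^ s * h x" for x
    proof (cases "infdist x K \<le> R")
      case True
      have "(\<integral>t. f (x, t) \<partial>lborel) = (\<integral>t. indicator {infdist x K..R} t * (real s * t ^ m) * h x \<partial>lborel)"
        by (rule Bochner_Integration.integral_cong) (auto simp: f_def indicator_def intro: order.trans[OF infdist_nonneg])
      also have "\<dots> = real s * (R ^ Suc m - infdist x K ^ Suc m) / real (Suc m) * h x"
        unfolding power_int[OF True, symmetric] by simp
      finally show ?thesis unfolding m by (simp del: power_Suc of_nat_Suc add: left_diff_distrib)
    next
      case False
      then have "h x = 0" by (simp add: h_def parallel_set_def)
      then show ?thesis by (simp add: f_def)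
    qed
    have inner2: "(\<integral>x. f (x, t) \<partial>lborel) = (\<Sum>k<?d. G k * (indicator {0..R} t * (real s * t ^ (m + (?d - k)))))" for t
    proof (cases "t \<in> {0..R}")
      case True
      have "(\<integral>x. f (x, t) \<partial>lborel) = (\<integral>x. (real s * t ^ m) * (indicator (parallel_set K t - K) x * F (normal_pair K x)) \<partial>lborel)"
        by (rule Bochner_Integration.integral_cong) (use True in \<open>auto simp: f_def h_def indicator_def parallel_set_def\<close>)
      also have "\<dots> = (real s * t ^ m) * (\<Sum>k<?d. t ^ (?d - k) * G k)"
        using T[of t] True by simp
      also have "\<dots> = (\<Sum>k<?d. G k * (indicator {0..R} t * (real s * t ^ (m + (?d - k)))))"
        unfolding sum_distrib_left power_add using True by (intro sum.cong refl) (simp add: mult_ac)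
      finally show ?thesis .
    qed (simp add: f_def)
    have "(\<integral>x. R ^ s * h x - infdist x K ^ s * h x \<partial>lborel) = (\<integral>t. (\<Sum>k<?d. G k * (indicator {0..R} t * (real s * t ^ (m + (?d - k))))) \<partial>lborel)"
      using lborel_pair.Fubini_integral[of "\<lambda>x t. f (x, t)"] f_int unfolding inner1 inner2 by simp
    also have "\<dots> = (\<Sum>k<?d. G k * (real s * R ^ Suc (m + (?d - k)) / real (Suc (m + (?d - k)))))"
    proof -
      have "integrable lborel (\<lambda>t. indicator {0..R} t * (real s * t ^ j))" for j
        using borel_integrable_compact[of "{0..R}" "\<lambda>t. real s * t ^ j"] by (simp add: continuous_intros)
      then show ?thesis
        by (subst Bochner_Integration.integral_sum) (use power_int[of 0] R in auto)
    qed
    finally have eq: "(\<integral>x. R ^ s * h x - infdist x K ^ s * h x \<partial>lborel) =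
      (\<Sum>k<?d. G k * (real s * R ^ (?d - k + s) / real (?d - k + s)))" by (simp add: m add.commute)
    have int2: "integrable lborel (\<lambda>x. infdist x K ^ s * h x)"
    proof (rule integrableI_bounded_set[where A = "parallel_set K R - K" and B = "R ^ s * C"])
      have "(\<lambda>x. infdist x K) \<in> borel_measurable borel"
        by (intro borel_measurable_continuous_onI continuous_intros)
      then show "(\<lambda>x. infdist x K ^ s * h x) \<in> borel_measurable lborel" using h_meas by simp
      show "AE x in lborel. x \<in> parallel_set K R - K \<longrightarrow> norm (infdist x K ^ s * h x) \<le> R ^ s * C"
      proof (intro AE_I2 impI)
        fix x assume "x \<in> parallel_set K R - K"
        then show "norm (infdist x K ^ s * h x) \<le> R ^ s * C"
          unfolding real_norm_def abs_mult power_abs using h_bd R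
          by (intro mult_mono power_mono) (auto simp: parallel_set_def infdist_nonneg)
      qed
    qed (use tube_borel[of R] tube_finite[of R] in \<open>auto simp: h_def\<close>)
    have "(\<integral>x. indicator (parallel_set K R - K) x * (infdist x K ^ s * F (normal_pair K x)) \<partial>lborel) = (\<integral>x. infdist x K ^ s * h x \<partial>lborel)"
      by (simp add: h_def mult_ac)
    also have "\<dots> = R ^ s * (\<integral>x. h x \<partial>lborel) - (\<integral>x. R ^ s * h x - infdist x K ^ s * h x \<partial>lborel)"
      using h_int int2 by simp
    also have "\<dots> = R ^ s * (\<Sum>k<?d. R ^ (?d - k) * G k) - (\<Sum>k<?d. G k * (real s * R ^ (?d - k + s) / real (?d - k + s)))"
      unfolding eq using T[of R] R by (simp add: h_def)
    \<comment> \<open>With \<open>j = ?d - k\<close> the remaining factor is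
      \<open>1 - s / (j + s) = j / (j + s)\<close>.\<close>
    also have "\<dots> = (\<Sum>k<?d. G k * (R ^ (?d - k + s) * (real (?d - k) / real (?d - k + s))))"
      unfolding sum_distrib_left sum_subtractf[symmetric]
    proof (rule sum.cong)
      fix k assume "k \<in> {..<?d}"
      then have "real (?d - k + s) > 0" by simp
      then show "R ^ s * (R ^ (?d - k) * G k) - G k * (real s * R ^ (?d - k + s) / real (?d - k + s)) =
         G k * (R ^ (?d - k + s) * (real (?d - k) / real (?d - k + s)))"
        by (simp add: field_simps power_add)
    qed simp
    finally show ?thesis by (simp add: G_def mult_ac)
  qed
qed


section \<open>Symmetric tensors and the tensor Steiner formula\<close>

lemma sym_tensor_scaleR: "sym_tensor r s x (c *\<^sub>R y) v = c ^ s * sym_tensor r s x y v"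
proof -
  have c: "(\<Prod>i<r + s. if i < r then 1 else c) = c ^ s"
  proof -
    have "{..<r + s} \<inter> {i. i < r} = {..<r}" "{..<r + s} \<inter> - {i. i < r} = {r..<r + s}" by auto
    then show ?thesis by (simp add: prod.If_cases)
  qed
  have "(\<Prod>i<r + s. inner (if i < r then x else c *\<^sub>R y) (v (\<pi> i))) =
      c ^ s * (\<Prod>i<r + s. inner (if i < r then x else y) (v (\<pi> i)))" for \<pi> :: "nat \<Rightarrow> nat"
    unfolding c[symmetric] prod.distrib[symmetric] by (rule prod.cong) auto
  then show ?thesis by (simp add: sym_tensor_def sum_distrib_left)
qed

lemma continuous_on_sym_tensor:
  assumes "continuous_on S f" "continuous_on S g"
  shows "continuous_on S (\<lambda>z. sym_tensor r s (f z) (g z) v)"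
proof -
  have *: "continuous_on S (\<lambda>z. inner (if i < r then f z else g z) w)" for i :: nat and w
    using assms by (cases "i < r") (auto intro!: continuous_intros)
  show ?thesis unfolding sym_tensor_def divide_inverse
    by (intro continuous_on_mult continuous_on_sum continuous_on_prod continuous_on_const *)
qed

text \<open>Dividing by \<open>M\<close> makes all factors at most 1 in modulus, so that the
  difference of the products is at most the sum of the differences of the factors. The factor
  \<open>r + s\<close> is kept, since in rank 0 it removes the root term from the final
  estimate.\<close>

lemma sym_tensor_lipschitz:
  assumes M: "1 \<le> M" "norm x \<le> M" "norm x' \<le> M" "norm y \<le> M" "norm y' \<le> M"
    and v: "\<And>i. i < r + s \<Longrightarrow> norm (v i) = 1" and \<delta>: "norm (x - x') \<le> \<delta>" "norm (y - y') \<le> \<delta>"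
  shows "\<bar>sym_tensor r s x y v - sym_tensor r s x' y' v\<bar> \<le> M ^ (r + s) * real (r + s) * \<delta>"
proof -
  let ?n = "r + s"
  have d0: "\<delta> \<ge> 0" using \<delta>(1) norm_ge_zero order.trans by blast
  define a b where "a \<pi> i = inner (if i < r then x else y) (v (\<pi> i))" and "b \<pi> i = inner (if i < r then x' else y') (v (\<pi> i))"
    for \<pi> :: "nat \<Rightarrow> nat" and i
  have summand: "\<bar>(\<Prod>i<?n. a \<pi> i) - (\<Prod>i<?n. b \<pi> i)\<bar> \<le> M ^ ?n * real ?n * \<delta>" if \<pi>: "\<pi> permutes {..<?n}" for \<pi>
  proof -
    have vn: "norm (v (\<pi> i)) = 1" if "i < ?n" for i
      using v permutes_in_image[OF \<pi>, of i] that by simp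
    have inn: "\<bar>inner z (v (\<pi> i))\<bar> \<le> B" if "i < ?n" "norm z \<le> B" for z :: 'a and B i
      using Cauchy_Schwarz_ineq2[of z "v (\<pi> i)"] vn[OF that(1)] that(2) by simp
    have ab: "\<bar>a \<pi> i\<bar> \<le> M" "\<bar>b \<pi> i\<bar> \<le> M" "\<bar>a \<pi> i - b \<pi> i\<bar> \<le> \<delta>" if i: "i < ?n" for i
      using inn[OF i] M \<delta> by (auto simp: a_def b_def simp flip: inner_diff_left)
    have "norm ((\<Prod>i<?n. a \<pi> i / M) - (\<Prod>i<?n. b \<pi> i / M)) \<le> (\<Sum>i<?n. norm (a \<pi> i / M - b \<pi> i / M))"
      using ab M(1) by (intro norm_prod_diff) auto
    also have "\<dots> \<le> (\<Sum>i<?n. \<delta>)"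
    proof (rule sum_mono)
      fix i assume "i \<in> {..<?n}"
      then have "norm (a \<pi> i / M - b \<pi> i / M) \<le> \<delta> / M"
        using ab(3)[of i] M(1) by (simp add: diff_divide_distrib[symmetric] divide_right_mono)
      also have "\<dots> \<le> \<delta>" using M(1) d0 by (simp add: divide_le_eq mult_le_cancel_left1)
      finally show "norm (a \<pi> i / M - b \<pi> i / M) \<le> \<delta>" .
    qed
    finally have "M ^ ?n * \<bar>(\<Prod>i<?n. a \<pi> i / M) - (\<Prod>i<?n. b \<pi> i / M)\<bar> \<le> M ^ ?n * (real ?n * \<delta>)"
      using M(1) by (intro mult_left_mono) auto
    moreover have "M ^ ?n * \<bar>(\<Prod>i<?n. a \<pi> i / M) - (\<Prod>i<?n. b \<pi> i / M)\<bar> = \<bar>(\<Prod>i<?n. a \<pi> i) - (\<Prod>i<?n. b \<pi> i)\<bar>"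
      using M(1) by (simp add: prod_dividef diff_divide_distrib[symmetric])
    ultimately show ?thesis by (simp add: mult.assoc)
  qed
  have "\<bar>sym_tensor r s x y v - sym_tensor r s x' y' v\<bar> =
      \<bar>\<Sum>\<pi> | \<pi> permutes {..<?n}. ((\<Prod>i<?n. a \<pi> i) - (\<Prod>i<?n. b \<pi> i))\<bar> / fact ?n"
    by (simp add: sym_tensor_def a_def b_def sum_subtractf diff_divide_distrib[symmetric])
  also have "\<dots> \<le> (\<Sum>\<pi> | \<pi> permutes {..<?n}. M ^ ?n * real ?n * \<delta>) / fact ?n"
    using summand by (intro divide_right_mono order.trans[OF sum_abs] sum_mono) auto
  also have "\<dots> = M ^ ?n * real ?n * \<delta>"
    by (simp add: card_permutations[OF card_lessThan])
  finally show ?thesis .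
qed

lemma sym_tensor_bound:
  assumes M: "norm x \<le> M" "norm y \<le> M" and v: "\<And>i. i < r + s \<Longrightarrow> norm (v i) = 1"
  shows "\<bar>sym_tensor r s x y v\<bar> \<le> M ^ (r + s)"
proof -
  let ?n = "r + s"
  have summand: "\<bar>\<Prod>i<?n. inner (if i < r then x else y) (v (\<pi> i))\<bar> \<le> M ^ ?n" if \<pi>: "\<pi> permutes {..<?n}" for \<pi>
  proof -
    have "\<bar>inner (if i < r then x else y) (v (\<pi> i))\<bar> \<le> M" if "i < ?n" for i
      using Cauchy_Schwarz_ineq2[of "if i < r then x else y" "v (\<pi> i)"] v[of "\<pi> i"] permutes_in_image[OF \<pi>, of i] that M
      by (auto split: if_splits)
    then have "(\<Prod>i<?n. \<bar>inner (if i < r then x else y) (v (\<pi> i))\<bar>) \<le> (\<Prod>i<?n. M)"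
      by (intro prod_mono) auto
    then show ?thesis by (simp add: abs_prod)
  qed
  have "\<bar>sym_tensor r s x y v\<bar> =
      \<bar>\<Sum>\<pi> | \<pi> permutes {..<?n}. (\<Prod>i<?n. inner (if i < r then x else y) (v (\<pi> i)))\<bar> / fact ?n"
    by (simp add: sym_tensor_def)
  also have "\<dots> \<le> (\<Sum>\<pi> | \<pi> permutes {..<?n}. M ^ ?n) / fact ?n"
    using summand by (intro divide_right_mono order.trans[OF sum_abs] sum_mono) auto
  also have "\<dots> = M ^ ?n" by (simp add: card_permutations[OF card_lessThan])
  finally show ?thesis .
qed

lemma sym_tensor_bounded_on:
  fixes K :: "'a::euclidean_space set"
  assumes "compact K"
  obtains C where "\<And>x u. x \<in> K \<Longrightarrow> norm u = 1 \<Longrightarrow> \<bar>sym_tensor r s x u v\<bar> \<le> C"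
proof -
  have "compact ((\<lambda>(x, u). sym_tensor r s x u v) ` (K \<times> sphere (0::'a) 1))"
    using assms by (intro compact_continuous_image compact_Times)
      (auto simp: split_beta intro!: continuous_on_sym_tensor continuous_intros)
  then obtain C where "\<And>z. z \<in> (\<lambda>(x, u). sym_tensor r s x u v) ` (K \<times> sphere (0::'a) 1) \<Longrightarrow> \<bar>z\<bar> \<le> C"
    using compact_imp_bounded by (fastforce simp: bounded_iff)
  then show ?thesis using that[of C] by force
qed

text \<open>The tube splits into \<open>K\<close>, where the nearest point is the point itself, and
  the rest, where \<open>tube_moment\<close> applies to the tensor in polar form: it is homogeneous
  of degree \<open>s\<close> in \<open>x - proj x\<close>.\<close>

lemma steiner_tensor_formula:
  fixes K :: "'a::euclidean_space set"
  assumes K: "compact K" "K \<noteq> {}" and R: "0 < R" "ereal R < reach K"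
  shows "voronoi_tensor r s R K v =
    (\<Sum>j\<le>DIM('a). fact r * fact s * (unit_ball_vol (real (s + j)) * R ^ (s + j)) * minkowski_tensor (DIM('a) - j) r s K v)"
proof -
  let ?d = "DIM('a)"
  obtain r0 where r0: "R < r0" "ereal r0 < reach K" using ereal_dense2[OF R(2)] by auto
  interpret prox_regular K r0 using r0 R by (intro reach_imp_prox_regular K) auto
  define f where "f x = sym_tensor r s (proj x) (x - proj x) v" for x
  define F where "F = (\<lambda>(x, u). sym_tensor r s x u v)"
  have K_sub: "K \<subseteq> parallel_set K R" using R by (auto simp: parallel_set_def)
  have par: "compact (parallel_set K R)" unfolding parallel_set_def using R(1) by (rule compact_parallel)
  have f_cont: "continuous_on (parallel_set K R) f"
    unfolding f_def by (intro continuous_on_sym_tensor continuous_intros continuous_on_subset[OF continuous_on_proj])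
      (use r0 in \<open>auto simp: parallel_set_def\<close>)
  have proj_K: "proj x = x" if "x \<in> K" for x
    using that norm_proj[of x] by simp
  have int: "integrable lborel (\<lambda>x. indicator (parallel_set K R) x *\<^sub>R f x)" "integrable lborel (\<lambda>x. indicator K x *\<^sub>R f x)"
    using borel_integrable_compact[OF par f_cont]
      borel_integrable_compact[OF K(1) continuous_on_subset[OF f_cont K_sub]] by auto
  have "voronoi_tensor r s R K v = (\<integral>x. indicator (parallel_set K R) x *\<^sub>R f x \<partial>lebesgue)"
    by (simp add: voronoi_tensor_def set_lebesgue_integral_def f_def)
  also have "\<dots> = (\<integral>x. indicator (parallel_set K R) x *\<^sub>R f x \<partial>lborel)"
    using borel_measurable_integrable[OF int(1)] by (intro integral_completion)
  also have "\<dots> = (\<integral>x. indicator K x *\<^sub>R f x + indicator (parallel_set K R - K) x * f x \<partial>lborel)"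
    by (rule Bochner_Integration.integral_cong) (use K_sub in \<open>auto simp: indicator_def\<close>)
  also have "\<dots> = (\<integral>x. indicator K x *\<^sub>R f x \<partial>lborel) + (\<integral>x. indicator (parallel_set K R - K) x * f x \<partial>lborel)"
  proof (rule Bochner_Integration.integral_add[OF int(2)])
    have "integrable lborel (\<lambda>x. indicator (parallel_set K R) x *\<^sub>R f x - indicator K x *\<^sub>R f x)"
      using int by (rule Bochner_Integration.integrable_diff)
    moreover have "indicator (parallel_set K R) x *\<^sub>R f x - indicator K x *\<^sub>R f x = indicator (parallel_set K R - K) x * f x" for x
      using K_sub by (auto simp: indicator_def)
    ultimately show "integrable lborel (\<lambda>x. indicator (parallel_set K R - K) x * f x)" by simp
  qed
  finally have split: "voronoi_tensor r s R K v =
    (\<integral>x. indicator K x *\<^sub>R f x \<partial>lborel) + (\<integral>x. indicator (parallel_set K R - K) x * f x \<partial>lborel)" .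
  \<comment> \<open>On \<open>K\<close> the integrand is the tensor with second argument 0. It
    vanishes for \<open>s > 0\<close>, as does \<open>minkowski_tensor ?d r s K\<close>; for
    \<open>s = 0\<close> the volume of the unit ball is 1.\<close>
  have inner: "(\<integral>x. indicator K x *\<^sub>R f x \<partial>lborel) = fact r * fact s * (unit_ball_vol (real s) * R ^ s) * minkowski_tensor ?d r s K v"
  proof -
    have fK: "f x = sym_tensor r s x 0 v" if "x \<in> K" for x using proj_K[OF that] by (simp add: f_def)
    show ?thesis
    proof (cases "s = 0")
      case True
      have "(\<integral>x. indicator K x *\<^sub>R f x \<partial>lborel) = (\<integral>x. indicator K x *\<^sub>R f x \<partial>lebesgue)"
        using borel_measurable_integrable[OF int(2)] by (intro integral_completion[symmetric])
      also have "\<dots> = (\<integral>x. indicator K x *\<^sub>R sym_tensor r 0 x 0 v \<partial>lebesgue)"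
        by (rule Bochner_Integration.integral_cong) (use fK True in \<open>auto simp: indicator_def\<close>)
      finally show ?thesis using True by (simp add: minkowski_tensor_def set_lebesgue_integral_def)
    next
      case False
      have "f x = 0" if "x \<in> K" for x
        using fK[OF that] sym_tensor_scaleR[of r s x 0 0 v] False by (simp add: power_0_left)
      then have "(\<lambda>x. indicator K x *\<^sub>R f x) = (\<lambda>x. 0)" by (auto simp: indicator_def)
      then show ?thesis using False by (simp add: minkowski_tensor_def)
    qed
  qed
  have F_meas: "F \<in> borel_measurable normal_bundle_space"
  proof -
    have "F \<in> borel_measurable borel"
      unfolding F_def split_beta by (intro borel_measurable_continuous_onI continuous_on_sym_tensor continuous_intros)
    then show ?thesis unfolding normal_bundle_space_def by (rule measurable_restrict_space1)
  qed
  obtain C where C: "\<And>x u. x \<in> K \<Longrightarrow> norm u = 1 \<Longrightarrow> \<bar>F (x, u)\<bar> \<le> C"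
    using sym_tensor_bounded_on[OF K(1), of r s v] unfolding F_def by auto
  have f_polar: "f x = infdist x K ^ s * F (normal_pair K x)" for x
  proof (cases "x \<in> K")
    case True
    then show ?thesis using proj_K[OF True] by (cases "s = 0") (auto simp: f_def F_def normal_pair_def sym_tensor_scaleR[of r s x 0 0 v, simplified])
  next
    case False
    then have "norm (x - proj x) \<noteq> 0" using proj_in[of x] by auto
    then have "x - proj x = infdist x K *\<^sub>R ((x - proj x) /\<^sub>R norm (x - proj x))" by (simp add: norm_proj)
    then show ?thesis unfolding f_def F_def normal_pair_def using sym_tensor_scaleR by (metis case_prod_conv)
  qed
  have "(\<integral>x. indicator (parallel_set K R - K) x * f x \<partial>lborel) =
    (\<Sum>k<?d. R ^ (?d - k + s) * unit_ball_vol (real (?d - k)) * (real (?d - k) / real (?d - k + s)) *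
       signed_integral normal_bundle_space (support_measure K k) F)"
    unfolding f_polar by (rule tube_moment[OF K R F_meas C])
  also have "\<dots> = (\<Sum>k<?d. fact r * fact s * (unit_ball_vol (real (s + (?d - k))) * R ^ (s + (?d - k))) * minkowski_tensor k r s K v)"
  proof (rule sum.cong)
    fix k assume "k \<in> {..<?d}"
    then have k: "k < ?d" by simp
    define j where "j = ?d - k"
    have j: "j > 0" using k by (simp add: j_def)
    have nz: "unit_ball_vol (real (j + s)) \<noteq> 0" "real (j + s) \<noteq> 0"
      using unit_ball_vol_nat_pos[of "j + s"] j by linarith+
    \<comment> \<open>With \<open>j = ?d - k\<close>, the quotient of sphere areas in
      \<open>minkowski_tensor\<close> cancels the volume \<open>unit_ball_vol (real (s + j))\<close>
      and leaves the factor \<open>j / (j + s)\<close> of \<open>tube_moment\<close>.\<close>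
    show "R ^ (?d - k + s) * unit_ball_vol (real (?d - k)) * (real (?d - k) / real (?d - k + s)) *
       signed_integral normal_bundle_space (support_measure K k) F =
       fact r * fact s * (unit_ball_vol (real (s + (?d - k))) * R ^ (s + (?d - k))) * minkowski_tensor k r s K v"
      unfolding minkowski_tensor_def sphere_area_def F_def using k nz
      by (simp add: j_def[symmetric] add.commute[of s] del: of_nat_add)
  qed simp
  also have "\<dots> = (\<Sum>k<?d. (\<lambda>j. if j = 0 then 0 else fact r * fact s * (unit_ball_vol (real (s + j)) * R ^ (s + j)) * minkowski_tensor (?d - j) r s K v) (?d - k))"
    by (rule sum.cong) auto
  also have "\<dots> = (\<Sum>j\<le>?d. if j = 0 then 0 else fact r * fact s * (unit_ball_vol (real (s + j)) * R ^ (s + j)) * minkowski_tensor (?d - j) r s K v)"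
    by (rule sum_atMost_reverse) simp
  also have "\<dots> = (\<Sum>j\<in>{1..?d}. fact r * fact s * (unit_ball_vol (real (s + j)) * R ^ (s + j)) * minkowski_tensor (?d - j) r s K v)"
    by (rule sum.mono_neutral_cong_right) auto
  finally have outer: "(\<integral>x. indicator (parallel_set K R - K) x * f x \<partial>lborel) =
    (\<Sum>j\<in>{1..?d}. fact r * fact s * (unit_ball_vol (real (s + j)) * R ^ (s + j)) * minkowski_tensor (?d - j) r s K v)" .
  have "{..?d} = insert 0 {1..?d}" by auto
  then show ?thesis unfolding split inner outer by simp
qed


section \<open>Volumes of parallel shells\<close>

lemma power_diff_1_le:
  fixes h :: real
  assumes "0 \<le> h" "h \<le> H"
  shows "(1 + h) ^ n - 1 \<le> h * (real n * (1 + H) ^ n)"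
proof -
  have "(1 + h) ^ n - 1 = h * (\<Sum>i<n. (1 + h) ^ i)"
    using power_diff_1_eq[of "1 + h" n] by simp
  also have "\<dots> \<le> h * (\<Sum>i<n. (1 + H) ^ n)"
  proof (intro mult_left_mono sum_mono)
    fix i assume "i \<in> {..<n}"
    have "(1 + h) ^ i \<le> (1 + H) ^ i" using assms by (intro power_mono) auto
    also have "\<dots> \<le> (1 + H) ^ n" using assms \<open>i \<in> _\<close> by (intro power_increasing) auto
    finally show "(1 + h) ^ i \<le> (1 + H) ^ n" .
  qed (use assms in auto)
  finally show ?thesis by simp
qed

lemma emeasure_lborel_affine:
  fixes A :: "'a::euclidean_space set"
  assumes c: "c > 0" and A: "A \<in> sets borel"
  shows "emeasure lborel A = ennreal (c ^ DIM('a)) * emeasure lborel {x. t + c *\<^sub>R x \<in> A}"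
proof -
  have "emeasure lborel A = emeasure (density (distr lborel borel (\<lambda>x. t + c *\<^sub>R x)) (\<lambda>_. ennreal (\<bar>c\<bar> ^ DIM('a)))) A"
    using lborel_affine[of c t] c by simp
  also have "\<dots> = ennreal (c ^ DIM('a)) * emeasure (distr lborel borel (\<lambda>x. t + c *\<^sub>R x)) A"
    using A c by (simp add: emeasure_density_const)
  also have "emeasure (distr lborel borel (\<lambda>x. t + c *\<^sub>R x)) A = emeasure lborel {x. t + c *\<^sub>R x \<in> A}"
    using A by (subst emeasure_distr) (auto simp: vimage_def)
  finally show ?thesis .
qed

definition shell :: "'a::metric_space set \<Rightarrow> real \<Rightarrow> real \<Rightarrow> 'a set" where
  "shell K a b = {x. a < infdist x K \<and> infdist x K \<le> b}"

lemma shell_borel: "shell K a b \<in> sets borel" for K :: "'a::euclidean_space set"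
proof -
  have "shell K a b = {x. a < infdist x K} \<inter> {x. infdist x K \<le> b}" by (auto simp: shell_def)
  then show ?thesis
    by (simp add: borel_closed borel_open closed_Collect_le open_Collect_less continuous_intros sets.Int)
qed

lemma parallel_subset_cball:
  fixes K :: "'a::euclidean_space set"
  assumes K: "compact K" "K \<noteq> {}" "K \<subseteq> cball 0 \<rho>"
  shows "{x. infdist x K \<le> b} \<subseteq> cball 0 (\<rho> + b)"
proof
  fix x assume "x \<in> {x. infdist x K \<le> b}"
  then have "dist x (closest_point K x) \<le> b" using closest_point_props(2)[OF K(1,2)] by simp
  moreover have "norm (closest_point K x) \<le> \<rho>" using subsetD[OF K(3) closest_point_props(1)[OF K(1,2), of x]] by simp
  ultimately show "x \<in> cball 0 (\<rho> + b)"
    using norm_triangle_sub[of x "closest_point K x"] by (simp add: dist_norm)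
qed

lemma cball_fmeasurable: "cball (c :: 'a::euclidean_space) e \<in> fmeasurable lborel"
  using emeasure_lborel_cball_finite[of c e] by (intro fmeasurableI) auto

text \<open>For a piece of small diameter the larger parallel set is contained in a slight dilation
  of the smaller one about any of its points.\<close>

lemma shell_volume_small:
  fixes K :: "'a::euclidean_space set"
  assumes K: "compact K" "k0 \<in> K" "K \<subseteq> cball 0 \<rho>" and diam: "\<And>k. k \<in> K \<Longrightarrow> dist k0 k \<le> \<delta>"
    and ab: "\<delta> < a" "a \<le> b" "0 \<le> \<delta>"
  shows "measure lborel (shell K a b) \<le>
    ((1 + (b - a) / (a - \<delta>)) ^ DIM('a) - 1) * measure lborel (cball (0::'a) (\<rho> + a))"
proof -
  let ?d = "DIM('a)"
  have ne: "K \<noteq> {}" using K by auto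
  \<comment> \<open>The factor with \<open>b + (c - 1) * \<delta> = c * a\<close>: a point whose
    image under the dilation by \<open>c\<close> about \<open>k0\<close> is within \<open>b\<close>
    of \<open>K\<close> is then itself within \<open>a\<close> of \<open>K\<close>.\<close>
  define c where "c = 1 + (b - a) / (a - \<delta>)"
  have c: "c \<ge> 1" "c > 0" using ab by (auto simp: c_def add_pos_nonneg)
  have ca: "b - a = (c - 1) * (a - \<delta>)" using ab by (simp add: c_def)
  let ?U = "{x. infdist x K \<le> b}" and ?L = "{x. infdist x K \<le> a}"
  have UL: "?U \<in> sets borel" "?L \<in> sets borel"
    by (auto intro!: borel_closed closed_Collect_le continuous_intros)
  have fin: "{x. infdist x K \<le> t} \<in> fmeasurable lborel" if "t = a \<or> t = b" for t
  proof (rule fmeasurableI)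
    show "{x. infdist x K \<le> t} \<in> sets lborel" using UL that by auto
    show "emeasure lborel {x. infdist x K \<le> t} < \<infinity>"
      using parallel_subset_cball[OF K(1) ne K(3)] bounded_subset[OF bounded_cball] emeasure_bounded_finite by blast
  qed
  have sub: "{x. (k0 - c *\<^sub>R k0) + c *\<^sub>R x \<in> ?U} \<subseteq> ?L"
  proof safe
    fix x define y where "y = (k0 - c *\<^sub>R k0) + c *\<^sub>R x"
    assume "infdist (k0 - c *\<^sub>R k0 + c *\<^sub>R x) K \<le> b"
    then have y: "dist y (closest_point K y) \<le> b" using closest_point_props(2)[OF K(1) ne] by (simp add: y_def)
    define k where "k = closest_point K y"
    have k: "k \<in> K" using closest_point_props(1)[OF K(1) ne] by (simp add: k_def)
    have "c *\<^sub>R (x - k) = (y - k) + (c - 1) *\<^sub>R (k0 - k)" by (simp add: y_def algebra_simps)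
    then have "c * norm (x - k) \<le> norm (y - k) + (c - 1) * norm (k0 - k)"
      using norm_triangle_ineq[of "y - k" "(c - 1) *\<^sub>R (k0 - k)"] c by (metis abs_of_nonneg diff_ge_0_iff_ge less_imp_le norm_scaleR)
    also have "\<dots> \<le> b + (c - 1) * \<delta>"
      using y diam[OF k] c by (intro add_mono mult_left_mono) (auto simp: k_def dist_norm)
    also have "\<dots> = c * a" using ca by (simp add: algebra_simps)
    finally have "norm (x - k) \<le> a" using c by simp
    then show "infdist x K \<le> a" using k by (intro infdist_le2[of k]) (auto simp: dist_norm)
  qed
  have "emeasure lborel ?U = ennreal (c ^ ?d) * emeasure lborel {x. (k0 - c *\<^sub>R k0) + c *\<^sub>R x \<in> ?U}"
    by (rule emeasure_lborel_affine[OF c(2) UL(1)])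
  also have "\<dots> \<le> ennreal (c ^ ?d) * emeasure lborel ?L"
    by (intro mult_left_mono emeasure_mono sub) (use UL in auto)
  finally have "ennreal (measure lborel ?U) \<le> ennreal (c ^ ?d * measure lborel ?L)"
    using fin c by (simp add: emeasure_eq_measure2[OF fin] ennreal_mult)
  then have "measure lborel ?U \<le> c ^ ?d * measure lborel ?L"
    using c by (subst (asm) ennreal_le_iff) auto
  moreover have "measure lborel (shell K a b) = measure lborel ?U - measure lborel ?L"
  proof -
    have "shell K a b = ?U - ?L" by (auto simp: shell_def)
    moreover have "measure lborel (?U - ?L) = measure lborel ?U - measure lborel ?L"
      by (rule measurable_measure_Diff[OF fin fmeasurableD[OF fin]]) (use ab in auto)
    ultimately show ?thesis by simp
  qed
  ultimately have "measure lborel (shell K a b) \<le> (c ^ ?d - 1) * measure lborel ?L"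
    by (simp add: algebra_simps)
  also have "\<dots> \<le> (c ^ ?d - 1) * measure lborel (cball (0::'a) (\<rho> + a))"
    using parallel_subset_cball[OF K(1) ne K(3), of a] c UL
    by (intro mult_left_mono measure_mono_fmeasurable) (auto simp: cball_fmeasurable)
  finally show ?thesis by (simp add: c_def)
qed

text \<open>\<open>K\<close> is cut into pieces of diameter at most \<open>\<delta>\<close> by a
  finite cover of \<open>cball 0 \<rho>\<close>. The cover depends on \<open>\<rho>\<close> and
  \<open>a0\<close> only, which makes \<open>C\<close> independent of \<open>K\<close>; the argument
  works for arbitrary compact sets, so the bound applies to \<open>K0\<close> as well as to sets of
  positive reach.\<close>

lemma shell_volume:
  assumes a0: "0 < a0"
  obtains C where "0 \<le> C"
    "\<And>(K :: 'a::euclidean_space set) a b. compact K \<Longrightarrow> K \<noteq> {} \<Longrightarrow> K \<subseteq> cball 0 \<rho> \<Longrightarrow> a0 \<le> a \<Longrightarrow> a \<le> b \<Longrightarrow> b \<le> B \<Longrightarrow>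
      measure lborel (shell K a b) \<le> C * (b - a)"
proof -
  define \<delta> where "\<delta> = a0 / 2"
  have \<delta>: "0 < \<delta>" "\<delta> < a0" using a0 by (auto simp: \<delta>_def)
  obtain T where T: "finite T" "cball (0::'a) \<rho> \<subseteq> (\<Union>c\<in>T. ball c (\<delta> / 2))"
    using compact_cball[of "0::'a" \<rho>] \<delta>(1) unfolding compact_eq_totally_bounded
    by (metis half_gt_zero)
  \<comment> \<open>An upper bound for the quotient \<open>h\<close> below, as
    \<open>b - a \<le> B\<close> and \<open>a - \<delta> \<ge> \<delta>\<close>.\<close>
  define H where "H = B / \<delta>"
  define V where "V = measure lborel (cball (0::'a) (\<rho> + B))"
  define C1 where "C1 = (1 / \<delta>) * (real DIM('a) * (1 + H) ^ DIM('a)) * V"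
  have piece: "measure lborel (shell K a b) \<le> C1 * (b - a)"
    if K: "compact K" "k0 \<in> K" "K \<subseteq> cball 0 \<rho>" "\<And>k. k \<in> K \<Longrightarrow> dist k0 k \<le> \<delta>" and ab: "a0 \<le> a" "a \<le> b" "b \<le> B"
    for K :: "'a set" and k0 a b
  proof -
    have pos: "a - \<delta> \<ge> \<delta>" using ab by (simp add: \<delta>_def)
    define h where "h = (b - a) / (a - \<delta>)"
    have h: "0 \<le> h" "h \<le> (b - a) / \<delta>" using pos \<delta> ab by (auto simp: h_def intro: divide_left_mono)
    have "(b - a) / \<delta> \<le> H" unfolding H_def using ab a0 \<delta> by (intro divide_right_mono) auto
    then have hH: "h \<le> H" using h(2) by simp
    have "measure lborel (shell K a b) \<le> ((1 + h) ^ DIM('a) - 1) * measure lborel (cball (0::'a) (\<rho> + a))"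
      unfolding h_def by (rule shell_volume_small[OF K(1-4)]) (use \<delta> ab in auto)
    also have "\<dots> \<le> (h * (real DIM('a) * (1 + H) ^ DIM('a))) * V"
      unfolding V_def using h hH power_diff_1_le[OF h(1) hH] ab
      by (intro mult_mono measure_mono_fmeasurable) (auto simp: cball_fmeasurable intro: mult_nonneg_nonneg)
    also have "\<dots> \<le> ((b - a) / \<delta> * (real DIM('a) * (1 + H) ^ DIM('a))) * V"
      using h hH by (intro mult_right_mono) (auto simp: V_def)
    finally show ?thesis by (simp add: C1_def mult_ac)
  qed
  define C where "C = real (card T) * \<bar>C1\<bar>"
  show ?thesis
  proof
    show "0 \<le> C" by (simp add: C_def)
    fix K :: "'a set" and a b
    assume K: "compact K" "K \<noteq> {}" "K \<subseteq> cball 0 \<rho>" and ab: "a0 \<le> a" "a \<le> b" "b \<le> B"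
    define Kc where "Kc c = K \<inter> cball c (\<delta> / 2)" for c
    have le: "measure lborel (shell (Kc c) a b) \<le> \<bar>C1\<bar> * (b - a)" if "Kc c \<noteq> {}" for c
    proof -
      obtain k0 where k0: "k0 \<in> Kc c" using \<open>Kc c \<noteq> {}\<close> by blast
      have "measure lborel (shell (Kc c) a b) \<le> C1 * (b - a)"
      proof (rule piece[OF _ k0 _ _ ab])
        show "compact (Kc c)" "Kc c \<subseteq> cball 0 \<rho>" using K by (auto simp: Kc_def compact_Int_closed)
        show "dist k0 k \<le> \<delta>" if "k \<in> Kc c" for k
          using that k0 dist_triangle_half_r[of c k0 "\<delta> * 2" k] dist_triangle3[of k0 k c] by (auto simp: Kc_def)
      qed
      also have "\<dots> \<le> \<bar>C1\<bar> * (b - a)" using ab by (intro mult_right_mono) auto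
      finally show ?thesis .
    qed
    let ?T = "{c \<in> T. Kc c \<noteq> {}}"
    have bnd: "shell (Kc c) a b \<in> fmeasurable lborel" if "Kc c \<noteq> {}" for c
    proof (rule fmeasurableI)
      show "shell (Kc c) a b \<in> sets lborel" using shell_borel by simp
      have "compact (Kc c)" "Kc c \<subseteq> cball 0 \<rho>" using K by (auto simp: Kc_def compact_Int_closed)
      then have "shell (Kc c) a b \<subseteq> cball 0 (\<rho> + b)" using parallel_subset_cball[OF _ that, of \<rho> b] by (auto simp: shell_def)
      then show "emeasure lborel (shell (Kc c) a b) < \<infinity>" using bounded_subset[OF bounded_cball] emeasure_bounded_finite by blast
    qed
    \<comment> \<open>A point of the shell belongs to the shell of the piece that contains its
      nearest point, as its distance to that piece is its distance to \<open>K\<close>.\<close>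
    have "shell K a b \<subseteq> (\<Union>c\<in>?T. shell (Kc c) a b)"
    proof
      fix x assume x: "x \<in> shell K a b"
      let ?k = "closest_point K x"
      have k: "?k \<in> K" "dist x ?k = infdist x K" using closest_point_props[OF K(1,2)] by auto
      then obtain c where c: "c \<in> T" "?k \<in> ball c (\<delta> / 2)" using T(2) K(3) by blast
      then have kc: "?k \<in> Kc c" using k by (auto simp: Kc_def)
      have "infdist x K \<le> infdist x (Kc c)" using kc by (intro infdist_mono) (auto simp: Kc_def)
      moreover have "infdist x (Kc c) \<le> b" using x k kc by (intro infdist_le2[OF kc]) (auto simp: shell_def)
      ultimately have "x \<in> shell (Kc c) a b" using x by (auto simp: shell_def)
      then show "x \<in> (\<Union>c\<in>?T. shell (Kc c) a b)" using c kc by auto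
    qed
    then have "measure lborel (shell K a b) \<le> measure lborel (\<Union>c\<in>?T. shell (Kc c) a b)"
      using T(1) bnd shell_borel by (intro measure_mono_fmeasurable fmeasurable.finite_UN) auto
    also have "\<dots> \<le> (\<Sum>c\<in>?T. measure lborel (shell (Kc c) a b))"
      using T(1) by (intro measure_UNION_le) (auto simp: shell_borel)
    also have "\<dots> \<le> (\<Sum>c\<in>?T. \<bar>C1\<bar> * (b - a))" by (intro sum_mono le) auto
    also have "\<dots> \<le> (\<Sum>c\<in>T. \<bar>C1\<bar> * (b - a))" using T(1) ab by (intro sum_mono2) auto
    also have "\<dots> = C * (b - a)" by (simp add: C_def)
    finally show "measure lborel (shell K a b) \<le> C * (b - a)" .
  qed
qed

section \<open>Measurability of the nearest-point map\<close>

text \<open>Adding the two squared inequalities leaves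
  \<open>(t' - t) * (y \<bullet> e - z \<bullet> e) \<ge> 0\<close>: nearest points cannot move
  backwards along a line.\<close>

lemma nearest_points_monotone:
  fixes e :: "'a::real_inner"
  assumes t: "t < t'" and z: "dist (x + t *\<^sub>R e) z \<le> dist (x + t *\<^sub>R e) y" and y: "dist (x + t' *\<^sub>R e) y \<le> dist (x + t' *\<^sub>R e) z"
  shows "z \<bullet> e \<le> y \<bullet> e"
proof -
  have "(dist (x + t *\<^sub>R e) z)\<^sup>2 \<le> (dist (x + t *\<^sub>R e) y)\<^sup>2" "(dist (x + t' *\<^sub>R e) y)\<^sup>2 \<le> (dist (x + t' *\<^sub>R e) z)\<^sup>2"
    using z y by (auto intro: power_mono)
  then have "(t' - t) * (y \<bullet> e - z \<bullet> e) \<ge> 0"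
    by (simp add: dist_norm power2_norm_eq_inner inner_diff_left inner_diff_right inner_add_left inner_add_right
        inner_commute algebra_simps)
  then show ?thesis using t by (simp add: zero_le_mult_iff)
qed

text \<open>The separation \<open>\<eta>\<close> in a fixed direction makes the set closed when
  \<open>K\<close> is compact; the points with several nearest points form a countable union of such
  sets.\<close>

definition split_points :: "'a::euclidean_space set \<Rightarrow> 'a \<Rightarrow> real \<Rightarrow> 'a set" where
  "split_points K e \<eta> = {x. \<exists>y\<in>K. \<exists>z\<in>K. dist x y = infdist x K \<and> dist x z = infdist x K \<and> \<eta> \<le> z \<bullet> e - y \<bullet> e}"

lemma closed_split_points:
  fixes K :: "'a::euclidean_space set"
  assumes "compact K"
  shows "closed (split_points K e \<eta>)"
proof -
  let ?T = "{p :: ('a \<times> 'a) \<times> 'a. dist (snd p) (fst (fst p)) = infdist (snd p) K} \<inter>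
      {p. dist (snd p) (snd (fst p)) = infdist (snd p) K} \<inter> {p. \<eta> \<le> snd (fst p) \<bullet> e - fst (fst p) \<bullet> e}"
  have "closed ?T"
    by (intro closed_Int closed_Collect_eq closed_Collect_le continuous_intros)
  from closed_compact_projection[OF compact_Times[OF assms assms] this]
  have "closed {x. \<exists>p. p \<in> K \<times> K \<and> (p, x) \<in> ?T}" .
  moreover have "{x. \<exists>p. p \<in> K \<times> K \<and> (p, x) \<in> ?T} = split_points K e \<eta>"
    by (auto simp: split_points_def)
  ultimately show ?thesis by simp
qed

text \<open>Along a line the nearest points move monotonically, so only countably many points of the
  line have nearest points a distance \<open>\<eta>\<close> apart in that direction.\<close>

lemma split_points_null:
  fixes K :: "'a::euclidean_space set"
  assumes K: "compact K" and \<eta>: "0 < \<eta>"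
  shows "split_points K e \<eta> \<in> null_sets lborel"
proof -
  let ?N = "split_points K e \<eta>"
  have borel: "?N \<in> sets borel" using closed_split_points[OF K] by (rule borel_closed)
  have ctble: "countable {t. x + t *\<^sub>R e \<in> ?N}" for x
  proof -
    let ?A = "{t. x + t *\<^sub>R e \<in> ?N}"
    define Q where "Q t p \<longleftrightarrow> fst p \<in> K \<and> snd p \<in> K \<and> dist (x + t *\<^sub>R e) (fst p) = infdist (x + t *\<^sub>R e) K \<and>
        dist (x + t *\<^sub>R e) (snd p) = infdist (x + t *\<^sub>R e) K \<and> \<eta> \<le> snd p \<bullet> e - fst p \<bullet> e" for t and p :: "'a \<times> 'a"
    define y z where "y t = fst (SOME p. Q t p)" and "z t = snd (SOME p. Q t p)" for t
    have yz: "y t \<in> K" "z t \<in> K" "dist (x + t *\<^sub>R e) (y t) = infdist (x + t *\<^sub>R e) K"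
      "dist (x + t *\<^sub>R e) (z t) = infdist (x + t *\<^sub>R e) K" "\<eta> \<le> z t \<bullet> e - y t \<bullet> e" if "t \<in> ?A" for t
    proof -
      have "\<exists>p. Q t p" using that by (force simp: split_points_def Q_def)
      then have "Q t (SOME p. Q t p)" by (rule someI_ex)
      then show "y t \<in> K" "z t \<in> K" "dist (x + t *\<^sub>R e) (y t) = infdist (x + t *\<^sub>R e) K"
        "dist (x + t *\<^sub>R e) (z t) = infdist (x + t *\<^sub>R e) K" "\<eta> \<le> z t \<bullet> e - y t \<bullet> e"
        by (auto simp: Q_def y_def z_def)
    qed
    \<comment> \<open>Each parameter occupies an interval of length at least \<open>\<eta>\<close>
      on the axis, and these intervals overlap at most in end points, so the integer part of the
      left end divided by \<open>\<eta>\<close> tells the parameters apart.\<close>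
    have less: "\<lfloor>(y t \<bullet> e) / \<eta>\<rfloor> < \<lfloor>(y t' \<bullet> e) / \<eta>\<rfloor>" if t: "t \<in> ?A" "t' \<in> ?A" "t < t'" for t t'
    proof -
      have "z t \<bullet> e \<le> y t' \<bullet> e"
        using nearest_points_monotone[OF t(3), of x e "z t" "y t'"] yz(2,4)[OF t(1)] yz(1,3)[OF t(2)]
        by (simp add: infdist_le)
      then have "y t \<bullet> e + \<eta> \<le> y t' \<bullet> e" using yz(5)[OF t(1)] by simp
      then have "(y t \<bullet> e + \<eta>) / \<eta> \<le> (y t' \<bullet> e) / \<eta>" using \<eta> by (intro divide_right_mono) auto
      then have "(y t \<bullet> e) / \<eta> + 1 \<le> (y t' \<bullet> e) / \<eta>" using \<eta> by (simp add: add_divide_distrib)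
      then show ?thesis by linarith
    qed
    have "inj_on (\<lambda>t. \<lfloor>(y t \<bullet> e) / \<eta>\<rfloor>) ?A"
    proof (rule inj_onI, rule ccontr)
      fix t t' assume t: "t \<in> ?A" "t' \<in> ?A" "\<lfloor>(y t \<bullet> e) / \<eta>\<rfloor> = \<lfloor>(y t' \<bullet> e) / \<eta>\<rfloor>" "t \<noteq> t'"
      then consider "t < t'" | "t' < t" by linarith
      then show False
      proof cases
        case 1 show False using less[OF t(1,2) 1] t(3) by simp
      next
        case 2 show False using less[OF t(2,1) 2] t(3) by simp
      qed
    qed
    then show ?thesis by (rule countable_image_inj_on[OF countableI_type])
  qed
  have shift: "emeasure lborel ?N = (\<integral>\<^sup>+x. indicator ?N (x + t *\<^sub>R e) \<partial>lborel)" for t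
  proof -
    have "emeasure lborel ?N = (\<integral>\<^sup>+x. indicator ?N x \<partial>distr lborel borel ((+) (t *\<^sub>R e)))"
      using borel by (simp add: lborel_distr_plus)
    also have "\<dots> = (\<integral>\<^sup>+x. indicator ?N (x + t *\<^sub>R e) \<partial>lborel)"
      using borel by (subst nn_integral_distr) (auto simp: add.commute)
    finally show ?thesis .
  qed
  \<comment> \<open>Averaging over the translates along \<open>e\<close> turns the volume into an
    integral over lines parallel to \<open>e\<close>, each of which meets the set in a null
    set.\<close>
  have "emeasure lborel ?N = (\<integral>\<^sup>+t. indicator {0..1::real} t * emeasure lborel ?N \<partial>lborel)"
    by (simp add: nn_integral_multc)
  also have "\<dots> = (\<integral>\<^sup>+t. (\<integral>\<^sup>+x. indicator {0..1} t * indicator ?N (x + t *\<^sub>R e) \<partial>lborel) \<partial>lborel)"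
    using borel by (intro nn_integral_cong, subst shift) (simp add: nn_integral_cmult)
  also have "\<dots> = (\<integral>\<^sup>+x. (\<integral>\<^sup>+t. indicator {0..1} t * indicator ?N (x + t *\<^sub>R e) \<partial>lborel) \<partial>lborel)"
  proof (rule lborel_pair.Fubini')
    define C where "C = {z :: 'a \<times> real. fst z + snd z *\<^sub>R e \<in> ?N}"
    have "closed ((\<lambda>z :: 'a \<times> real. fst z + snd z *\<^sub>R e) -` ?N)"
      by (intro continuous_closed_vimage closed_split_points[OF K]) (auto intro!: continuous_intros)
    then have [measurable]: "C \<in> sets (lborel \<Otimes>\<^sub>M lborel)"
      unfolding lborel_prod by (simp add: C_def vimage_def)
    have "(\<lambda>(x, t). indicator {0..1} t * indicator C (x, t) :: ennreal) \<in> borel_measurable (lborel \<Otimes>\<^sub>M lborel)"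
      by measurable
    then show "(\<lambda>(x, t). indicator {0..1} t * indicator ?N (x + t *\<^sub>R e) :: ennreal) \<in> borel_measurable (lborel \<Otimes>\<^sub>M lborel)"
      by (simp add: C_def indicator_def)
  qed
  also have "\<dots> = (\<integral>\<^sup>+x. 0 \<partial>(lborel :: 'a measure))"
  proof (rule nn_integral_cong)
    fix x :: 'a
    have "AE t in lborel. t \<notin> {t. x + t *\<^sub>R e \<in> ?N}"
      by (rule AE_not_in[OF countable_imp_null_set_lborel[OF ctble]])
    then have "AE t in lborel. indicator {0..1} t * indicator ?N (x + t *\<^sub>R e) = (0 :: ennreal)"
      by eventually_elim simp
    then show "(\<integral>\<^sup>+t. indicator {0..1} t * indicator ?N (x + t *\<^sub>R e) \<partial>lborel) = 0"
      using nn_integral_cong_AE by fastforce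
  qed
  finally show ?thesis using borel by (simp add: null_sets_def)
qed

text \<open>Distinct nearest points differ in some coordinate by at least
  \<open>1 / real (Suc n)\<close> for some \<open>n\<close>; which of them plays the role of
  \<open>y\<close> depends on the sign of the difference.\<close>

lemma unique_nearest_null:
  fixes K :: "'a::euclidean_space set"
  assumes K: "compact K" "K \<noteq> {}"
  shows "- unique_nearest K \<in> null_sets lborel"
proof -
  have "- unique_nearest K = (\<Union>e\<in>Basis. \<Union>n. split_points K e (1 / real (Suc n)))"
  proof safe
    fix x assume "x \<notin> unique_nearest K"
    then obtain y where y: "y \<in> K" "dist x y = infdist x K" "y \<noteq> closest_point K x"
      by (auto simp: unique_nearest_def)
    then obtain e where e: "e \<in> Basis" "y \<bullet> e \<noteq> closest_point K x \<bullet> e"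
      using euclidean_eqI by blast
    obtain n where "1 / real (Suc n) < \<bar>y \<bullet> e - closest_point K x \<bullet> e\<bar>"
      using e(2) nat_approx_posE[of "\<bar>y \<bullet> e - closest_point K x \<bullet> e\<bar>"] by auto
    then have "x \<in> split_points K e (1 / real (Suc n))"
      using y closest_point_props[OF K, of x] unfolding split_points_def
      by (cases "y \<bullet> e < closest_point K x \<bullet> e") (fastforce simp: dist_commute)+
    then show "x \<in> (\<Union>e\<in>Basis. \<Union>n. split_points K e (1 / real (Suc n)))" using e(1) by blast
  next
    fix x e n assume x: "x \<in> split_points K e (1 / real (Suc n))" "x \<in> unique_nearest K"
    then obtain y z where yz: "y \<in> K" "z \<in> K" "dist x y = infdist x K" "dist x z = infdist x K" "1 / real (Suc n) \<le> z \<bullet> e - y \<bullet> e"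
      by (auto simp: split_points_def)
    have "y = closest_point K x" "z = closest_point K x" using x(2) yz by (auto simp: unique_nearest_def)
    then have "y = z" by simp
    moreover have "0 < 1 / real (Suc n)" by simp
    ultimately show False using yz(5) by simp
  qed
  also have "\<dots> \<in> null_sets lborel"
    by (intro null_sets_UN' null_sets_UN split_points_null[OF K(1)] countable_finite) auto
  finally show ?thesis .
qed

text \<open>On the null set without unique nearest points \<open>closest_point\<close> is an
  arbitrary choice; completeness of \<open>lebesgue\<close> absorbs it.\<close>

lemma lebesgue_measurable_null:
  fixes f g :: "'a::euclidean_space \<Rightarrow> 'b::topological_space"
  assumes g: "g \<in> borel_measurable borel" and N: "N \<in> null_sets lborel" and fg: "\<And>x. x \<notin> N \<Longrightarrow> f x = g x"
  shows "f \<in> borel_measurable lebesgue"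
proof (rule measurableI)
  fix B :: "'b set" assume B: "B \<in> sets borel"
  have "f -` B \<inter> space lebesgue = (g -` B - N) \<union> (f -` B \<inter> N)" using fg by auto
  moreover have "g -` B \<in> sets borel" using measurable_sets[OF g B] by simp
  then have "g -` B - N \<in> sets lebesgue" using null_setsD2[OF N] by (intro sets_completionI_sets sets.Diff) simp_all
  moreover have "f -` B \<inter> N \<in> sets lebesgue" by (rule null_sets_completion[OF N]) auto
  ultimately show "f -` B \<inter> space lebesgue \<in> sets lebesgue" by (metis sets.Un)
qed simp


section \<open>Stability of the Voronoi tensors\<close>

text \<open>\<open>2 * \<rho>\<close> is admissible, so the infimum is taken over a nonempty set.
  Each \<open>infdist\<close> in question is a lower bound of all admissible values, hence of the
  infimum, so the inclusions hold at the distance itself.\<close>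

lemma hausdorff_distance_props:
  fixes K K0 :: "'a::euclidean_space set"
  assumes K: "K \<noteq> {}" "K \<subseteq> cball 0 \<rho>" and K0: "K0 \<noteq> {}" "K0 \<subseteq> cball 0 \<rho>" and \<rho>: "\<rho> > 0"
  defines "\<epsilon> \<equiv> hausdorff_distance K0 K"
  shows "0 \<le> \<epsilon>" "\<epsilon> \<le> 2 * \<rho>" "\<And>x. x \<in> K0 \<Longrightarrow> infdist x K \<le> \<epsilon>" "\<And>x. x \<in> K \<Longrightarrow> infdist x K0 \<le> \<epsilon>"
proof -
  let ?E = "{\<epsilon>. \<epsilon> > 0 \<and> K0 \<subseteq> parallel_set K \<epsilon> \<and> K \<subseteq> parallel_set K0 \<epsilon>}"
  have \<epsilon>: "\<epsilon> = Inf ?E" by (simp add: \<epsilon>_def hausdorff_distance_def)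
  have bdd: "bdd_below ?E" by (intro bdd_belowI[of _ 0]) auto
  have close: "infdist x B \<le> 2 * \<rho>" if "x \<in> cball 0 \<rho>" "B \<noteq> {}" "B \<subseteq> cball 0 \<rho>" for x :: 'a and B
  proof -
    obtain y where y: "y \<in> B" using \<open>B \<noteq> {}\<close> by blast
    have "dist x y \<le> norm x + norm y" by (simp add: dist_norm norm_triangle_ineq4)
    also have "\<dots> \<le> 2 * \<rho>" using that y by auto
    finally show ?thesis using y by (intro infdist_le2)
  qed
  have mem: "2 * \<rho> \<in> ?E"
  proof -
    have "infdist x K \<le> 2 * \<rho>" if "x \<in> K0" for x using that K K0 by (intro close) blast+
    moreover have "infdist x K0 \<le> 2 * \<rho>" if "x \<in> K" for x using that K K0 by (intro close) blast+
    ultimately show ?thesis using \<rho> by (auto simp: parallel_set_def)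
  qed
  show "0 \<le> \<epsilon>" unfolding \<epsilon> using mem by (intro cInf_greatest) auto
  show "\<epsilon> \<le> 2 * \<rho>" unfolding \<epsilon> using mem bdd by (rule cInf_lower)
  show "infdist x K \<le> \<epsilon>" if "x \<in> K0" for x
    unfolding \<epsilon> using mem that by (intro cInf_greatest) (auto simp: parallel_set_def)
  show "infdist x K0 \<le> \<epsilon>" if "x \<in> K" for x
    unfolding \<epsilon> using mem that by (intro cInf_greatest) (auto simp: parallel_set_def)
qed

lemma infdist_le_add_hausdorff:
  fixes K K0 :: "'a::euclidean_space set"
  assumes "compact K0" "K0 \<noteq> {}" "\<And>y. y \<in> K0 \<Longrightarrow> infdist y K \<le> \<epsilon>"
  shows "infdist x K \<le> infdist x K0 + \<epsilon>"
  using infdist_triangle[of x K "closest_point K0 x"] closest_point_props[OF assms(1,2), of x]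
    assms(3)[of "closest_point K0 x"] by simp

text \<open>Here \<open>q\<close> is a point near \<open>K\<close> that almost minimizes the
  distance to \<open>x\<close>, in the application the nearest point in the other set. Its
  projection lies in \<open>K\<close> within \<open>t + 2 * \<epsilon>\<close> of \<open>x\<close>;
  squaring and \<open>prox_inequality\<close> give \<open>N\<^sup>2 * w \<le> 4 * t * \<epsilon> + 4
  * \<epsilon>\<^sup>2\<close>, and taking roots produces \<open>sqrt \<epsilon>\<close>.\<close>

lemma (in prox_regular) proj_stability:
  assumes x: "infdist x K < r" and q: "infdist q K \<le> \<epsilon>" "dist x q \<le> infdist x K + \<epsilon>" and \<epsilon>: "0 \<le> \<epsilon>" "\<epsilon> \<le> E"
  shows "norm (q - proj x) \<le> sqrt \<epsilon> * (sqrt (4 * r + 4 * E) * (1 / sqrt (1 - infdist x K / r)) + sqrt E)"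
proof -
  define t where "t = infdist x K"
  define N where "N = norm (proj q - proj x)"
  define w where "w = 1 - t / r"
  have t: "0 \<le> t" "t < r" using x by (auto simp: t_def infdist_nonneg)
  have w: "w > 0" using t r_pos by (simp add: w_def)
  have "dist x (proj q) \<le> t + 2 * \<epsilon>"
    using dist_triangle[of x "proj q" q] dist_proj[of q] q by (simp add: t_def)
  then have "(dist x (proj q))\<^sup>2 \<le> (t + 2 * \<epsilon>)\<^sup>2" by (intro power_mono) auto
  moreover have "(dist x (proj q))\<^sup>2 = t\<^sup>2 + N\<^sup>2 - 2 * ((proj q - proj x) \<bullet> (x - proj x))"
  proof -
    have "(dist x (proj q))\<^sup>2 = (norm (x - proj x))\<^sup>2 + N\<^sup>2 - 2 * ((proj q - proj x) \<bullet> (x - proj x))"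
      by (simp add: N_def dist_norm power2_norm_eq_inner inner_diff_left inner_diff_right inner_commute algebra_simps)
    then show ?thesis by (simp add: norm_proj t_def)
  qed
  moreover have "2 * ((proj q - proj x) \<bullet> (x - proj x)) \<le> N\<^sup>2 * (t / r)"
    using prox_inequality[OF x proj_in, of q] r_pos by (simp add: N_def t_def field_simps)
  ultimately have "N\<^sup>2 * w \<le> 4 * t * \<epsilon> + 4 * \<epsilon>\<^sup>2"
    by (simp add: w_def power2_eq_square algebra_simps)
  also have "\<dots> \<le> 4 * r * \<epsilon> + 4 * (E * \<epsilon>)"
    using t \<epsilon> by (intro add_mono mult_mono) (auto simp: power2_eq_square intro: mult_right_mono)
  finally have "N\<^sup>2 * w \<le> \<epsilon> * (4 * r + 4 * E)" by (simp add: algebra_simps)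
  then have "N\<^sup>2 \<le> \<epsilon> * (4 * r + 4 * E) * (1 / w)" using w by (simp add: field_simps)
  then have "N \<le> sqrt (\<epsilon> * (4 * r + 4 * E) * (1 / w))" by (rule real_le_rsqrt)
  then have N: "N \<le> sqrt \<epsilon> * (sqrt (4 * r + 4 * E) * (1 / sqrt w))"
    by (simp add: real_sqrt_mult real_sqrt_divide)
  \<comment> \<open>The bound \<open>E\<close> on \<open>\<epsilon>\<close> turns the linear error
    from replacing \<open>q\<close> by \<open>proj q\<close> into a root.\<close>
  have "\<epsilon> = sqrt \<epsilon> * sqrt \<epsilon>" using \<epsilon> by simp
  also have "\<dots> \<le> sqrt \<epsilon> * sqrt E" using \<epsilon> by (intro mult_left_mono) auto
  finally have "\<epsilon> \<le> sqrt \<epsilon> * sqrt E" .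
  moreover have "norm (q - proj x) \<le> norm (q - proj q) + N"
    unfolding N_def using norm_triangle_ineq[of "q - proj q" "proj q - proj x"] by simp
  ultimately have "norm (q - proj x) \<le> sqrt \<epsilon> * sqrt E + sqrt \<epsilon> * (sqrt (4 * r + 4 * E) * (1 / sqrt w))"
    using N q(1) by (simp add: norm_proj)
  then show ?thesis by (simp add: w_def t_def algebra_simps)
qed

text \<open>Where \<open>w = 1 - t / r\<close> lies between \<open>(1 / 4) ^ (j + 2)\<close> and
  \<open>(1 / 4) ^ Suc j\<close>, the left side is at most \<open>2 ^ (j + 2)\<close>; powers of 4
  make the roots powers of 2. The summand 2 accounts for \<open>w \<ge> 1 / 4\<close>.\<close>

lemma inverse_sqrt_dyadic:
  assumes t: "0 \<le> t" "t < r"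
  shows "ennreal (1 / sqrt (1 - t / r)) \<le> 2 + (\<Sum>j. ennreal (2 ^ (j + 2)) * indicator {r * (1 - (1 / 4) ^ Suc j)<..r} t)"
proof -
  have r: "r > 0" using t by simp
  define w where "w = 1 - t / r"
  have w: "0 < w" "w \<le> 1" using t r by (auto simp: w_def)
  have sq: "1 / sqrt w \<le> 2 ^ n" if "(1 / 4) ^ n \<le> w" for n
  proof -
    have "((1 / 2 :: real) ^ n)\<^sup>2 = (1 / 4) ^ n" by (simp add: power2_eq_square power_mult_distrib[symmetric])
    then have "(1 / 2) ^ n \<le> sqrt w" using that by (intro real_le_rsqrt) simp
    then show ?thesis using w by (simp add: power_one_over field_simps)
  qed
  show ?thesis
  proof (cases "1 / 4 \<le> w")
    case True
    then have "1 / sqrt w \<le> 2" using sq[of 1] by simp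
    then have "ennreal (1 / sqrt w) \<le> ennreal 2" by (rule ennreal_leI)
    also have "ennreal 2 = 2" by simp
    also have "(2 :: ennreal) \<le> 2 + (\<Sum>j. ennreal (2 ^ (j + 2)) * indicator {r * (1 - (1 / 4) ^ Suc j)<..r} t)" by simp
    finally show ?thesis by (simp add: w_def)
  next
    case False
    obtain n0 where "(1 / 4 :: real) ^ n0 < w" using real_arch_pow_inv[OF w(1), of "1 / 4"] by auto
    then have ex: "(1 / 4 :: real) ^ n0 \<le> w" by simp
    define n where "n = (LEAST n. (1 / 4 :: real) ^ n \<le> w)"
    have n: "(1 / 4) ^ n \<le> w" unfolding n_def by (rule LeastI[of "\<lambda>n. (1 / 4 :: real) ^ n \<le> w", OF ex])
    have "n \<noteq> 0"
    proof
      assume "n = 0"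
      then have "1 \<le> w" using n by simp
      then show False using False by simp
    qed
    moreover have "n \<noteq> 1" using n False by auto
    \<comment> \<open>The exponents 0 and 1 are excluded by \<open>w < 1 / 4\<close>, and by
      minimality of \<open>n\<close> the preceding power, of exponent \<open>Suc j\<close>, exceeds
      \<open>w\<close>.\<close>
    ultimately obtain j where j: "n = j + 2" by (metis One_nat_def add_2_eq_Suc' not0_implies_Suc)
    have "\<not> (1 / 4 :: real) ^ Suc j \<le> w" unfolding n_def using not_less_Least[of "Suc j" "\<lambda>n. (1 / 4 :: real) ^ n \<le> w"] j n_def by simp
    then have "w < (1 / 4) ^ Suc j" by simp
    then have "t > r * (1 - (1 / 4) ^ Suc j)" using r by (simp add: w_def field_simps)
    then have "ennreal (1 / sqrt w) \<le> ennreal (2 ^ (j + 2)) * indicator {r * (1 - (1 / 4) ^ Suc j)<..r} t"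
      using sq[OF n] j t by (simp add: ennreal_leI)
    also have "\<dots> \<le> (\<Sum>j. ennreal (2 ^ (j + 2)) * indicator {r * (1 - (1 / 4) ^ Suc j)<..r} t)"
    proof -
      define g where "g j = ennreal (2 ^ (j + 2)) * indicator {r * (1 - (1 / 4) ^ Suc j)<..r} t" for j
      have "g j \<le> suminf g" using sum_le_suminf[of g "{j}"] by simp
      then show ?thesis unfolding g_def .
    qed
    also have "\<dots> \<le> 2 + \<dots>" by simp
    finally show ?thesis by (simp add: w_def)
  qed
qed

lemma shell_fmeasurable:
  fixes K :: "'a::euclidean_space set"
  assumes "compact K" "K \<noteq> {}" "K \<subseteq> cball 0 \<rho>"
  shows "shell K a b \<in> fmeasurable lborel"
proof (rule fmeasurableI)
  have "shell K a b \<subseteq> cball 0 (\<rho> + b)" using parallel_subset_cball[OF assms, of b] by (auto simp: shell_def)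
  then show "emeasure lborel (shell K a b) < \<infinity>" using bounded_subset[OF bounded_cball] emeasure_bounded_finite by blast
qed (simp add: shell_borel)

text \<open>The \<open>j\<close>-th shell has volume at most \<open>C * r * (1 / 4) ^ Suc j\<close>
  and carries the weight \<open>2 ^ (j + 2)\<close>, so it contributes at most
  \<open>C * r * (1 / 2) ^ j\<close>. The geometric series sums to \<open>2 * (C * r)\<close>; the
  summand \<open>2 * V\<close> in \<open>W\<close> comes from the constant 2 in
  \<open>inverse_sqrt_dyadic\<close>.\<close>

lemma singular_integral_bound:
  assumes r: "0 < r"
  obtains W where "0 \<le> W"
    "\<And>K :: 'a::euclidean_space set. compact K \<Longrightarrow> K \<noteq> {} \<Longrightarrow> K \<subseteq> cball 0 \<rho> \<Longrightarrow>
      (\<integral>\<^sup>+x. indicator {x. infdist x K < r} x * ennreal (1 / sqrt (1 - infdist x K / r)) \<partial>lborel) \<le> ennreal W"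
proof -
  obtain C where C: "0 \<le> C"
    "\<And>(K :: 'a set) a b. compact K \<Longrightarrow> K \<noteq> {} \<Longrightarrow> K \<subseteq> cball 0 \<rho> \<Longrightarrow> r / 2 \<le> a \<Longrightarrow> a \<le> b \<Longrightarrow> b \<le> r \<Longrightarrow>
      measure lborel (shell K a b) \<le> C * (b - a)"
    using shell_volume[of "r / 2" \<rho> r] r by (metis half_gt_zero)
  define V where "V = measure lborel (cball (0::'a) (\<rho> + r))"
  define W where "W = 2 * V + 2 * (C * r)"
  show ?thesis
  proof
    show "0 \<le> W" using C(1) r by (simp add: W_def V_def)
    fix K :: "'a set" assume K: "compact K" "K \<noteq> {}" "K \<subseteq> cball 0 \<rho>"
    let ?U = "{x. infdist x K < r}" and ?a = "\<lambda>j. r * (1 - (1 / 4) ^ Suc j)"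
    have U: "?U \<in> sets borel" by (intro borel_open open_Collect_less continuous_intros)
    have a: "r / 2 \<le> ?a j" "?a j \<le> r" for j
    proof -
      have "(1 / 4 :: real) ^ Suc j \<le> (1 / 4) ^ 1" by (rule power_decreasing) auto
      then have "r * (1 / 2) \<le> ?a j" using r by (intro mult_left_mono) auto
      then show "r / 2 \<le> ?a j" by simp
      show "?a j \<le> r" using r by (simp add: mult_le_cancel_left1)
    qed
    have "indicator ?U x * ennreal (1 / sqrt (1 - infdist x K / r)) \<le>
        2 * indicator ?U x + (\<Sum>j. ennreal (2 ^ (j + 2)) * indicator (shell K (?a j) r) x)" for x
    proof (cases "infdist x K < r")
      case True
      have "indicator {?a j<..r} (infdist x K) = (indicator (shell K (?a j) r) x :: ennreal)" for j
        by (simp add: shell_def indicator_def)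
      then show ?thesis using True inverse_sqrt_dyadic[OF infdist_nonneg True] by simp
    qed simp
    then have "(\<integral>\<^sup>+x. indicator ?U x * ennreal (1 / sqrt (1 - infdist x K / r)) \<partial>lborel) \<le>
        (\<integral>\<^sup>+x. 2 * indicator ?U x + (\<Sum>j. ennreal (2 ^ (j + 2)) * indicator (shell K (?a j) r) x) \<partial>lborel)"
      by (rule nn_integral_mono)
    also have "\<dots> = 2 * emeasure lborel ?U + (\<Sum>j. ennreal (2 ^ (j + 2)) * emeasure lborel (shell K (?a j) r))"
      using U shell_borel[of K]
      by (subst nn_integral_add) (simp_all add: nn_integral_cmult nn_integral_suminf)
    also have "\<dots> \<le> ennreal (2 * V) + (\<Sum>j. ennreal (C * r * (1 / 2) ^ j))"
    proof (intro add_mono suminf_le)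
      have "emeasure lborel ?U \<le> emeasure lborel (cball (0::'a) (\<rho> + r))"
        using parallel_subset_cball[OF K, of r] by (intro emeasure_mono) auto
      also have "\<dots> = ennreal V" unfolding V_def by (rule emeasure_eq_measure2[OF cball_fmeasurable])
      finally have "2 * emeasure lborel ?U \<le> ennreal 2 * ennreal V" by (simp add: mult_left_mono)
      then show "2 * emeasure lborel ?U \<le> ennreal (2 * V)" by (simp add: ennreal_mult' V_def)
      fix j
      have "measure lborel (shell K (?a j) r) \<le> C * (r - ?a j)" by (rule C(2)[OF K a]) simp
      also have "\<dots> = C * r * (1 / 4) ^ Suc j" by (simp add: algebra_simps)
      finally have m: "measure lborel (shell K (?a j) r) \<le> C * r * (1 / 4) ^ Suc j" .
      have "ennreal (2 ^ (j + 2)) * emeasure lborel (shell K (?a j) r) = ennreal (2 ^ (j + 2) * measure lborel (shell K (?a j) r))"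
        by (simp add: emeasure_eq_measure2[OF shell_fmeasurable[OF K]] ennreal_mult)
      also have "\<dots> \<le> ennreal (2 ^ (j + 2) * (C * r * (1 / 4) ^ Suc j))"
        using m by (intro ennreal_leI mult_left_mono) auto
      also have "2 ^ (j + 2) * (C * r * (1 / 4) ^ Suc j) = C * r * ((2::real) ^ j * (1 / 4) ^ j)" by (simp add: power_add)
      also have "(2::real) ^ j * (1 / 4) ^ j = (1 / 2) ^ j" by (simp add: power_mult_distrib[symmetric])
      finally show "ennreal (2 ^ (j + 2)) * emeasure lborel (shell K (?a j) r) \<le> ennreal (C * r * (1 / 2) ^ j)" .
    qed auto
    also have "(\<Sum>j. ennreal (C * r * (1 / 2) ^ j)) = ennreal (C * r * 2)"
    proof (rule suminf_ennreal_eq)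
      show "0 \<le> C * r * (1 / 2) ^ j" for j using C(1) r by simp
      show "(\<lambda>j. C * r * (1 / 2) ^ j) sums (C * r * 2)"
        using sums_mult[OF geometric_sums[of "1 / 2 :: real"], of "C * r"] by simp
    qed
    also have "ennreal (2 * V) + ennreal (C * r * 2) = ennreal W"
      using C(1) r by (subst ennreal_plus[symmetric]) (auto simp: W_def V_def mult_ac)
    finally show "(\<integral>\<^sup>+x. indicator ?U x * ennreal (1 / sqrt (1 - infdist x K / r)) \<partial>lborel) \<le> ennreal W" .
  qed
qed

text \<open>The level set lies in shells of arbitrarily small width. At distance exactly
  \<open>r\<close> from \<open>K\<close> \<open>proj_stability\<close> says nothing, so these points
  have to be discarded.\<close>

lemma level_set_null:
  fixes K :: "'a::euclidean_space set"
  assumes K: "compact K" "K \<noteq> {}" "K \<subseteq> cball 0 \<rho>" and r: "0 < r"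
  shows "{x. infdist x K = r} \<in> null_sets lborel"
proof -
  let ?L = "{x. infdist x K = r}"
  obtain C where C: "0 \<le> C"
    "\<And>(K :: 'a set) a b. compact K \<Longrightarrow> K \<noteq> {} \<Longrightarrow> K \<subseteq> cball 0 \<rho> \<Longrightarrow> r / 2 \<le> a \<Longrightarrow> a \<le> b \<Longrightarrow> b \<le> r \<Longrightarrow>
      measure lborel (shell K a b) \<le> C * (b - a)"
    using shell_volume[of "r / 2" \<rho> r] r by (metis half_gt_zero)
  have L: "?L \<in> sets borel" by (intro borel_closed closed_Collect_eq continuous_intros)
  have "emeasure lborel ?L \<le> ennreal (C * (r / 2 * (1 / real (Suc n))))" for n
  proof -
    define a where "a = r - r / 2 * (1 / real (Suc n))"
    have "r / 2 * (1 / real (Suc n)) \<le> r / 2 * 1" using r by (intro mult_left_mono) auto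
    then have a: "r / 2 \<le> a" "a < r" using r by (auto simp: a_def)
    have "emeasure lborel ?L \<le> emeasure lborel (shell K a r)"
      using a shell_borel[of K] by (intro emeasure_mono) (auto simp: shell_def)
    also have "\<dots> = ennreal (measure lborel (shell K a r))" by (rule emeasure_eq_measure2[OF shell_fmeasurable[OF K]])
    also have "\<dots> \<le> ennreal (C * (r - a))" using C(2)[OF K, of a r] a by (intro ennreal_leI) auto
    finally show ?thesis by (simp add: a_def)
  qed
  moreover have "(\<lambda>n. ennreal (C * (r / 2 * (1 / real (Suc n))))) \<longlonglongrightarrow> ennreal (C * (r / 2 * 0))"
    by (intro tendsto_ennrealI tendsto_intros) (use LIMSEQ_inverse_real_of_nat in \<open>simp add: inverse_eq_divide\<close>)
  ultimately have "emeasure lborel ?L \<le> ennreal (C * (r / 2 * 0))"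
    using LIMSEQ_le_const by blast
  then show ?thesis using L by (simp add: null_sets_def)
qed

text \<open>For \<open>K0\<close> there is no positive reach from which to infer continuity on the
  parallel set; continuity off the null set of points with several nearest points takes its
  place.\<close>

lemma voronoi_integrand_measurable:
  fixes K :: "'a::euclidean_space set"
  assumes K: "compact K" "K \<noteq> {}"
  shows "(\<lambda>x. sym_tensor r s (closest_point K x) (x - closest_point K x) v) \<in> borel_measurable lebesgue"
proof -
  let ?f = "\<lambda>x. sym_tensor r s (closest_point K x) (x - closest_point K x) v" and ?U = "unique_nearest K"
  have N: "- ?U \<in> null_sets lborel" by (rule unique_nearest_null[OF K])
  have U: "?U \<in> sets borel" using null_setsD2[OF N] by (metis borel_comp double_complement sets_lborel)
  have "continuous_on ?U ?f"
    by (intro continuous_on_sym_tensor continuous_intros continuous_on_closest_point K) auto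
  from borel_measurable_continuous_on_indicator[OF U this]
  show ?thesis by (rule lebesgue_measurable_null[OF _ N]) simp
qed

text \<open>The summand 1 keeps the bound at least 1, as \<open>sym_tensor_lipschitz\<close>
  requires.\<close>

lemma voronoi_integrand_bound:
  fixes K :: "'a::euclidean_space set"
  assumes K: "compact K" "K \<noteq> {}" "K \<subseteq> cball 0 \<rho>" and x: "infdist x K \<le> R" and R: "0 \<le> R"
  shows "norm (closest_point K x) \<le> 1 + \<rho> + R" "norm (x - closest_point K x) \<le> 1 + \<rho> + R"
proof -
  have n: "norm (closest_point K x) \<le> \<rho>" using subsetD[OF K(3) closest_point_props(1)[OF K(1,2), of x]] by simp
  then show "norm (closest_point K x) \<le> 1 + \<rho> + R" using R by simp
  have "0 \<le> \<rho>" using n norm_ge_zero order.trans by blast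
  then show "norm (x - closest_point K x) \<le> 1 + \<rho> + R"
    using closest_point_props(2)[OF K(1,2), of x] x by (simp add: dist_norm)
qed

lemma voronoi_integrable:
  fixes K :: "'a::euclidean_space set"
  assumes K: "compact K" "K \<noteq> {}" "K \<subseteq> cball 0 \<rho>" and R: "0 \<le> R" and v: "\<And>i. i < r + s \<Longrightarrow> norm (v i) = 1"
  shows "integrable lebesgue (\<lambda>x. indicator (parallel_set K R) x * sym_tensor r s (closest_point K x) (x - closest_point K x) v)"
proof (rule integrableI_bounded_set[where A = "parallel_set K R" and B = "(1 + \<rho> + R) ^ (r + s)"])
  have closed: "closed (parallel_set K R)" unfolding parallel_set_def by (intro closed_Collect_le continuous_intros)
  then show P: "parallel_set K R \<in> sets lebesgue" by (intro sets_completionI_sets) (simp add: borel_closed)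
  show "(\<lambda>x. indicator (parallel_set K R) x * sym_tensor r s (closest_point K x) (x - closest_point K x) v) \<in> borel_measurable lebesgue"
    by (intro borel_measurable_times borel_measurable_indicator P voronoi_integrand_measurable K)
  have "bounded (parallel_set K R)"
    using parallel_subset_cball[OF K, of R] bounded_subset[OF bounded_cball] unfolding parallel_set_def by blast
  then have "emeasure lborel (parallel_set K R) < \<infinity>" by (rule emeasure_bounded_finite)
  then show "emeasure lebesgue (parallel_set K R) < \<infinity>" using closed by (simp add: borel_closed)
  show "AE x in lebesgue. x \<in> parallel_set K R \<longrightarrow>
      norm (indicator (parallel_set K R) x * sym_tensor r s (closest_point K x) (x - closest_point K x) v) \<le> (1 + \<rho> + R) ^ (r + s)"
    using sym_tensor_bound[OF voronoi_integrand_bound[OF K _ R] v] by (intro AE_I2) (auto simp: parallel_set_def)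
qed simp

text \<open>The term with \<open>C1\<close> comes from the points counted for only one of the two
  sets, which lie in shells of width \<open>\<epsilon>\<close>; the term with \<open>C2\<close>
  comes from the common points, where the nearest points are compared. Regularity of
  \<open>K\<close> is used with the radius \<open>b\<close> itself, so that the constants do not see
  how far the reach exceeds \<open>b\<close>.\<close>

lemma voronoi_stability:
  assumes \<rho>: "0 < \<rho>" and R0: "0 < R0"
  obtains C1 C2 where "0 \<le> C1" "0 \<le> C2"
    "\<And>(K :: 'a::euclidean_space set) K0 R v. compact K \<Longrightarrow> K \<noteq> {} \<Longrightarrow> K \<subseteq> cball 0 \<rho> \<Longrightarrow> ereal b < reach K \<Longrightarrow>
      compact K0 \<Longrightarrow> K0 \<noteq> {} \<Longrightarrow> K0 \<subseteq> cball 0 \<rho> \<Longrightarrow> R0 \<le> R \<Longrightarrow> R \<le> b \<Longrightarrow> (\<forall>i<r + s. norm (v i) = 1) \<Longrightarrow>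
      \<bar>voronoi_tensor r s R K0 v - voronoi_tensor r s R K v\<bar> \<le>
        C1 * hausdorff_distance K0 K + real (r + s) * C2 * sqrt (hausdorff_distance K0 K)"
proof (cases "R0 \<le> b")
  case False
  \<comment> \<open>No radius satisfies the premises.\<close>
  show ?thesis by (rule that[of 0 0]) (use False in auto)
next
  case True
  then have b: "0 < b" using R0 by simp
  \<comment> \<open>Shells up to radius \<open>b + 2 * \<rho>\<close> occur, since
    \<open>R \<le> b\<close> and the Hausdorff distance is at most
    \<open>2 * \<rho>\<close>.\<close>
  obtain C where C: "0 \<le> C"
    "\<And>(K :: 'a set) a b'. compact K \<Longrightarrow> K \<noteq> {} \<Longrightarrow> K \<subseteq> cball 0 \<rho> \<Longrightarrow> R0 \<le> a \<Longrightarrow> a \<le> b' \<Longrightarrow> b' \<le> b + 2 * \<rho> \<Longrightarrow>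
      measure lborel (shell K a b') \<le> C * (b' - a)"
    by (rule shell_volume[OF R0, of \<rho> "b + 2 * \<rho>"]) blast
  obtain W where W: "0 \<le> W"
    "\<And>K :: 'a set. compact K \<Longrightarrow> K \<noteq> {} \<Longrightarrow> K \<subseteq> cball 0 \<rho> \<Longrightarrow>
      (\<integral>\<^sup>+x. indicator {x. infdist x K < b} x * ennreal (1 / sqrt (1 - infdist x K / b)) \<partial>lborel) \<le> ennreal W"
    by (rule singular_integral_bound[OF b, of \<rho>]) blast
  define n where "n = r + s"
  define M where "M = 1 + \<rho> + b"
  have M: "1 \<le> M" using \<rho> b by (simp add: M_def)
  define V where "V = measure lborel (cball (0::'a) (\<rho> + b))"
  define A where "A = sqrt (4 * b + 4 * (2 * \<rho>))"
  define B where "B = sqrt (2 * \<rho>)"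
  have AB: "0 \<le> A" "0 \<le> B" "0 \<le> V" using \<rho> b by (auto simp: A_def B_def V_def)
  define C2 where "C2 = M ^ n * (A * W + B * V)"
  show ?thesis
  proof (rule that[of "2 * M ^ n * C" C2])
    show "0 \<le> 2 * M ^ n * C" "0 \<le> C2" using M C(1) AB W(1) by (auto simp: C2_def)
    fix K K0 :: "'a set" and R and v :: "nat \<Rightarrow> 'a"
    assume K: "compact K" "K \<noteq> {}" "K \<subseteq> cball 0 \<rho>" and reach: "ereal b < reach K"
      and K0: "compact K0" "K0 \<noteq> {}" "K0 \<subseteq> cball 0 \<rho>" and R: "R0 \<le> R" "R \<le> b" and v': "\<forall>i<r + s. norm (v i) = 1"
    have v: "\<And>i. i < r + s \<Longrightarrow> norm (v i) = 1" using v' by blast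
    interpret prox_regular K b by (rule reach_imp_prox_regular[OF K(1,2) b reach])
    define \<epsilon> where "\<epsilon> = hausdorff_distance K0 K"
    note H = hausdorff_distance_props[OF K(2,3) K0(2,3) \<rho>, folded \<epsilon>_def]
    have d1: "infdist x K \<le> infdist x K0 + \<epsilon>" for x by (rule infdist_le_add_hausdorff[OF K0(1,2) H(3)])
    have d2: "infdist x K0 \<le> infdist x K + \<epsilon>" for x by (rule infdist_le_add_hausdorff[OF K(1,2) H(4)])
    have Rpos: "0 \<le> R" using R R0 by simp
    define f where "f K x = sym_tensor r s (closest_point K x) (x - closest_point K x) v" for K :: "'a set" and x
    define h where "h x = indicator (parallel_set K0 R) x * f K0 x - indicator (parallel_set K R) x * f K x" for x
    have int: "integrable lebesgue (\<lambda>x. indicator (parallel_set K0 R) x * f K0 x)" "integrable lebesgue (\<lambda>x. indicator (parallel_set K R) x * f K x)"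
      unfolding f_def by (rule voronoi_integrable[OF K0 Rpos v], simp) (rule voronoi_integrable[OF K Rpos v], simp)
    have vd: "voronoi_tensor r s R K0 v - voronoi_tensor r s R K v = integral\<^sup>L lebesgue h"
      using int by (simp add: voronoi_tensor_def set_lebesgue_integral_def f_def h_def[abs_def])
    define w where "w x = 1 / sqrt (1 - infdist x K / b)" for x
    let ?U = "{x. infdist x K < b}"
    \<comment> \<open>A majorant of the integrand: the two shells where just one of the indicators
      is 1, then the contributions of the summands with \<open>A\<close> and with \<open>B\<close>
      from \<open>proj_stability\<close> on the common part.\<close>
    define G where "G x = ennreal (M ^ n) * indicator (shell K R (R + \<epsilon>)) x + ennreal (M ^ n) * indicator (shell K0 R (R + \<epsilon>)) x
      + ennreal (M ^ n * real n * sqrt \<epsilon> * A) * (indicator ?U x * ennreal (w x))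
      + ennreal (M ^ n * real n * sqrt \<epsilon> * B) * indicator ?U x" for x
    have Mn: "0 \<le> M ^ n" "0 \<le> M ^ n * real n * sqrt \<epsilon>" using M H(1) by auto
    have fb: "\<bar>f K x\<bar> \<le> M ^ n" if "infdist x K \<le> b" for x
      unfolding f_def n_def M_def by (rule sym_tensor_bound[OF voronoi_integrand_bound[OF K that] v]) (use b in auto)
    have fb0: "\<bar>f K0 x\<bar> \<le> M ^ n" if "infdist x K0 \<le> b" for x
      unfolding f_def n_def M_def by (rule sym_tensor_bound[OF voronoi_integrand_bound[OF K0 that] v]) (use b in auto)
    have hG: "ennreal (norm (h x)) \<le> G x" if x: "infdist x K \<noteq> b" for x
    proof (cases "infdist x K \<le> R")
      case True
      then have xU: "infdist x K < b" using R x by simp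
      show ?thesis
      proof (cases "infdist x K0 \<le> R")
        case T0: True
        define p q where "p = closest_point K x" and "q = closest_point K0 x"
        have q: "q \<in> K0" "dist x q = infdist x K0" unfolding q_def by (rule closest_point_props[OF K0(1,2)])+
        have "norm (q - p) \<le> sqrt \<epsilon> * (A * w x + B)"
          unfolding p_def A_def B_def w_def
          by (rule proj_stability[OF xU H(3)[OF q(1)]]) (use q(2) d2[of x] H(1,2) in auto)
        then have le: "norm (q - p) \<le> sqrt \<epsilon> * (A * w x + B)" "norm ((x - q) - (x - p)) \<le> sqrt \<epsilon> * (A * w x + B)"
          by (auto simp: norm_minus_commute)
        have "norm (h x) = \<bar>f K0 x - f K x\<bar>" using True T0 by (simp add: h_def parallel_set_def)
        also have "\<dots> \<le> M ^ (r + s) * real (r + s) * (sqrt \<epsilon> * (A * w x + B))"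
          unfolding f_def p_def[symmetric] q_def[symmetric]
          using voronoi_integrand_bound[OF K, of x b] voronoi_integrand_bound[OF K0, of x b] True T0 R b
          by (intro sym_tensor_lipschitz[OF M _ _ _ _ v le]) (auto simp: M_def p_def q_def)
        also have "\<dots> = (M ^ n * real n * sqrt \<epsilon> * A) * w x + M ^ n * real n * sqrt \<epsilon> * B"
          by (simp add: n_def algebra_simps)
        finally have "ennreal (norm (h x)) \<le> ennreal ((M ^ n * real n * sqrt \<epsilon> * A) * w x + M ^ n * real n * sqrt \<epsilon> * B)"
          by (rule ennreal_leI)
        also have "\<dots> = ennreal (M ^ n * real n * sqrt \<epsilon> * A) * (indicator ?U x * ennreal (w x)) + ennreal (M ^ n * real n * sqrt \<epsilon> * B) * indicator ?U x"
        proof -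
          have "0 \<le> w x" using xU b by (simp add: w_def)
          then show ?thesis using Mn AB xU by (simp add: ennreal_plus ennreal_mult)
        qed
        also have "\<dots> \<le> G x" by (simp add: G_def add.assoc add_increasing)
        finally show ?thesis .
      next
        case F0: False
        then have "x \<in> shell K0 R (R + \<epsilon>)" using d2[of x] True by (simp add: shell_def)
        moreover have "norm (h x) \<le> M ^ n" using True F0 fb[of x] R by (simp add: h_def parallel_set_def)
        ultimately have "ennreal (norm (h x)) \<le> ennreal (M ^ n) * indicator (shell K0 R (R + \<epsilon>)) x"
          by (simp add: ennreal_leI)
        then show ?thesis unfolding G_def
          by (rule order.trans[OF _ add_increasing2[OF zero_le add_increasing2[OF zero_le add_increasing[OF zero_le order.refl]]]])
      qed
    next
      case False
      show ?thesis
      proof (cases "infdist x K0 \<le> R")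
        case T0: True
        then have "x \<in> shell K R (R + \<epsilon>)" using d1[of x] False by (simp add: shell_def)
        moreover have "norm (h x) \<le> M ^ n" using False T0 fb0[of x] R by (simp add: h_def parallel_set_def)
        ultimately show ?thesis using ennreal_leI[of "norm (h x)" "M ^ n"]
          by (auto simp: G_def intro!: add_increasing2)
      qed (use False in \<open>simp add: h_def parallel_set_def\<close>)
    qed
    have U: "?U \<in> sets borel" by (rule borel_open[OF open_infdist_less])
    have w_meas: "w \<in> borel_measurable borel"
    proof -
      have "(\<lambda>x. infdist x K) \<in> borel_measurable borel" by (intro borel_measurable_continuous_onI continuous_intros)
      then show ?thesis unfolding w_def by measurable
    qed
    have sh: "shell K R (R + \<epsilon>) \<in> sets borel" "shell K0 R (R + \<epsilon>) \<in> sets borel" by (rule shell_borel)+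
    have sh_vol: "emeasure lborel (shell K R (R + \<epsilon>)) \<le> ennreal (C * \<epsilon>)" "emeasure lborel (shell K0 R (R + \<epsilon>)) \<le> ennreal (C * \<epsilon>)"
      using C(2)[OF K, of R "R + \<epsilon>"] C(2)[OF K0, of R "R + \<epsilon>"] R H(1,2)
      by (auto simp: emeasure_eq_measure2[OF shell_fmeasurable[OF K]] emeasure_eq_measure2[OF shell_fmeasurable[OF K0]] intro!: ennreal_leI)
    have U_vol: "emeasure lborel ?U \<le> ennreal V"
      unfolding V_def emeasure_eq_measure2[OF cball_fmeasurable, symmetric]
      using parallel_subset_cball[OF K, of b] by (intro emeasure_mono) auto
    have "ennreal (norm (integral\<^sup>L lebesgue h)) \<le> (\<integral>\<^sup>+x. ennreal (norm (h x)) \<partial>lebesgue)"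
      by (rule integral_norm_bound_ennreal) (use int in \<open>simp add: h_def[abs_def]\<close>)
    also have "\<dots> \<le> (\<integral>\<^sup>+x. G x \<partial>lebesgue)"
    proof (rule nn_integral_mono_AE)
      have "AE x in lebesgue. x \<notin> {x. infdist x K = b}"
        by (rule AE_completion[OF AE_not_in[OF level_set_null[OF K b]]])
      then show "AE x in lebesgue. ennreal (norm (h x)) \<le> G x" by eventually_elim (use hG in auto)
    qed
    also have "\<dots> = (\<integral>\<^sup>+x. G x \<partial>lborel)" by (rule nn_integral_completion)
    also have "\<dots> = ennreal (M ^ n) * emeasure lborel (shell K R (R + \<epsilon>)) + ennreal (M ^ n) * emeasure lborel (shell K0 R (R + \<epsilon>))
      + ennreal (M ^ n * real n * sqrt \<epsilon> * A) * (\<integral>\<^sup>+x. indicator ?U x * ennreal (w x) \<partial>lborel)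
      + ennreal (M ^ n * real n * sqrt \<epsilon> * B) * emeasure lborel ?U"
    proof -
      have 1: "(\<lambda>x. indicator ?U x * ennreal (w x)) \<in> borel_measurable lborel" using U w_meas by measurable
      show ?thesis
        unfolding G_def using U w_meas sh 1
        by (subst nn_integral_add, measurable)+ (simp add: nn_integral_cmult)
    qed
    also have "\<dots> \<le> ennreal (M ^ n) * ennreal (C * \<epsilon>) + ennreal (M ^ n) * ennreal (C * \<epsilon>)
      + ennreal (M ^ n * real n * sqrt \<epsilon> * A) * ennreal W + ennreal (M ^ n * real n * sqrt \<epsilon> * B) * ennreal V"
      by (intro add_mono mult_left_mono sh_vol U_vol) (use W(2)[OF K] in \<open>simp_all add: w_def\<close>)
    also have "\<dots> = ennreal (M ^ n * (C * \<epsilon>) + M ^ n * (C * \<epsilon>) + M ^ n * real n * sqrt \<epsilon> * A * W + M ^ n * real n * sqrt \<epsilon> * B * V)"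
    proof -
      have nn: "0 \<le> C * \<epsilon>" "0 \<le> M ^ n * real n * sqrt \<epsilon> * A" "0 \<le> M ^ n * real n * sqrt \<epsilon> * B" "0 \<le> M ^ n"
        using C(1) H(1) Mn AB by auto
      then have "0 \<le> M ^ n * (C * \<epsilon>)" "0 \<le> M ^ n * real n * sqrt \<epsilon> * A * W" "0 \<le> M ^ n * real n * sqrt \<epsilon> * B * V"
        using W(1) AB(3) by (metis mult_nonneg_nonneg)+
      then show ?thesis using nn W(1) AB(3) by (simp only: ennreal_mult ennreal_plus add_nonneg_nonneg)
    qed
    finally have "norm (integral\<^sup>L lebesgue h) \<le> M ^ n * (C * \<epsilon>) + M ^ n * (C * \<epsilon>) + M ^ n * real n * sqrt \<epsilon> * A * W + M ^ n * real n * sqrt \<epsilon> * B * V"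
      using C(1) H(1) Mn AB W(1) by (subst (asm) ennreal_le_iff) (auto intro!: add_nonneg_nonneg mult_nonneg_nonneg)
    also have "\<dots> = 2 * M ^ n * C * \<epsilon> + real (r + s) * C2 * sqrt \<epsilon>"
      by (simp add: C2_def n_def algebra_simps)
    finally show "\<bar>voronoi_tensor r s R K0 v - voronoi_tensor r s R K v\<bar> \<le>
        2 * M ^ n * C * hausdorff_distance K0 K + real (r + s) * C2 * sqrt (hausdorff_distance K0 K)"
      unfolding vd \<epsilon>_def by simp
  qed
qed

section \<open>Stability of the estimators\<close>

text \<open>Up to the row factors \<open>R i ^ s\<close> and nonzero column factors this is a
  Vandermonde matrix. Its determinant is nonzero, so \<open>mat_inverse\<close> returns a genuine
  inverse and \<open>the\<close> in the estimator is meaningful.\<close>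

lemma steiner_matrix_inverse:
  assumes inj: "inj_on R {..d}" and pos: "\<And>i. i \<le> d \<Longrightarrow> 0 < R i"
  obtains B where "mat_inverse (steiner_matrix d r s R) = Some B" "B \<in> carrier_mat (d + 1) (d + 1)"
    "B * steiner_matrix d r s R = 1\<^sub>m (d + 1)"
proof -
  let ?A = "steiner_matrix d r s R"
  have A: "?A \<in> carrier_mat (d + 1) (d + 1)" by (simp add: steiner_matrix_def)
  obtain W where W: "\<And>c k. k \<le> d \<Longrightarrow> (\<Sum>i\<le>d. W k i * (\<Sum>j\<le>d. c j * R i ^ j)) = (c k :: real)"
    using vandermonde_weights[OF inj] by blast
  have "Determinant.det ?A \<noteq> 0"
  proof
    assume "Determinant.det ?A = 0"
    then obtain v where v: "v \<in> carrier_vec (d + 1)" "v \<noteq> 0\<^sub>v (d + 1)" "?A *\<^sub>v v = 0\<^sub>v (d + 1)"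
      using det_0_iff_vec_prod_zero_field[OF A] by blast
    define c where "c j = fact r * fact s * unit_ball_vol (real (s + j)) * vec_index v j" for j
    have "(\<Sum>j\<le>d. c j * R i ^ j) = 0" if i: "i \<le> d" for i
    proof -
      have "0 = vec_index (?A *\<^sub>v v) i" using v(3) i by simp
      also have "\<dots> = (\<Sum>j\<in>{0..<d + 1}. ?A $$ (i, j) * vec_index v j)"
        using i v(1) A by (simp add: scalar_prod_def)
      also have "\<dots> = (\<Sum>j\<le>d. R i ^ s * (c j * R i ^ j))"
      proof (rule sum.cong)
        show "{0..<d + 1} = {..d}" by auto
        fix j assume "j \<in> {..d}"
        then show "?A $$ (i, j) * vec_index v j = R i ^ s * (c j * R i ^ j)"
          using i by (simp add: steiner_matrix_def c_def power_add)
      qed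
      also have "\<dots> = R i ^ s * (\<Sum>j\<le>d. c j * R i ^ j)" by (simp add: sum_distrib_left)
      finally show ?thesis using pos[OF i] by simp
    qed
    then have "c k = 0" if "k \<le> d" for k using W[OF that, of c] by simp
    then have "vec_index v k = 0" if "k \<le> d" for k
    proof -
      have "c k = 0" "unit_ball_vol (real (s + k)) \<noteq> 0"
        using \<open>\<And>k. k \<le> d \<Longrightarrow> c k = 0\<close>[OF that] less_imp_neq[OF unit_ball_vol_nat_pos[of "s + k"]] by metis+
      then show ?thesis by (simp add: c_def del: of_nat_add)
    qed
    then have "v = 0\<^sub>v (d + 1)" using v(1) by (intro eq_vecI) auto
    then show False using v(2) by simp
  qed
  then have "?A \<in> Units (ring_mat TYPE(real) (d + 1) ())" by (rule det_non_zero_imp_unit[OF A])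
  then obtain B where B: "mat_inverse ?A = Some B"
    using mat_inverse(1)[OF A, where b = "()"] by (cases "mat_inverse ?A") auto
  then show ?thesis using mat_inverse(2)[OF A B] that by blast
qed

text \<open>The Minkowski tensors of \<open>K\<close> solve exactly the linear system that defines
  the estimators, with the Voronoi tensors of \<open>K\<close> on the right-hand side. The error is
  therefore the inverse matrix applied to the difference of the Voronoi tensors, and
  \<open>S\<close>, the sum of the moduli of all its entries, serves for every
  \<open>k\<close>.\<close>

lemma estimator_error:
  assumes \<rho>: "0 < \<rho>" and R0: "0 < R 0" and inc: "\<And>i. i < DIM('a::euclidean_space) \<Longrightarrow> R i < R (Suc i)"
  obtains C1 C2 where "0 \<le> C1" "0 \<le> C2"
    "\<And>(K :: 'a set) K0 k v. compact K \<Longrightarrow> K \<noteq> {} \<Longrightarrow> K \<subseteq> cball 0 \<rho> \<Longrightarrow> ereal (R DIM('a)) < reach K \<Longrightarrow>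
      compact K0 \<Longrightarrow> K0 \<noteq> {} \<Longrightarrow> K0 \<subseteq> cball 0 \<rho> \<Longrightarrow> k \<le> DIM('a) \<Longrightarrow> (\<forall>i<r + s. norm (v i) = 1) \<Longrightarrow>
      \<bar>minkowski_estimator R k r s K0 v - minkowski_tensor k r s K v\<bar> \<le>
        C1 * hausdorff_distance K0 K + real (r + s) * C2 * sqrt (hausdorff_distance K0 K)"
proof -
  let ?d = "DIM('a)"
  have mono: "R i < R j" if "i < j" "j \<le> ?d" for i j
    using that
  proof (induction j)
    case (Suc j)
    then show ?case using inc[of j] by (cases "i = j") (auto intro: order.strict_trans)
  qed simp
  have inj: "inj_on R {..?d}"
    by (rule inj_onI) (metis atMost_iff less_irrefl linorder_neqE_nat mono)
  have R_le: "R 0 \<le> R i" "R i \<le> R ?d" if "i \<le> ?d" for i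
    using mono[of 0 i] mono[of i ?d] that by (cases "i = 0", auto, cases "i = ?d", auto)
  have R_pos: "0 < R i" if "i \<le> ?d" for i using R_le(1)[OF that] R0 by simp
  obtain B where B: "mat_inverse (steiner_matrix ?d r s R) = Some B" "B \<in> carrier_mat (?d + 1) (?d + 1)"
    "B * steiner_matrix ?d r s R = 1\<^sub>m (?d + 1)"
    using steiner_matrix_inverse[OF inj R_pos] by blast
  obtain D1 D2 where D: "0 \<le> D1" "0 \<le> D2"
    "\<And>(K :: 'a set) K0 R' v. compact K \<Longrightarrow> K \<noteq> {} \<Longrightarrow> K \<subseteq> cball 0 \<rho> \<Longrightarrow> ereal (R ?d) < reach K \<Longrightarrow>
      compact K0 \<Longrightarrow> K0 \<noteq> {} \<Longrightarrow> K0 \<subseteq> cball 0 \<rho> \<Longrightarrow> R 0 \<le> R' \<Longrightarrow> R' \<le> R ?d \<Longrightarrow> (\<forall>i<r + s. norm (v i) = 1) \<Longrightarrow>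
      \<bar>voronoi_tensor r s R' K0 v - voronoi_tensor r s R' K v\<bar> \<le>
        D1 * hausdorff_distance K0 K + real (r + s) * D2 * sqrt (hausdorff_distance K0 K)"
    by (rule voronoi_stability[OF \<rho> R0, of "R ?d" r s]) blast
  define S where "S = (\<Sum>a\<le>?d. \<Sum>i\<le>?d. \<bar>B $$ (a, i)\<bar>)"
  have S: "0 \<le> S" by (simp add: S_def sum_nonneg)
  show ?thesis
  proof (rule that[of "S * D1" "S * D2"])
    show "0 \<le> S * D1" "0 \<le> S * D2" using S D by auto
    fix K K0 :: "'a set" and k and v :: "nat \<Rightarrow> 'a"
    assume K: "compact K" "K \<noteq> {}" "K \<subseteq> cball 0 \<rho>" "ereal (R ?d) < reach K"
      and K0: "compact K0" "K0 \<noteq> {}" "K0 \<subseteq> cball 0 \<rho>" and k: "k \<le> ?d" and v: "\<forall>i<r + s. norm (v i) = 1"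
    \<comment> \<open>The row of the inverse that produces the index \<open>k\<close>, as solutions
      are listed from \<open>?d\<close> down to 0.\<close>
    define a where "a = ?d - k"
    have a: "a \<le> ?d" "?d - a = k" using k by (auto simp: a_def)
    have est: "minkowski_estimator R k r s K0 v = (\<Sum>i\<le>?d. B $$ (a, i) * voronoi_tensor r s (R i) K0 v)"
    proof -
      have "minkowski_estimator R k r s K0 v = (\<Sum>i\<in>{0..<?d + 1}. B $$ (a, i) * voronoi_tensor r s (R i) K0 v)"
        unfolding minkowski_estimator_def B(1) option.sel a_def[symmetric]
        using B(2) a by (simp add: scalar_prod_def)
      also have "{0..<?d + 1} = {..?d}" by auto
      finally show ?thesis .
    qed
    have BA: "(\<Sum>i\<le>?d. B $$ (a, i) * (fact r * fact s * (unit_ball_vol (real (s + j)) * R i ^ (s + j)))) = (if a = j then 1 else 0)"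
      if j: "j \<le> ?d" for j
    proof -
      have "(B * steiner_matrix ?d r s R) $$ (a, j) = (\<Sum>i\<in>{0..<?d + 1}. B $$ (a, i) * (fact r * fact s * (unit_ball_vol (real (s + j)) * R i ^ (s + j))))"
        using B(2) a j by (simp add: scalar_prod_def steiner_matrix_def)
      also have "{0..<?d + 1} = {..?d}" by auto
      finally show ?thesis unfolding B(3) using a j by simp
    qed
    have "(\<Sum>i\<le>?d. B $$ (a, i) * voronoi_tensor r s (R i) K v) =
        (\<Sum>i\<le>?d. \<Sum>j\<le>?d. B $$ (a, i) * (fact r * fact s * (unit_ball_vol (real (s + j)) * R i ^ (s + j))) * minkowski_tensor (?d - j) r s K v)"
    proof (rule sum.cong)
      fix i assume "i \<in> {..?d}"
      then have i: "i \<le> ?d" by simp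
      have "ereal (R i) < reach K" using R_le(2)[OF i] K(4) by (metis ereal_less_eq(3) order.strict_trans1)
      then show "B $$ (a, i) * voronoi_tensor r s (R i) K v =
        (\<Sum>j\<le>?d. B $$ (a, i) * (fact r * fact s * (unit_ball_vol (real (s + j)) * R i ^ (s + j))) * minkowski_tensor (?d - j) r s K v)"
        by (simp only: steiner_tensor_formula[OF K(1,2) R_pos[OF i]] sum_distrib_left mult.assoc)
    qed simp
    also have "\<dots> = (\<Sum>j\<le>?d. (if a = j then 1 else 0) * minkowski_tensor (?d - j) r s K v)"
      by (subst sum.swap, unfold sum_distrib_right[symmetric], rule sum.cong) (simp_all only: BA atMost_iff)
    also have "\<dots> = (\<Sum>j\<le>?d. if a = j then minkowski_tensor (?d - j) r s K v else 0)" by (rule sum.cong) auto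
    also have "\<dots> = minkowski_tensor k r s K v" using a by simp
    finally have tens: "minkowski_tensor k r s K v = (\<Sum>i\<le>?d. B $$ (a, i) * voronoi_tensor r s (R i) K v)" by simp
    define E where "E = D1 * hausdorff_distance K0 K + real (r + s) * D2 * sqrt (hausdorff_distance K0 K)"
    have E: "0 \<le> E" unfolding E_def
      using D(1,2) hausdorff_distance_props(1)[OF K(2,3) K0(2,3) \<rho>] by (intro add_nonneg_nonneg mult_nonneg_nonneg) auto
    have "\<bar>minkowski_estimator R k r s K0 v - minkowski_tensor k r s K v\<bar> =
        \<bar>\<Sum>i\<le>?d. B $$ (a, i) * (voronoi_tensor r s (R i) K0 v - voronoi_tensor r s (R i) K v)\<bar>"
      unfolding est tens by (simp add: right_diff_distrib sum_subtractf)
    also have "\<dots> \<le> (\<Sum>i\<le>?d. \<bar>B $$ (a, i)\<bar> * E)"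
      by (rule order.trans[OF sum_abs], rule sum_mono, unfold abs_mult E_def, rule mult_left_mono[OF D(3)[OF K K0 _ _ v]])
         (use R_le in auto)
    also have "\<dots> = (\<Sum>i\<le>?d. \<bar>B $$ (a, i)\<bar>) * E" by (simp add: sum_distrib_right)
    also have "\<dots> \<le> S * E"
      unfolding S_def using a E
      by (intro mult_right_mono member_le_sum[of a "{..?d}" "\<lambda>a. \<Sum>i\<le>?d. \<bar>B $$ (a, i)\<bar>"]) (auto intro: sum_nonneg)
    also have "\<dots> = S * D1 * hausdorff_distance K0 K + real (r + s) * (S * D2) * sqrt (hausdorff_distance K0 K)"
      by (simp add: E_def algebra_simps)
    finally show "\<bar>minkowski_estimator R k r s K0 v - minkowski_tensor k r s K v\<bar> \<le>
        S * D1 * hausdorff_distance K0 K + real (r + s) * (S * D2) * sqrt (hausdorff_distance K0 K)" .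
  qed
qed

text \<open>Unit vectors exist, so the supremum is over a nonempty set and a bound on all values
  bounds it.\<close>

lemma tensor_norm_le:
  fixes T :: "'a::euclidean_space tensor"
  assumes "\<And>v. \<forall>i<p. norm (v i) = 1 \<Longrightarrow> \<bar>T v\<bar> \<le> C"
  shows "tensor_norm p T \<le> C"
proof -
  obtain b :: 'a where "b \<in> Basis" using nonempty_Basis by blast
  then have "\<bar>T (\<lambda>_. b)\<bar> \<in> {\<bar>T v\<bar> |v. \<forall>i<p. norm (v i) = 1}" by auto
  then show ?thesis unfolding tensor_norm_def using assms by (intro cSup_least) auto
qed

theorem corollary4p6:
  fixes \<rho> :: real and R :: "nat \<Rightarrow> real"
  assumes "\<rho> > 0" and "0 < R 0" and "\<And>i. i < DIM('a::euclidean_space) \<Longrightarrow> R i < R (Suc i)"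
  shows "(\<exists>C\<^sub>4 :: real. \<forall>K K\<^sub>0 :: 'a set.
            compact K \<and> K \<noteq> {} \<and> K \<subseteq> cball 0 \<rho> \<and> 0 < reach K \<and> ereal (R DIM('a)) < reach K \<and>
            compact K\<^sub>0 \<and> K\<^sub>0 \<noteq> {} \<and> K\<^sub>0 \<subseteq> cball 0 \<rho> \<longrightarrow>
            (\<forall>k\<le>DIM('a).
               tensor_norm 0 (\<lambda>v. minkowski_estimator R k 0 0 K\<^sub>0 v - minkowski_tensor k 0 0 K v)
               \<le> C\<^sub>4 * hausdorff_distance K\<^sub>0 K))
       \<and> (\<forall>r s. \<exists>C\<^sub>5 :: real. \<forall>K K\<^sub>0 :: 'a set.
            compact K \<and> K \<noteq> {} \<and> K \<subseteq> cball 0 \<rho> \<and> 0 < reach K \<and> ereal (R DIM('a)) < reach K \<and>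
            compact K\<^sub>0 \<and> K\<^sub>0 \<noteq> {} \<and> K\<^sub>0 \<subseteq> cball 0 \<rho> \<longrightarrow>
            (\<forall>k<DIM('a).
               tensor_norm (r + s) (\<lambda>v. minkowski_estimator R k r s K\<^sub>0 v - minkowski_tensor k r s K v)
               \<le> C\<^sub>5 * sqrt (hausdorff_distance K\<^sub>0 K)))"
proof (intro conjI allI)
  \<comment> \<open>In rank 0 the factor \<open>real (0 + 0)\<close> removes the root term, which
    leaves the linear bound.\<close>
  obtain C1 C2 where C: "0 \<le> C1" "0 \<le> C2" "\<And>(K :: 'a set) K0 k v. compact K \<Longrightarrow> K \<noteq> {} \<Longrightarrow> K \<subseteq> cball 0 \<rho> \<Longrightarrow> ereal (R DIM('a)) < reach K \<Longrightarrow>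
      compact K0 \<Longrightarrow> K0 \<noteq> {} \<Longrightarrow> K0 \<subseteq> cball 0 \<rho> \<Longrightarrow> k \<le> DIM('a) \<Longrightarrow> (\<forall>i<0 + 0. norm (v i) = 1) \<Longrightarrow>
      \<bar>minkowski_estimator R k 0 0 K0 v - minkowski_tensor k 0 0 K v\<bar> \<le>
        C1 * hausdorff_distance K0 K + real (0 + 0) * C2 * sqrt (hausdorff_distance K0 K)"
    by (rule estimator_error[where 'a = 'a, OF assms, of 0 0]) blast+
  then show "\<exists>C\<^sub>4 :: real. \<forall>K K\<^sub>0 :: 'a set.
            compact K \<and> K \<noteq> {} \<and> K \<subseteq> cball 0 \<rho> \<and> 0 < reach K \<and> ereal (R DIM('a)) < reach K \<and>
            compact K\<^sub>0 \<and> K\<^sub>0 \<noteq> {} \<and> K\<^sub>0 \<subseteq> cball 0 \<rho> \<longrightarrow>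
            (\<forall>k\<le>DIM('a).
               tensor_norm 0 (\<lambda>v. minkowski_estimator R k 0 0 K\<^sub>0 v - minkowski_tensor k 0 0 K v)
               \<le> C\<^sub>4 * hausdorff_distance K\<^sub>0 K)"
    by (intro exI[of _ C1] allI impI tensor_norm_le) simp
next
  fix r s
  obtain C1 C2 where C: "0 \<le> C1" "0 \<le> C2" "\<And>(K :: 'a set) K0 k v. compact K \<Longrightarrow> K \<noteq> {} \<Longrightarrow> K \<subseteq> cball 0 \<rho> \<Longrightarrow> ereal (R DIM('a)) < reach K \<Longrightarrow>
      compact K0 \<Longrightarrow> K0 \<noteq> {} \<Longrightarrow> K0 \<subseteq> cball 0 \<rho> \<Longrightarrow> k \<le> DIM('a) \<Longrightarrow> (\<forall>i<r + s. norm (v i) = 1) \<Longrightarrow>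
      \<bar>minkowski_estimator R k r s K0 v - minkowski_tensor k r s K v\<bar> \<le>
        C1 * hausdorff_distance K0 K + real (r + s) * C2 * sqrt (hausdorff_distance K0 K)"
    by (rule estimator_error[where 'a = 'a, OF assms, of r s]) blast+
  \<comment> \<open>The linear term is absorbed by
    \<open>\<epsilon> \<le> sqrt (2 * \<rho>) * sqrt \<epsilon>\<close>, as the distance is at most
    \<open>2 * \<rho>\<close>.\<close>
  define C5 where "C5 = C1 * sqrt (2 * \<rho>) + real (r + s) * C2"
  have "tensor_norm (r + s) (\<lambda>v. minkowski_estimator R k r s K0 v - minkowski_tensor k r s K v) \<le> C5 * sqrt (hausdorff_distance K0 K)"
    if K: "compact K" "K \<noteq> {}" "K \<subseteq> cball 0 \<rho>" "ereal (R DIM('a)) < reach K" and K0: "compact K0" "K0 \<noteq> {}" "K0 \<subseteq> cball 0 \<rho>"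
      and k: "k < DIM('a)" for K K0 :: "'a set" and k
  proof (rule tensor_norm_le)
    fix v :: "nat \<Rightarrow> 'a" assume v: "\<forall>i<r + s. norm (v i) = 1"
    define \<epsilon> where "\<epsilon> = hausdorff_distance K0 K"
    note H = hausdorff_distance_props(1,2)[OF K(2,3) K0(2,3) assms(1), folded \<epsilon>_def]
    have "\<epsilon> = sqrt \<epsilon> * sqrt \<epsilon>" using H by simp
    also have "\<dots> \<le> sqrt (2 * \<rho>) * sqrt \<epsilon>" using H by (intro mult_right_mono) auto
    finally have "C1 * \<epsilon> \<le> C1 * (sqrt (2 * \<rho>) * sqrt \<epsilon>)" using C(1) by (rule mult_left_mono)
    then show "\<bar>minkowski_estimator R k r s K0 v - minkowski_tensor k r s K v\<bar> \<le> C5 * sqrt (hausdorff_distance K0 K)"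
      using C(3)[OF K K0 less_imp_le[OF k] v] by (simp add: C5_def \<epsilon>_def[symmetric] algebra_simps)
  qed
  then show "\<exists>C\<^sub>5 :: real. \<forall>K K\<^sub>0 :: 'a set.
            compact K \<and> K \<noteq> {} \<and> K \<subseteq> cball 0 \<rho> \<and> 0 < reach K \<and> ereal (R DIM('a)) < reach K \<and>
            compact K\<^sub>0 \<and> K\<^sub>0 \<noteq> {} \<and> K\<^sub>0 \<subseteq> cball 0 \<rho> \<longrightarrow>
            (\<forall>k<DIM('a).
               tensor_norm (r + s) (\<lambda>v. minkowski_estimator R k r s K\<^sub>0 v - minkowski_tensor k r s K v)
               \<le> C\<^sub>5 * sqrt (hausdorff_distance K\<^sub>0 K))"
    by (intro exI[of _ C5]) blast
qed

end
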